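(* Let $\mathcal Z_\nu$ be the Zorich map described in the context, built with bi-Lipschitz constant $L$ and scale factor $\lambda$. Suppose $\lambda>L^{5}$ and $\nu>\sqrt{2L/\lambda}$. Then $\mathcal J(\mathcal Z_\nu)=\mathbb R^3$. More strongly, for every nonempty open set $V\subset\mathbb R^3$ one has $\bigcup_{n\ge0}\mathcal Z_\nu^n(V)\supset\mathbb R^3\setminus\{0\}$.
   Context: Zorich maps. Let $Q=\{(x_1,x_2)\in\mathbb R^2:|x_1|\le1,|x_2|\le1\}$. Let $L\ge1$ and let $\mathfrak h=(\mathfrak h_1,\mathfrak h_2,\mathfrak h_3)$ be a sense-preserving $L$-bi-Lipschitz map (i.e. $|a-b|/L\le|\mathfrak h(a)-\mathfrak h(b)|\le L|a-b|$) of $Q$ onto the closed upper unit hemisphere $\{x\in\mathbb R^3:|x|=1,x_3\ge0\}$, with $\partial Q$ mapped onto the equator. Assume $\mathfrak h_1(t,t)=\mathfrak h_2(t,t)$ and $\mathfrak h_1(t,-t)=-\mathfrak h_2(t,-t)$ for $t\in[-1,1]$ (so $\mathfrak h(0,0)=(0,0,1)$). Let $\lambda\ge1$ and $h(x_1,x_2)=\lambda\mathfrak h(x_1/\lambda,x_2/\lambda)$ on $\lambda Q=[-\lambda,\lambda]^2$. For $\nu>0$ set $\mathcal Z_\nu(x_1,x_2,x_3)=\nu e^{x_3}h(x_1,x_2)$ on $\lambda Q\times\mathbb R$ (which is mapped onto $\{x_3\ge0\}$), and extend $\mathcal Z_\nu$ to $\mathbb R^3$ by repeated reflection: in the domain across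 the faces $x_1=(2k+1)\lambda$, $x_2=(2k+1)\lambda$ ($k\in\mathbb Z$) of the beams, and in the range across the plane $x_3=0$. The resulting $\mathcal Z_\nu:\mathbb R^3\to\mathbb R^3$ is quasiregular with an essential singularity at infinity, and $\mathfrak h$, $h$ extend by the same reflections to $L$-Lipschitz maps on $\mathbb R^2$. Julia set. For a quasiregular map $f:\mathbb R^3\to\mathbb R^3$ with essential singularity at infinity, $\mathcal J(f)$ is the set of $x\in\mathbb R^3$ such that $\operatorname{cap}\big(\mathbb R^3\setminus\bigcup_{k\ge1}f^k(U)\big)=0$ for every neighbourhood $U$ of $x$. Here, for an open $A$ and compact $C\subset A$, $\operatorname{cap}(A,C)=\inf_u\int_A|\nabla u|^3\,dm$ over nonnegative $u\in C_0^\infty(A)$ with $u\ge1$ on $C$; a compact $C$ has zero capacity if $\operatorname{cap}(A,C)=0$ for some bounded open $A\supset C$, and an arbitrary set has zero capacity if all its compact subsets do. *)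

theory Defs
  imports "HOL-Complex_Analysis.Complex_Analysis"
begin

definition sqQ :: "(real^2) set" where
  "sqQ = {x. \<bar>x$1\<bar> \<le> 1 \<and> \<bar>x$2\<bar> \<le> 1}"

definition upper_hemisphere :: "(real^3) set" where
  "upper_hemisphere = {x. norm x = 1 \<and> x$3 \<ge> 0}"

definition equator :: "(real^3) set" where
  "equator = {x. norm x = 1 \<and> x$3 = 0}"

definition bdQ_path :: "real \<Rightarrow> complex" where
  "bdQ_path = linepath (Complex 1 (-1)) (Complex 1 1) +++
              (linepath (Complex 1 1) (Complex (-1) 1) +++
              (linepath (Complex (-1) 1) (Complex (-1) (-1)) +++
               linepath (Complex (-1) (-1)) (Complex 1 (-1))))"

text \<open>Sense-preserving: composing with the vertical projection of the upper hemisphere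
  onto the closed unit disc (with the outward orientation of the sphere) the boundary
  square is mapped with degree (winding number) +1 around the centre.\<close>
definition sense_preserving_hemi :: "(real^2 \<Rightarrow> real^3) \<Rightarrow> bool" where
  "sense_preserving_hemi hh \<longleftrightarrow>
     winding_number
       ((\<lambda>z. let v = hh (vector [Re z, Im z]) in Complex (v$1) (v$2)) \<circ> bdQ_path) 0 = 1"

text \<open>Reflection folding of the real line onto [-lambda, lambda] (triangle wave of period
  4 lambda, reflecting across the points (2k+1) lambda) and the parity sign of the number of
  reflections used.\<close>
definition foldpos :: "real \<Rightarrow> real \<Rightarrow> real" where
  "foldpos lam t = (t + lam) - 4 * lam * of_int \<lfloor>(t + lam) / (4 * lam)\<rfloor>"

definition fold_refl :: "real \<Rightarrow> real \<Rightarrow> real" where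
  "fold_refl lam t = (if foldpos lam t \<le> 2 * lam then foldpos lam t - lam
                      else 3 * lam - foldpos lam t)"

definition fold_sign :: "real \<Rightarrow> real \<Rightarrow> real" where
  "fold_sign lam t = (if foldpos lam t \<le> 2 * lam then 1 else -1)"

definition scaled_h :: "real \<Rightarrow> (real^2 \<Rightarrow> real^3) \<Rightarrow> real^2 \<Rightarrow> real^3" where
  "scaled_h lam hh y = lam *\<^sub>R hh ((1 / lam) *\<^sub>R y)"

text \<open>The Zorich map: nu e^{x3} h(x1,x2) on the beam lambda Q x R, extended to R^3 by
  repeated reflection (in the domain across the faces x_i = (2k+1) lambda, in the range
  across the plane x3 = 0).\<close>
definition zorich :: "real \<Rightarrow> real \<Rightarrow> (real^2 \<Rightarrow> real^3) \<Rightarrow> real^3 \<Rightarrow> real^3" where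
  "zorich nu lam hh x =
     (let v = scaled_h lam hh (vector [fold_refl lam (x$1), fold_refl lam (x$2)]);
          s = fold_sign lam (x$1) * fold_sign lam (x$2)
      in (nu * exp (x$3)) *\<^sub>R vector [v$1, v$2, s * v$3])"

definition pderiv3 :: "3 \<Rightarrow> (real^3 \<Rightarrow> real) \<Rightarrow> real^3 \<Rightarrow> real" where
  "pderiv3 i u x = deriv (\<lambda>t. u (x + t *\<^sub>R axis i 1)) 0"

fun pderivs3 :: "(real^3 \<Rightarrow> real) \<Rightarrow> 3 list \<Rightarrow> real^3 \<Rightarrow> real" where
  "pderivs3 u [] = u"
| "pderivs3 u (i # is) = pderiv3 i (pderivs3 u is)"

definition smooth3 :: "(real^3 \<Rightarrow> real) \<Rightarrow> bool" where
  "smooth3 u \<longleftrightarrow> (\<forall>is. continuous_on UNIV (pderivs3 u is) \<and>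
      (\<forall>i x. (\<lambda>t. pderivs3 u is (x + t *\<^sub>R axis i 1)) differentiable (at 0)))"

definition grad3 :: "(real^3 \<Rightarrow> real) \<Rightarrow> real^3 \<Rightarrow> real^3" where
  "grad3 u x = (\<chi> i. pderiv3 i u x)"

definition cap_admissible :: "(real^3) set \<Rightarrow> (real^3) set \<Rightarrow> (real^3 \<Rightarrow> real) \<Rightarrow> bool" where
  "cap_admissible A C u \<longleftrightarrow>
     smooth3 u \<and> compact (closure {x. u x \<noteq> 0}) \<and> closure {x. u x \<noteq> 0} \<subseteq> A \<and>
     (\<forall>x. 0 \<le> u x) \<and> (\<forall>x\<in>C. 1 \<le> u x)"

definition capacity :: "(real^3) set \<Rightarrow> (real^3) set \<Rightarrow> real" where
  "capacity A C = Inf {integral A (\<lambda>x. norm (grad3 u x) ^ 3) | u. cap_admissible A C u}"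

definition compact_zero_cap :: "(real^3) set \<Rightarrow> bool" where
  "compact_zero_cap C \<longleftrightarrow> (\<exists>A. open A \<and> bounded A \<and> C \<subseteq> A \<and> capacity A C = 0)"

definition zero_cap :: "(real^3) set \<Rightarrow> bool" where
  "zero_cap S \<longleftrightarrow> (\<forall>C. C \<subseteq> S \<and> compact C \<longrightarrow> compact_zero_cap C)"

definition julia :: "(real^3 \<Rightarrow> real^3) \<Rightarrow> (real^3) set" where
  "julia f = {x. \<forall>U. open U \<and> x \<in> U \<longrightarrow>
                   zero_cap (UNIV - (\<Union>k\<in>{1..}. (f ^^ k) ` U))}"

end

theory Submission
  imports Defs "HOL-Real_Asymp.Real_Asymp"
begin

text \<open>Every nonempty open set is driven by the iterates onto the vertical axis, in three steps.
  First, the preimage of the planes \<open>x\<^sub>1 = x\<^sub>2\<close> and \<open>x\<^sub>1 = - x\<^sub>2\<close> cuts the space into diamond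
  beams, each consisting of parts of two square beams with images in opposite half-spaces. With respect to the measure
  \<open>dx / r\<^sup>3\<close>, where \<open>r\<close> is the distance to the axis, volumes grow by the factor \<open>lam / L ^ 5 > 1\<close>.
  So if the iterates of a ball avoided these planes, almost every orbit would visit any bounded
  region away from the axis only finitely often; along such an orbit the products of the linear
  expansion factors are unbounded, and the images would contain balls too large for a diamond
  beam. Second, the planes are invariant with image in the upper half-space, and there area grows
  by \<open>lam * nu\<^sup>2 / L > 2\<close> while the map is at most two-to-one over each strip, so that the same
  argument leads from the planes to the axis. Third, points of the axis escape, small balls around
  them grow, and a large ball at great height covers everything but the origin after two more
  steps. No differentiability is used: the bi-Lipschitz bound gives explicit inverse estimates on
  each beam, and a Vitali covering in the image turns them into measure estimates. Finally, a
  point has zero capacity.\<close>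

text \<open>The obstacle is that \<open>Z\<close> contracts strongly at very negative heights: its
  expansion factor is of order \<open>nu * exp x\<^sub>3\<close>, so Lebesgue measure is not
  expanded. The weight \<open>1 / r ^ 3\<close> repairs this, because the distance to the axis is
  also multiplied by at most a constant times \<open>nu * exp x\<^sub>3\<close>, and the
  exponentials cancel in the quotient. The price is that the weight is not integrable at the axis,
  so the measure argument is silent there: it only yields an orbit that is, from some time on, near
  the axis or at great height. For such an orbit the linear expansion is followed instead. What
  limits it are the vertical lines through the centres of the square beams, which \<open>Z\<close>
  maps into the axis and which every large ball must hit. On the invariant planes heights are
  nonnegative after one step, so plain area expands; but there two sheets are folded onto each
  other, hence the factor two in the condition on \<open>nu\<close>.\<close>

no_notation fps_nth (infixl "$" 75)

section \<open>A point has zero capacity\<close>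

definition flat :: "real poly \<Rightarrow> real \<Rightarrow> real" where
  "flat p t = (if t > 0 then poly p (1 / t) * exp (- (1 / t)) else 0)"

lemma poly_times_exp_uminus_tendsto_0:
  fixes q :: "real poly"
  shows "((\<lambda>x. poly q x * exp (- x)) \<longlongrightarrow> 0) at_top"
proof -
  have "((\<lambda>x. \<Sum>i\<le>degree q. coeff q i * (x ^ i / exp x)) \<longlongrightarrow> (\<Sum>i\<le>degree q. coeff q i * 0)) at_top"
    by (intro tendsto_intros tendsto_power_div_exp_0)
  then show ?thesis
    by (simp add: poly_altdef exp_minus sum_distrib_right divide_inverse mult.assoc)
qed

lemma flat_at_right_0:
  "((\<lambda>t. poly q (1 / t) * exp (- (1 / t))) \<longlongrightarrow> 0) (at_right (0::real))"
  using filterlim_compose [OF poly_times_exp_uminus_tendsto_0 filterlim_inverse_at_top_right, of q]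
  by (simp add: inverse_eq_divide)

text \<open>The polynomial factor in \<open>flat\<close> is there for this closure: differentiating
  \<open>p (1/t) * exp (- 1/t)\<close> only replaces \<open>p\<close> by
  \<open>X ^ 2 * (p - p')\<close>, so one statement yields derivatives of all orders, including at
  0.\<close>

lemma flat_has_derivative:
  "(flat p has_real_derivative flat ([:0, 0, 1:] * (p - pderiv p)) t) (at t)"
proof -
  consider "t > 0" | "t < 0" | "t = 0" by linarith
  then show ?thesis
  proof cases
    case 1
    have "((\<lambda>t. poly p (1 / t) * exp (- (1 / t))) has_real_derivative
        flat ([:0, 0, 1:] * (p - pderiv p)) t) (at t)"
      using 1 by (auto intro!: derivative_eq_intros simp: flat_def power2_eq_square field_simps)
    then show ?thesis
      by (rule has_field_derivative_transform_within [where d = t])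
         (use 1 in \<open>auto simp: flat_def dist_real_def\<close>)
  next
    case 2
    have "((\<lambda>_. 0) has_real_derivative flat ([:0, 0, 1:] * (p - pderiv p)) t) (at t)"
      using 2 by (simp add: flat_def)
    then show ?thesis
      by (rule has_field_derivative_transform_within [where d = "- t"])
         (use 2 in \<open>auto simp: flat_def dist_real_def\<close>)
  next
    case 3
    have "((\<lambda>h. flat p h / h) \<longlongrightarrow> 0) (at 0)"
    proof (rule filterlim_split_at)
      show "((\<lambda>h. flat p h / h) \<longlongrightarrow> 0) (at_left 0)"
        by (rule tendsto_eventually) (auto simp: flat_def eventually_at_filter)
      \<comment> \<open>For positive \<open>h\<close> the difference quotient at 0 has the same form
        again, with \<open>X * p\<close> in place of \<open>p\<close>.\<close>
      have "((\<lambda>h. poly ([:0, 1:] * p) (1 / h) * exp (- (1 / h))) \<longlongrightarrow> 0) (at_right 0)"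
        by (rule flat_at_right_0)
      then show "((\<lambda>h. flat p h / h) \<longlongrightarrow> 0) (at_right 0)"
        by (rule Lim_transform_eventually) (auto simp: flat_def eventually_at_filter)
    qed
    then show ?thesis
      using 3 by (simp add: DERIV_def flat_def)
  qed
qed

text \<open>A class of continuous functions closed under partial derivatives; membership gives
  \<open>smooth3\<close> with no bookkeeping of higher derivatives.\<close>

inductive bump_algebra :: "(real^3 \<Rightarrow> real) \<Rightarrow> bool" where
  const: "bump_algebra (\<lambda>_. c)"
| coord: "bump_algebra (\<lambda>x. x $ i)"
| flat: "bump_algebra (\<lambda>x. flat p (1 - c * (x \<bullet> x)))"
| add: "bump_algebra u \<Longrightarrow> bump_algebra v \<Longrightarrow> bump_algebra (\<lambda>x. u x + v x)"
| mult: "bump_algebra u \<Longrightarrow> bump_algebra v \<Longrightarrow> bump_algebra (\<lambda>x. u x * v x)"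

lemma continuous_on_flat [continuous_intros]:
  "continuous_on S f \<Longrightarrow> continuous_on S (\<lambda>x. flat p (f x))"
  by (rule continuous_on_compose2 [of UNIV "flat p"])
     (auto intro!: continuous_at_imp_continuous_on DERIV_isCont flat_has_derivative)

lemma bump_algebra_continuous: "bump_algebra u \<Longrightarrow> continuous_on UNIV u"
  by (induction rule: bump_algebra.induct) (auto intro!: continuous_intros)

lemma flat_radial_partial_derivative:
  "((\<lambda>t. flat p (1 - c * ((x + t *\<^sub>R axis i 1) \<bullet> (x + t *\<^sub>R axis i 1)))) has_real_derivative
     flat ([:0, 0, 1:] * (p - pderiv p)) (1 - c * (x \<bullet> x)) * (- 2 * c * x $ i)) (at 0)"
  for x :: "real^3"
proof -
  have ip: "(x + t *\<^sub>R axis i 1) \<bullet> (x + t *\<^sub>R axis i 1) = x \<bullet> x + 2 * t * x $ i + t\<^sup>2" for t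
    by (simp add: inner_add_left inner_add_right inner_axis inner_axis' power2_eq_square)
       (simp add: axis_def algebra_simps)
  have "((\<lambda>t. 1 - c * (x \<bullet> x + 2 * t * x $ i + t\<^sup>2)) has_real_derivative - 2 * c * x $ i) (at 0)"
    by (auto intro!: derivative_eq_intros)
  with flat_has_derivative [of p] have
    "((\<lambda>t. flat p (1 - c * (x \<bullet> x + 2 * t * x $ i + t\<^sup>2))) has_real_derivative
       flat ([:0, 0, 1:] * (p - pderiv p)) (1 - c * (x \<bullet> x)) * (- 2 * c * x $ i)) (at 0)"
    by (intro DERIV_chain2 [of "flat p"]) auto
  then show ?thesis unfolding ip .
qed

lemma bump_algebra_partial_derivative:
  assumes "bump_algebra u"
  shows "\<exists>v. bump_algebra v \<and>
    (\<forall>x. ((\<lambda>t. u (x + t *\<^sub>R axis i 1)) has_real_derivative v x) (at 0))"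
  using assms
proof induction
  case (const c)
  show ?case by (auto intro!: exI [of _ "\<lambda>_. 0"] bump_algebra.intros)
next
  case (coord j)
  show ?case
    by (auto intro!: exI [of _ "\<lambda>_. axis i 1 $ j"] bump_algebra.intros derivative_eq_intros)
next
  case (flat p c)
  show ?case
    by (intro exI conjI allI, rule bump_algebra.mult [OF bump_algebra.flat
          bump_algebra.mult [OF bump_algebra.const bump_algebra.coord]])
       (rule flat_radial_partial_derivative)
next
  case (add u v)
  then obtain u' v' where "bump_algebra u'" "bump_algebra v'"
    and "\<forall>x. ((\<lambda>t. u (x + t *\<^sub>R axis i 1)) has_real_derivative u' x) (at 0)"
    and "\<forall>x. ((\<lambda>t. v (x + t *\<^sub>R axis i 1)) has_real_derivative v' x) (at 0)" by blast
  then show ?case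
    by (intro exI [of _ "\<lambda>x. u' x + v' x"])
       (auto intro!: bump_algebra.intros DERIV_add)
next
  case (mult u v)
  then obtain u' v' where "bump_algebra u'" "bump_algebra v'"
    and "\<forall>x. ((\<lambda>t. u (x + t *\<^sub>R axis i 1)) has_real_derivative u' x) (at 0)"
    and "\<forall>x. ((\<lambda>t. v (x + t *\<^sub>R axis i 1)) has_real_derivative v' x) (at 0)" by blast
  then show ?case using mult.hyps
    by (intro exI [of _ "\<lambda>x. u' x * v x + v' x * u x"])
       (auto intro!: bump_algebra.intros derivative_eq_intros)
qed

lemma bump_algebra_pderiv3:
  assumes "bump_algebra u"
  shows "bump_algebra (pderiv3 i u)"
    and "((\<lambda>t. u (x + t *\<^sub>R axis i 1)) has_real_derivative pderiv3 i u x) (at 0)"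
proof -
  obtain v where v: "bump_algebra v"
      "\<And>x. ((\<lambda>t. u (x + t *\<^sub>R axis i 1)) has_real_derivative v x) (at 0)"
    using bump_algebra_partial_derivative [OF assms] by blast
  then have "pderiv3 i u = v"
    by (auto simp: pderiv3_def fun_eq_iff intro!: DERIV_imp_deriv)
  with v show "bump_algebra (pderiv3 i u)"
    "((\<lambda>t. u (x + t *\<^sub>R axis i 1)) has_real_derivative pderiv3 i u x) (at 0)" by auto
qed

lemma bump_algebra_smooth3:
  assumes "bump_algebra u"
  shows "smooth3 u"
proof -
  have "bump_algebra (pderivs3 u is)" for "is"
    by (induction "is") (auto intro: assms bump_algebra_pderiv3)
  then show ?thesis
    unfolding smooth3_def
    using bump_algebra_continuous bump_algebra_pderiv3(2) real_differentiable_def by blast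
qed

section \<open>Logarithmic test functions of small 3-energy\<close>

lemma bump_algebra_sum:
  "(\<And>k. k \<in> I \<Longrightarrow> bump_algebra (f k)) \<Longrightarrow> finite I \<Longrightarrow> bump_algebra (\<lambda>x. \<Sum>k\<in>I. f k x)"
  by (induction I rule: infinite_finite_induct) (auto intro: bump_algebra.intros)

text \<open>A smooth discretisation of a multiple of the logarithm, the extremal profile for
  3-capacity in dimension 3: \<open>N\<close> bumps on balls shrinking dyadically to the origin,
  each normalised through \<open>flat 1 1 = exp (- 1)\<close> to the value \<open>1 / N\<close> at
  0.\<close>

definition log_bump :: "nat \<Rightarrow> real^3 \<Rightarrow> real" where
  "log_bump N x = (\<Sum>k<N. (exp 1 / N) * flat 1 (1 - 4 ^ k * (x \<bullet> x)))"

lemma bump_algebra_log_bump: "bump_algebra (log_bump N)"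
  unfolding log_bump_def by (intro bump_algebra_sum bump_algebra.intros) auto

lemma flat_nonneg: "flat 1 t \<ge> 0"
  by (simp add: flat_def)

lemma pderiv3_log_bump:
  "pderiv3 i (log_bump N) x =
     (\<Sum>k<N. (exp 1 / N) * (flat [:0, 0, 1:] (1 - 4 ^ k * (x \<bullet> x)) * (- 2 * 4 ^ k * x $ i)))"
proof -
  have "((\<lambda>t. log_bump N (x + t *\<^sub>R axis i 1)) has_real_derivative
     (\<Sum>k<N. (exp 1 / N) * (flat ([:0, 0, 1:] * (1 - pderiv 1)) (1 - 4 ^ k * (x \<bullet> x)) * (- 2 * 4 ^ k * x $ i)))) (at 0)"
    unfolding log_bump_def
    by (intro DERIV_sum DERIV_cmult flat_radial_partial_derivative)
  then show ?thesis
    unfolding pderiv3_def by (auto dest: DERIV_imp_deriv)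
qed

lemma flat_square_bounds: "0 \<le> flat [:0, 0, 1:] t" "flat [:0, 0, 1:] t \<le> 2"
proof -
  show "0 \<le> flat [:0, 0, 1:] t" by (simp add: flat_def)
  have "s ^ 2 * exp (- s) \<le> 2" if "s > 0" for s :: real
    using exp_lower_Taylor_quadratic [of s] that by (simp add: exp_minus field_simps)
  from this [of "1 / t"] show "flat [:0, 0, 1:] t \<le> 2"
    by (auto simp: flat_def power2_eq_square)
qed

text \<open>The supports of the summands shrink dyadically while their gradients grow like \<open>2 ^ k\<close>,
  so at every point the gradient of the sum is dominated by that of the last active summand.\<close>

lemma norm_grad3_log_bump:
  assumes "N > 0"
  shows "norm (grad3 (log_bump N) x) ^ 3 \<le>
     (72 / N) ^ 3 * (\<Sum>k<N. 8 ^ k * indicator (ball 0 ((1 / 2) ^ k)) x)"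
proof -
  define I where "I = {k. k < N \<and> x \<in> ball 0 ((1 / 2) ^ k)}"
  have finI: "finite I" unfolding I_def by auto
  define S where "S = (\<Sum>k\<in>I. 4 ^ k * norm x)"
  have inI: "k \<in> I \<longleftrightarrow> k < N \<and> 2 ^ k * norm x < 1" for k
    unfolding I_def by (auto simp: field_simps power_one_over)
  \<comment> \<open>12 = 3 * 2 * 2: \<open>exp 1 \<le> 3\<close>, the bound 2 of
    \<open>flat_square_bounds\<close>, and the 2 of the inner derivative. Adding three components
    gives 36, and \<open>S \<le> 2 * 2 ^ J\<close> below turns 36 into 72.\<close>
  have comp: "\<bar>grad3 (log_bump N) x $ i\<bar> \<le> 12 / N * S" for i
  proof -
    have "\<bar>grad3 (log_bump N) x $ i\<bar> \<le>
        (\<Sum>k<N. (exp 1 / N) * (flat [:0, 0, 1:] (1 - 4 ^ k * (x \<bullet> x)) * (2 * 4 ^ k * \<bar>x $ i\<bar>)))"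
      unfolding grad3_def
      by (simp add: pderiv3_log_bump, rule order_trans [OF sum_abs])
         (auto intro!: sum_mono simp: abs_mult flat_square_bounds)
    also have "\<dots> = (\<Sum>k\<in>I. (exp 1 / N) * (flat [:0, 0, 1:] (1 - 4 ^ k * (x \<bullet> x)) * (2 * 4 ^ k * \<bar>x $ i\<bar>)))"
    proof (rule sum.mono_neutral_right)
      show "\<forall>k\<in>{..<N} - I. exp 1 / N * (flat [:0, 0, 1:] (1 - 4 ^ k * (x \<bullet> x)) * (2 * 4 ^ k * \<bar>x $ i\<bar>)) = 0"
      proof
        fix k assume "k \<in> {..<N} - I"
        then have "1 \<le> 2 ^ k * norm x" by (auto simp: inI)
        then have "1 \<le> (2 ^ k * norm x)\<^sup>2" by (simp add: one_le_power)
        then have "1 \<le> 4 ^ k * (x \<bullet> x)"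
        proof -
          have "((2::real) ^ k) ^ 2 = (2 ^ 2) ^ k"
            by (simp only: power_mult [symmetric] mult.commute)
          with \<open>1 \<le> (2 ^ k * norm x)\<^sup>2\<close> show ?thesis
            by (simp add: power_mult_distrib power2_norm_eq_inner)
        qed
        then show "exp 1 / N * (flat [:0, 0, 1:] (1 - 4 ^ k * (x \<bullet> x)) * (2 * 4 ^ k * \<bar>x $ i\<bar>)) = 0"
          by (simp add: flat_def)
      qed
    qed (auto simp: I_def)
    also have "\<dots> \<le> (\<Sum>k\<in>I. (3 / N) * (2 * (2 * 4 ^ k * norm x)))"
      using component_le_norm_cart [of x i] flat_square_bounds exp_le
      by (intro sum_mono mult_mono divide_right_mono) auto
    also have "\<dots> = 12 / N * S"
      by (simp add: S_def sum_distrib_left algebra_simps)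
    finally show ?thesis .
  qed
  have "norm (grad3 (log_bump N) x) \<le> (\<Sum>i\<in>UNIV. \<bar>grad3 (log_bump N) x $ i\<bar>)"
    by (rule norm_le_l1_cart)
  also have "\<dots> \<le> (\<Sum>i\<in>(UNIV :: 3 set). 12 / N * S)"
    by (intro sum_mono comp)
  finally have g: "norm (grad3 (log_bump N) x) \<le> 36 / N * S" by simp
  have S3: "S ^ 3 \<le> 8 * (\<Sum>k<N. 8 ^ k * indicator (ball 0 ((1 / 2) ^ k)) x)"
  proof (cases "I = {}")
    case True
    then show ?thesis by (auto simp: S_def intro!: sum_nonneg)
  next
    case False
    define J where "J = Max I"
    have J: "J \<in> I" using False finI by (simp add: J_def)
    have "S \<le> (\<Sum>k\<le>J. 4 ^ k * norm x)"
      unfolding S_def using finI by (intro sum_mono2) (auto simp: J_def)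
    also have "(\<Sum>k\<le>J. 4 ^ k * norm x) = (\<Sum>k<Suc J. 4 ^ k) * norm x"
      by (simp add: sum_distrib_right lessThan_Suc_atMost)
    also have "\<dots> \<le> (2 * 4 ^ J) * norm x"
      by (intro mult_right_mono) (auto simp: geometric_sum intro: order_trans [of _ 0])
    also have "\<dots> = 2 * 2 ^ J * (2 ^ J * norm x)"
      by (simp add: power_mult_distrib [symmetric])
    also have "\<dots> \<le> 2 * 2 ^ J * 1"
      using J by (intro mult_left_mono) (auto simp: inI)
    finally have "S \<le> 2 * 2 ^ J" by simp
    then have "S ^ 3 \<le> (2 * 2 ^ J) ^ 3"
      by (rule power_mono) (auto simp: S_def intro!: sum_nonneg)
    also have "\<dots> = 8 * 8 ^ J"
    proof -
      have "((2::real) ^ J) ^ 3 = (2 ^ 3) ^ J"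
        by (simp only: power_mult [symmetric] mult.commute)
      then show ?thesis by (simp add: power_mult_distrib)
    qed
    also have "(8::real) ^ J \<le> (\<Sum>k<N. 8 ^ k * indicator (ball 0 ((1 / 2) ^ k)) x)"
      using member_le_sum [of J "{..<N}" "\<lambda>k. 8 ^ k * indicator (ball 0 ((1 / 2) ^ k)) x :: real"] J
      by (auto simp: I_def)
    finally show ?thesis by simp
  qed
  have "norm (grad3 (log_bump N) x) ^ 3 \<le> (36 / N * S) ^ 3"
    by (intro power_mono g) auto
  also have "\<dots> = (36 / N) ^ 3 * S ^ 3" by (rule power_mult_distrib)
  also have "\<dots> \<le> (36 / N) ^ 3 * (8 * (\<Sum>k<N. 8 ^ k * indicator (ball 0 ((1 / 2) ^ k)) x))"
    by (intro mult_left_mono S3) auto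
  also have "\<dots> = (72 / N) ^ 3 * (\<Sum>k<N. 8 ^ k * indicator (ball 0 ((1 / 2) ^ k)) x)"
    by (simp add: power_divide)
  finally show ?thesis .
qed

text \<open>Scale invariance of the 3-energy: each of the \<open>N\<close> dyadic balls contributes
  the same amount, since \<open>8 ^ k\<close> cancels its volume. The total is of order
  \<open>N * (1 / N) ^ 3\<close>.\<close>

lemma integral_grad3_log_bump:
  assumes "N > 0"
  shows "integral (ball 0 2) (\<lambda>x. norm (grad3 (log_bump N) x) ^ 3) \<le>
     72 ^ 3 * unit_ball_vol 3 / N\<^sup>2"
proof -
  have ind: "((\<lambda>x::real^3. indicator (ball 0 ((1 / 2) ^ k)) x) has_integral unit_ball_vol 3 / 8 ^ k) (ball 0 2)"
    for k
  proof -
    let ?B = "ball (0::real^3) ((1 / 2) ^ k)"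
    have "(indicat_real ?B has_integral measure lebesgue ?B) UNIV"
      using lmeasurable_ball by (simp only: lmeasurable_iff_has_integral)
    then have "((\<lambda>x. if x \<in> ball 0 2 then indicat_real ?B x else 0) has_integral measure lebesgue ?B) UNIV"
      using power_le_one [of "1/2::real" k]
      by (elim has_integral_eq [rotated]) (auto simp: indicator_def)
    then have "(indicat_real ?B has_integral measure lebesgue ?B) (ball 0 2)"
      by (simp only: has_integral_restrict_UNIV)
    moreover have "measure lebesgue (ball (0::real^3) ((1 / 2) ^ k)) = unit_ball_vol 3 / 8 ^ k"
    proof -
      have "((1 / 2) ^ k) ^ 3 = ((1 / 2 :: real) ^ 3) ^ k"
        by (simp only: power_mult [symmetric] mult.commute)
      then show ?thesis
        using content_ball [of "(1 / 2) ^ k" "0::real^3"]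
        by (simp add: measure_completion power3_eq_cube power_one_over)
    qed
    ultimately show ?thesis by simp
  qed
  have bound: "((\<lambda>x. (72 / N) ^ 3 * (\<Sum>k<N. 8 ^ k * indicator (ball 0 ((1 / 2) ^ k)) x)) has_integral
     (72 / N) ^ 3 * (\<Sum>k<N. 8 ^ k * (unit_ball_vol 3 / 8 ^ k))) (ball (0::real^3) 2)"
    by (intro has_integral_mult_right has_integral_sum ind) auto
  have "continuous_on UNIV (\<lambda>x. norm (grad3 (log_bump N) x) ^ 3)"
    unfolding grad3_def
    by (intro continuous_intros continuous_on_vec_lambda bump_algebra_continuous
        bump_algebra_pderiv3 bump_algebra_log_bump)
  moreover obtain c where c: "ball (0::real^3) 2 \<subseteq> cbox (- c) c"
    using bounded_subset_cbox_symmetric [OF bounded_ball] by blast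
  ultimately have "(\<lambda>x. norm (grad3 (log_bump N) x) ^ 3) absolutely_integrable_on cbox (- c) c"
    using absolutely_integrable_continuous continuous_on_subset by blast
  then have "(\<lambda>x. norm (grad3 (log_bump N) x) ^ 3) absolutely_integrable_on ball 0 2"
    by (rule set_integrable_subset) (use c in auto)
  then have int: "(\<lambda>x. norm (grad3 (log_bump N) x) ^ 3) integrable_on ball 0 2"
    using set_lebesgue_integral_eq_integral(1) by blast
  have "integral (ball 0 2) (\<lambda>x. norm (grad3 (log_bump N) x) ^ 3) \<le>
     (72 / N) ^ 3 * (\<Sum>k<N. 8 ^ k * (unit_ball_vol 3 / 8 ^ k))"
    using norm_grad3_log_bump [OF assms] by (rule has_integral_le [OF integrable_integral [OF int] bound])
  also have "\<dots> = 72 ^ 3 * unit_ball_vol 3 / N\<^sup>2"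
    using assms by (simp add: field_simps power2_eq_square power3_eq_cube)
  finally show ?thesis .
qed

lemma log_bump_admissible:
  assumes "N > 0" "C \<subseteq> {0}"
  shows "cap_admissible (ball 0 2) C (log_bump N)"
proof -
  have "log_bump N x = 0" if "norm x \<ge> 1" for x
  proof -
    have "flat 1 (1 - 4 ^ k * (x \<bullet> x)) = 0" for k
    proof -
      have "1 * 1 \<le> 4 ^ k * (x \<bullet> x)"
        using that by (intro mult_mono) (auto simp: dot_square_norm)
      then show ?thesis by (simp add: flat_def)
    qed
    then show ?thesis by (simp add: log_bump_def)
  qed
  then have "{x. log_bump N x \<noteq> 0} \<subseteq> cball 0 1"
    by (force simp: not_le)
  then have sub: "closure {x. log_bump N x \<noteq> 0} \<subseteq> cball 0 1"
    by (rule closure_minimal) auto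
  then have "compact (closure {x. log_bump N x \<noteq> 0})"
    using bounded_subset compact_eq_bounded_closed by blast
  moreover have "log_bump N 0 = 1"
    using assms by (simp add: log_bump_def flat_def exp_minus)
  moreover have "0 \<le> log_bump N x" for x
    unfolding log_bump_def by (intro sum_nonneg mult_nonneg_nonneg flat_nonneg) auto
  moreover have "cball (0::real^3) 1 \<subseteq> ball 0 2" by auto
  ultimately show ?thesis
    using sub assms bump_algebra_smooth3 [OF bump_algebra_log_bump]
    unfolding cap_admissible_def by auto
qed

lemma zero_cap_subset_origin:
  assumes "S \<subseteq> {0}"
  shows "zero_cap S"
proof -
  have "compact_zero_cap C" if "C \<subseteq> {0}" for C
  proof -
    let ?V = "{integral (ball 0 2) (\<lambda>x. norm (grad3 u x) ^ 3) | u. cap_admissible (ball 0 2) C u}"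
    have nonneg: "0 \<le> v" if "v \<in> ?V" for v
    proof -
      obtain u where v: "v = integral (ball 0 2) (\<lambda>x. norm (grad3 u x) ^ 3)"
        using \<open>v \<in> ?V\<close> by blast
      \<comment> \<open>A non-integrable integrand has \<open>integral\<close> equal to 0 by
        default, which is nonnegative as well.\<close>
      show ?thesis
      proof (cases "(\<lambda>x. norm (grad3 u x) ^ 3) integrable_on ball 0 2")
        case True
        then show ?thesis unfolding v by (rule Henstock_Kurzweil_Integration.integral_nonneg) simp
      next
        case False
        then show ?thesis unfolding v by (simp add: not_integrable_integral)
      qed
    qed
    have small: "\<exists>v\<in>?V. v < e" if "e > 0" for e
    proof -
      have "(\<lambda>N. 72 ^ 3 * unit_ball_vol 3 / (real N)\<^sup>2) \<longlonglongrightarrow> 0"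
        by (intro tendsto_divide_0 [OF tendsto_const] filterlim_at_top_imp_at_infinity
            filterlim_pow_at_top filterlim_real_sequentially) auto
      then have "eventually (\<lambda>N. 72 ^ 3 * unit_ball_vol 3 / (real N)\<^sup>2 < e \<and> N > 0) sequentially"
        using that by (intro eventually_conj order_tendstoD eventually_gt_at_top)
      then obtain N :: nat where "72 ^ 3 * unit_ball_vol 3 / (real N)\<^sup>2 < e" "N > 0"
        by (metis (mono_tags, lifting) eventually_sequentially order_refl)
      then show ?thesis
        using integral_grad3_log_bump [of N] log_bump_admissible [OF _ \<open>C \<subseteq> {0}\<close>, of N] by force
    qed
    have bdd: "bdd_below ?V" using nonneg by (meson bdd_below.I)
    \<comment> \<open>\<open>Inf\<close> on the reals is meaningful only for nonempty sets that are
      bounded below, so this and \<open>bdd\<close> are both used.\<close>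
    have "?V \<noteq> {}" using log_bump_admissible [OF _ \<open>C \<subseteq> {0}\<close>, of 1] by auto
    then have "0 \<le> Inf ?V"
      using nonneg by (intro cInf_greatest)
    moreover have "Inf ?V \<le> 0"
    proof (rule dense_ge)
      fix e :: real assume "0 < e"
      then obtain v where "v \<in> ?V" "v < e" using small by blast
      with cInf_lower [OF \<open>v \<in> ?V\<close> bdd] show "Inf ?V \<le> e" by linarith
    qed
    ultimately have "Inf ?V = 0" by linarith
    then show ?thesis
      using that unfolding compact_zero_cap_def capacity_def
      by (intro exI [of _ "ball 0 2"]) auto
  qed
  then show ?thesis
    using assms unfolding zero_cap_def by auto
qed

section \<open>Measure expansion from Lipschitz estimates\<close>

text \<open>Here \<open>g\<close> is to be an inverse branch. Disjoint small balls exhaust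
  \<open>F\<close> up to a null set, and \<open>lips\<close> makes the image of that null set null;
  the admissible radii and the Lipschitz constant may depend on the point.\<close>

lemma emeasure_image_le_Vitali:
  fixes g :: "'a::euclidean_space \<Rightarrow> 'a" and \<mu> :: "'a measure"
  assumes sets: "sets \<mu> = sets borel"
    and ac: "\<And>N. N \<in> sets borel \<Longrightarrow> negligible N \<Longrightarrow> emeasure \<mu> N = 0"
    and F: "open F" "inj_on g F" "g ` F \<in> sets borel"
    and lips: "\<And>y. y \<in> F \<Longrightarrow> \<exists>T B. open T \<and> y \<in> T \<and> (\<forall>w \<in> F \<inter> T. norm (g w - g y) \<le> B * norm (w - y))"
    and loc: "\<And>y. y \<in> F \<Longrightarrow> \<exists>d>0. \<forall>r. 0 < r \<and> r < d \<longrightarrow> cball y r \<subseteq> F \<and>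
       emeasure \<mu> (g ` cball y r) \<le> k * emeasure \<mu> (cball y r)"
  shows "emeasure \<mu> (g ` F) \<le> k * emeasure \<mu> F"
proof -
  obtain d where d: "\<And>y. y \<in> F \<Longrightarrow> d y > 0"
    "\<And>y r. y \<in> F \<Longrightarrow> 0 < r \<Longrightarrow> r < d y \<Longrightarrow> cball y r \<subseteq> F \<and>
       emeasure \<mu> (g ` cball y r) \<le> k * emeasure \<mu> (cball y r)"
    using loc by metis
  \<comment> \<open>Centre and radius together form the index, because the covering theorem asks for
    arbitrarily small balls at every point.\<close>
  define K where "K = {(y, r). y \<in> F \<and> 0 < r \<and> r < d y}"
  obtain C where C: "countable C" "C \<subseteq> K"
    "pairwise (\<lambda>i j. disjnt (cball (fst i) (snd i)) (cball (fst j) (snd j))) C"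
    "negligible (F - (\<Union>i \<in> C. cball (fst i) (snd i)))"
  proof (rule Vitali_covering_theorem_cballs [of K snd F fst])
    show "0 < snd i" if "i \<in> K" for i using that by (auto simp: K_def)
    show "\<exists>i. i \<in> K \<and> x \<in> cball (fst i) (snd i) \<and> snd i < e" if "x \<in> F" "0 < e" for x e
      using that d(1) [OF that(1)] by (intro exI [of _ "(x, min e (d x) / 2)"]) (auto simp: K_def)
  qed
  have CF: "cball (fst i) (snd i) \<subseteq> F"
    and Ck: "emeasure \<mu> (g ` cball (fst i) (snd i)) \<le> k * emeasure \<mu> (cball (fst i) (snd i))"
    if "i \<in> C" for i
  proof -
    have "fst i \<in> F" "0 < snd i" "snd i < d (fst i)" using that C(2) by (auto simp: K_def)
    from d(2) [OF this] show "cball (fst i) (snd i) \<subseteq> F"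
      "emeasure \<mu> (g ` cball (fst i) (snd i)) \<le> k * emeasure \<mu> (cball (fst i) (snd i))" by auto
  qed
  have cont: "continuous_on F g"
    unfolding continuous_on_def
  proof
    fix y assume y: "y \<in> F"
    obtain T B where T: "open T" "y \<in> T" "\<And>w. w \<in> F \<inter> T \<Longrightarrow> norm (g w - g y) \<le> B * norm (w - y)"
      using lips [OF y] by blast
    have "((\<lambda>w. B * norm (w - y)) \<longlongrightarrow> B * norm (y - y)) (at y within F)"
      by (intro tendsto_intros)
    then have lim: "((\<lambda>w. B * norm (w - y)) \<longlongrightarrow> 0) (at y within F)" by simp
    have "eventually (\<lambda>w. norm (g w - g y) \<le> B * norm (w - y)) (at y within F)"
      using T unfolding eventually_at_topological by blast
    from Lim_null_comparison [OF this lim] show "(g \<longlongrightarrow> g y) (at y within F)"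
      by (simp add: LIM_zero_iff)
  qed
  have meas: "g ` cball (fst i) (snd i) \<in> sets \<mu>" if "i \<in> C" for i
    unfolding sets
    by (intro borel_compact compact_continuous_image continuous_on_subset [OF cont] CF that compact_cball)
  define U where "U = (\<Union>i \<in> C. g ` cball (fst i) (snd i))"
  have Um: "U \<in> sets \<mu>" unfolding U_def using C(1) meas by (intro sets.countable_UN') auto
  have "negligible (g ` (F - (\<Union>i \<in> C. cball (fst i) (snd i))))"
  proof (rule negligible_locally_Lipschitz_image [OF _ C(4)])
    fix y assume "y \<in> F - (\<Union>i \<in> C. cball (fst i) (snd i))"
    then show "\<exists>T B. open T \<and> y \<in> T \<and> (\<forall>w \<in> (F - (\<Union>i \<in> C. cball (fst i) (snd i))) \<inter> T. norm (g w - g y) \<le> B * norm (w - y))"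
      using lips [of y] by blast
  qed simp
  then have "negligible (g ` F - U)" by (rule negligible_subset) (auto simp: U_def)
  then have null: "emeasure \<mu> (g ` F - U) = 0" using F(3) Um sets by (intro ac) auto
  have "emeasure \<mu> (g ` F) \<le> emeasure \<mu> (U \<union> (g ` F - U))"
    using Um F(3) sets by (intro emeasure_mono) auto
  also have "\<dots> \<le> emeasure \<mu> U + emeasure \<mu> (g ` F - U)"
    using Um F(3) sets by (intro emeasure_subadditive) auto
  also have "\<dots> = emeasure \<mu> U" by (simp add: null)
  also have "\<dots> = (\<integral>\<^sup>+i. emeasure \<mu> (g ` cball (fst i) (snd i)) \<partial>count_space C)"
    unfolding U_def
  proof (rule emeasure_UN_countable [OF meas C(1)])
    show "disjoint_family_on (\<lambda>i. g ` cball (fst i) (snd i)) C"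
      unfolding disjoint_family_on_def
    proof (intro ballI impI)
      fix i j assume ij: "i \<in> C" "j \<in> C" "i \<noteq> j"
      then have "cball (fst i) (snd i) \<inter> cball (fst j) (snd j) = {}"
        using C(3) by (auto simp: pairwise_def disjnt_def)
      with inj_on_image_Int [OF F(2) CF [OF ij(1)] CF [OF ij(2)]]
      show "g ` cball (fst i) (snd i) \<inter> g ` cball (fst j) (snd j) = {}" by simp
    qed
  qed
  also have "\<dots> \<le> (\<integral>\<^sup>+i. k * emeasure \<mu> (cball (fst i) (snd i)) \<partial>count_space C)"
    by (intro nn_integral_mono) (auto intro: Ck)
  also have "\<dots> = k * (\<integral>\<^sup>+i. emeasure \<mu> (cball (fst i) (snd i)) \<partial>count_space C)"
    by (rule nn_integral_cmult) simp
  also have "(\<integral>\<^sup>+i. emeasure \<mu> (cball (fst i) (snd i)) \<partial>count_space C) = emeasure \<mu> (\<Union>i \<in> C. cball (fst i) (snd i))"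
    using C(1,3) sets
    by (intro emeasure_UN_countable [symmetric])
       (auto simp: disjoint_family_on_def pairwise_def disjnt_def)
  also have "k * \<dots> \<le> k * emeasure \<mu> F"
    using CF F(1) sets by (intro mult_left_mono emeasure_mono) auto
  finally show ?thesis .
qed

text \<open>Separate factors \<open>m k\<close> keep the volume sharp: the lower bounds for the
  stretching of \<open>Z\<close> differ by the factor \<open>L * lam\<close> between the vertical
  and the horizontal directions, and a round ball would lose it.\<close>

lemma emeasure_ellipsoid:
  fixes m :: "'n::{finite,wellorder} \<Rightarrow> real" and x :: "real^'n::_"
  assumes m: "\<And>k. m k > 0" and r: "r \<ge> 0"
    and S: "S \<in> sets borel" "\<And>z. z \<in> S \<Longrightarrow> norm (\<chi> k. m k * (z - x) $ k) \<le> r"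
  shows "emeasure lborel S \<le> ennreal (unit_ball_vol (CARD('n)) * r ^ CARD('n) / prod m UNIV)"
proof -
  define E where "E = (\<lambda>v::real^'n::_. \<chi> k. (1 / m k) * v $ k) ` cball 0 r"
  have pos: "prod m UNIV > 0" using m by (simp add: prod_pos)
  have lm: "E \<in> lmeasurable" unfolding E_def by (rule measurable_stretch) simp
  have mE: "measure lebesgue E = unit_ball_vol (CARD('n)) * r ^ CARD('n) / prod m UNIV"
    unfolding E_def
    using pos content_cball [OF r, of "0::real^'n::_"] m
    by (subst measure_stretch) (simp_all add: prod_dividef measure_completion abs_of_pos)
  have "S \<subseteq> (+) x ` E"
  proof
    fix z assume z: "z \<in> S"
    have "z - x = (\<chi> k. (1 / m k) * (\<chi> k. m k * (z - x) $ k) $ k)"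
      using m by (simp add: vec_eq_iff less_imp_neq [symmetric])
    then have "z - x \<in> E" unfolding E_def using S(2) [OF z] by (intro image_eqI) auto
    then show "z \<in> (+) x ` E" by (metis add.commute diff_add_cancel image_eqI)
  qed
  moreover have lm': "(+) x ` E \<in> lmeasurable" using lm by (rule measurable_translation)
  ultimately have "emeasure lebesgue S \<le> emeasure lebesgue ((+) x ` E)"
    by (intro emeasure_mono) auto
  also have "\<dots> = ennreal (measure lebesgue ((+) x ` E))"
    using lm' by (simp add: emeasure_eq_measure2 fmeasurableD2)
  also have "measure lebesgue ((+) x ` E) = measure lebesgue E" by (rule measure_translation)
  finally show ?thesis using S(1) by (simp add: mE)
qed

text \<open>The inverse image of a small ball around \<open>f x\<close> lies in an ellipsoid around
  \<open>x\<close>, by an estimate that compares only with the centre \<open>x\<close>. The strict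
  inequality in \<open>exp\<close> leaves room to replace the continuous weight by constants near
  \<open>x\<close> and near \<open>f x\<close>.\<close>

lemma weighted_measure_expansion:
  fixes f :: "real^'n::{finite,wellorder} \<Rightarrow> real^'n::_" and w :: "real^'n::_ \<Rightarrow> real" and m :: "'n \<Rightarrow> real"
  defines "\<mu> \<equiv> density lborel (\<lambda>x. ennreal (w x))"
  assumes m: "\<And>i. m i > 0"
    and w: "w \<in> borel_measurable borel" "\<And>x. x \<in> E \<Longrightarrow> w x > 0" "\<And>x. x \<in> E \<Longrightarrow> w (f x) > 0"
      "\<And>x. x \<in> E \<Longrightarrow> isCont w x" "\<And>x. x \<in> E \<Longrightarrow> isCont w (f x)"
    and E: "open E" "inj_on f E" "continuous_on E f"
    and k: "k > 0"
    and exp: "\<And>x. x \<in> E \<Longrightarrow> \<exists>b>0. \<exists>\<delta>>0.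
      (\<forall>z \<in> E \<inter> ball x \<delta>. b * norm (\<chi> i. m i * (z - x) $ i) \<le> norm (f z - f x)) \<and>
      w x < k * (b ^ CARD('n) * prod m UNIV) * w (f x)"
  shows "emeasure \<mu> E \<le> ennreal k * emeasure \<mu> (f ` E)"
proof -
  have sets: "sets \<mu> = sets borel" by (simp add: \<mu>_def)
  have wm: "(\<lambda>x. ennreal (w x)) \<in> borel_measurable lborel" using w(1) by simp
  define g where "g = inv_into E f"
  have gf: "g (f x) = x" if "x \<in> E" for x using E(2) that by (simp add: g_def)
  have gF: "g ` f ` E = E" using gf by (force simp: image_iff)
  have opn: "open (f ` S)" if "open S" "S \<subseteq> E" for S
    using that E(2,3) by (intro invariance_of_domain continuous_on_subset [OF E(3)]) (auto intro: inj_on_subset)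
  have P: "prod m UNIV > 0" using m by (simp add: prod_pos)
  \<comment> \<open>Comparison with the Euclidean norm; it yields the Lipschitz bound for the
    inverse that the covering lemma asks for.\<close>
  define c where "c = Min (range m)"
  have c: "c > 0" "\<And>i. c \<le> m i" using m by (auto simp: c_def)
  have cn: "c * norm v \<le> norm (\<chi> i. m i * v $ i)" for v :: "real^'n::_"
  proof -
    have "norm (c *\<^sub>R v) \<le> norm (\<chi> i. m i * v $ i)"
      using c m by (intro norm_le_componentwise_cart) (auto simp: abs_mult abs_of_pos [OF m] intro!: mult_right_mono)
    then show ?thesis using c by simp
  qed
  have "emeasure \<mu> (g ` f ` E) \<le> ennreal k * emeasure \<mu> (f ` E)"
  proof (rule emeasure_image_le_Vitali [OF sets])
    show "emeasure \<mu> N = 0" if "N \<in> sets borel" "negligible N" for N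
    proof -
      have "N \<in> null_sets lborel"
        using that by (simp add: negligible_iff_null_sets null_sets_completion_iff)
      then show ?thesis unfolding \<mu>_def
        using absolutely_continuousI_density [OF wm] by (auto simp: absolutely_continuous_def null_sets_def)
    qed
    show "open (f ` E)" by (rule opn [OF E(1)]) simp
    show "inj_on g (f ` E)" using gf by (auto simp: inj_on_def)
    show "g ` f ` E \<in> sets borel" using gF E(1) by simp
    fix y assume "y \<in> f ` E"
    then obtain x where x: "x \<in> E" "y = f x" by blast
    obtain b \<delta>0 where b: "b > 0" "\<delta>0 > 0" "\<And>z. z \<in> E \<inter> ball x \<delta>0 \<Longrightarrow> b * norm (\<chi> i. m i * (z - x) $ i) \<le> norm (f z - f x)"
        "w x < k * (b ^ CARD('n) * prod m UNIV) * w (f x)" using exp [OF x(1)] by blast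
    define J where "J = b ^ CARD('n) * prod m UNIV"
    have J: "J > 0" using b P by (simp add: J_def)
    \<comment> \<open>\<alpha> bounds the weight from above near \<open>x\<close>, and \<beta>
      bounds it from below near \<open>f x\<close>. As \<open>\<alpha> = k * J * \<beta>\<close>,
      the volume ratio \<open>1 / J\<close> becomes exactly the factor \<open>k\<close>.\<close>
    obtain \<alpha> where \<alpha>: "w x < \<alpha>" "\<alpha> < k * J * w (f x)" using dense b(4) unfolding J_def by blast
    define \<beta> where "\<beta> = \<alpha> / (k * J)"
    have ab: "\<beta> < w (f x)" "\<alpha> = k * J * \<beta>" "\<alpha> > 0" "\<beta> > 0"
      using \<alpha> k J w(2) [OF x(1)] by (auto simp: \<beta>_def field_simps intro: less_trans)
    obtain \<delta>1 where d1: "\<delta>1 > 0" "\<And>z. dist z x < \<delta>1 \<Longrightarrow> w z < \<alpha>"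
    proof -
      have "eventually (\<lambda>z. w z < \<alpha>) (nhds x)"
        using w(4) [OF x(1)] \<alpha>(1) by (auto simp: isCont_def tendsto_at_iff_tendsto_nhds intro: order_tendstoD)
      then show ?thesis using that by (auto simp: eventually_nhds_metric)
    qed
    obtain \<delta>2 where d2: "\<delta>2 > 0" "\<And>z. dist z y < \<delta>2 \<Longrightarrow> \<beta> < w z"
    proof -
      have "eventually (\<lambda>z. \<beta> < w z) (nhds (f x))"
        using w(5) [OF x(1)] ab(1) by (auto simp: isCont_def tendsto_at_iff_tendsto_nhds intro: order_tendstoD)
      then show ?thesis using that x(2) by (auto simp: eventually_nhds_metric)
    qed
    define \<delta> where "\<delta> = min \<delta>0 \<delta>1"
    have "open (f ` (E \<inter> ball x \<delta>))" by (intro opn open_Int E(1) open_ball) auto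
    moreover have "y \<in> f ` (E \<inter> ball x \<delta>)" using x b d1 by (simp add: \<delta>_def)
    ultimately obtain e where e: "e > 0" "ball y e \<subseteq> f ` (E \<inter> ball x \<delta>)"
      using open_contains_ball by blast
    define \<rho> where "\<rho> = min e \<delta>2"
    have D: "\<rho> > 0" "b > 0" "\<delta> > 0" "ball y \<rho> \<subseteq> f ` (E \<inter> ball x \<delta>)"
      "\<And>z. z \<in> E \<inter> ball x \<delta> \<Longrightarrow> b * norm (\<chi> i. m i * (z - x) $ i) \<le> norm (f z - f x)"
      "\<And>z. z \<in> ball x \<delta> \<Longrightarrow> w z \<le> \<alpha>" "\<And>y'. y' \<in> ball y \<rho> \<Longrightarrow> \<beta> \<le> w y'"
    proof -
      show "\<rho> > 0" "b > 0" "\<delta> > 0" using e d1 d2 b by (auto simp: \<delta>_def \<rho>_def)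
      show "ball y \<rho> \<subseteq> f ` (E \<inter> ball x \<delta>)" using e by (auto simp: \<rho>_def)
      show "b * norm (\<chi> i. m i * (z - x) $ i) \<le> norm (f z - f x)" if "z \<in> E \<inter> ball x \<delta>" for z
        using b that by (auto simp: \<delta>_def)
      show "w z \<le> \<alpha>" if "z \<in> ball x \<delta>" for z
        using d1(2) [of z] that by (simp add: \<delta>_def dist_commute)
      show "\<beta> \<le> w y'" if "y' \<in> ball y \<rho>" for y'
        using d2(2) [of y'] that by (simp add: \<rho>_def dist_commute)
    qed
    have inside: "g y' \<in> E \<inter> ball x \<delta>" "f (g y') = y'" if "y' \<in> ball y \<rho>" for y'
      using D(4) that gf by auto
    have near: "b * norm (\<chi> i. m i * (g y' - x) $ i) \<le> norm (y' - y)" if "y' \<in> ball y \<rho>" for y'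
      using D(5) [OF inside(1) [OF that]] inside(2) [OF that] x by simp
    have gy: "g y = x" using x gf by simp
    show "\<exists>T B. open T \<and> y \<in> T \<and> (\<forall>v \<in> f ` E \<inter> T. norm (g v - g y) \<le> B * norm (v - y))"
    proof (intro exI [of _ "ball y \<rho>"] exI [of _ "1 / (b * c)"] conjI ballI)
      fix v assume v: "v \<in> f ` E \<inter> ball y \<rho>"
      have "b * (c * norm (g v - x)) \<le> b * norm (\<chi> i. m i * (g v - x) $ i)"
        using D(2) by (intro mult_left_mono cn) auto
      also have "\<dots> \<le> norm (v - y)" using near v by blast
      finally show "norm (g v - g y) \<le> 1 / (b * c) * norm (v - y)"
        using D(2) c by (simp add: gy field_simps)
    qed (use D in auto)
    show "\<exists>d>0. \<forall>r. 0 < r \<and> r < d \<longrightarrow> cball y r \<subseteq> f ` E \<and>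
        emeasure \<mu> (g ` cball y r) \<le> ennreal k * emeasure \<mu> (cball y r)"
    proof (intro exI [of _ \<rho>] conjI allI impI)
      show "\<rho> > 0" by (rule D)
      fix r assume r: "0 < r \<and> r < \<rho>"
      then have sub: "cball y r \<subseteq> ball y \<rho>" by auto
      then show "cball y r \<subseteq> f ` E" using D(4) by blast
      define S where "S = g ` cball y r"
      have Sm: "S \<in> sets borel"
      proof -
        \<comment> \<open>This shows \<open>S\<close> as relatively closed in the open set
          \<open>E\<close>, hence Borel.\<close>
        have "S = E - (f -` (- cball y r) \<inter> E)"
        proof (intro equalityI subsetI)
          fix z assume "z \<in> S"
          then obtain y' where "z = g y'" "y' \<in> cball y r" by (auto simp: S_def)
          then show "z \<in> E - (f -` (- cball y r) \<inter> E)" using inside [of y'] sub by auto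
        next
          fix z assume "z \<in> E - (f -` (- cball y r) \<inter> E)"
          then have "z \<in> E" "f z \<in> cball y r" by auto
          then show "z \<in> S" using gf [of z] unfolding S_def by (metis image_eqI)
        qed
        moreover have "open (f -` (- cball y r) \<inter> E)"
          using E(1,3) by (simp add: continuous_on_open_vimage open_Compl)
        ultimately show ?thesis using E(1) by auto
      qed
      have "emeasure lborel S \<le> ennreal (unit_ball_vol (CARD('n)) * (r / b) ^ CARD('n) / prod m UNIV)"
      proof (rule emeasure_ellipsoid [OF m _ Sm])
        show "0 \<le> r / b" using r D by simp
        fix z assume "z \<in> S"
        then obtain y' where y': "z = g y'" "y' \<in> cball y r" by (auto simp: S_def)
        then have "b * norm (\<chi> i. m i * (z - x) $ i) \<le> r"
          using near [of y'] sub by (fastforce simp: dist_norm norm_minus_commute)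
        then show "norm (\<chi> i. m i * (z - x) $ i) \<le> r / b" using D(2) by (simp add: field_simps)
      qed
      also have "unit_ball_vol (CARD('n)) * (r / b) ^ CARD('n) / prod m UNIV = unit_ball_vol (CARD('n)) * r ^ CARD('n) / J"
        by (simp add: J_def power_divide mult.commute)
      finally have S_le: "emeasure lborel S \<le> ennreal (unit_ball_vol (CARD('n)) * r ^ CARD('n) / J)" .
      have "emeasure \<mu> S = (\<integral>\<^sup>+z. ennreal (w z) * indicator S z \<partial>lborel)"
        unfolding \<mu>_def using Sm wm by (intro emeasure_density) auto
      also have "\<dots> \<le> (\<integral>\<^sup>+z. ennreal \<alpha> * indicator S z \<partial>lborel)"
      proof (intro nn_integral_mono)
        fix z :: "real^'n::_"
        show "ennreal (w z) * indicator S z \<le> ennreal \<alpha> * indicator S z"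
          using D(6) inside(1) sub by (cases "z \<in> S") (auto simp: S_def intro!: ennreal_leI)
      qed
      also have "\<dots> = ennreal \<alpha> * emeasure lborel S" using Sm by (simp add: nn_integral_cmult_indicator)
      also have "\<dots> \<le> ennreal \<alpha> * ennreal (unit_ball_vol (CARD('n)) * r ^ CARD('n) / J)"
        by (intro mult_left_mono S_le) simp
      also have "\<dots> = ennreal k * (ennreal \<beta> * ennreal (unit_ball_vol (CARD('n)) * r ^ CARD('n)))"
        using k J ab by (simp add: ennreal_mult' [symmetric] ab(2))
      also have "ennreal (unit_ball_vol (CARD('n)) * r ^ CARD('n)) = emeasure lborel (cball y r)"
        using r by (simp add: emeasure_cball)
      also have "ennreal \<beta> * emeasure lborel (cball y r) = (\<integral>\<^sup>+z. ennreal \<beta> * indicator (cball y r) z \<partial>lborel)"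
        by (simp add: nn_integral_cmult_indicator)
      also have "\<dots> \<le> (\<integral>\<^sup>+z. ennreal (w z) * indicator (cball y r) z \<partial>lborel)"
      proof (intro nn_integral_mono)
        fix z :: "real^'n::_"
        show "ennreal \<beta> * indicator (cball y r) z \<le> ennreal (w z) * indicator (cball y r) z"
          using D(7) sub by (cases "z \<in> cball y r") (auto intro!: ennreal_leI)
      qed
      also have "\<dots> = emeasure \<mu> (cball y r)"
        unfolding \<mu>_def using wm by (intro emeasure_density [symmetric]) auto
      finally show "emeasure \<mu> (g ` cball y r) \<le> ennreal k * emeasure \<mu> (cball y r)"
        by (simp add: S_def mult_left_mono)
    qed
  qed
  then show ?thesis by (simp add: gF)
qed

section \<open>Contraction of measures along orbits\<close>

lemma exists_power_greater:
  fixes c :: real assumes "c < 1"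
  obtains \<theta> where "0 < \<theta>" "\<theta> < 1" "c < \<theta> ^ n"
proof -
  define c' where "c' = max c 0"
  have c': "0 \<le> c'" "c' < 1" "c \<le> c'" using assms by (auto simp: c'_def)
  \<comment> \<open>Chosen for Bernoulli: \<open>n * t < 1 - c'\<close>, and \<open>t < 1\<close>
    even for \<open>n = 0\<close>. The number \<open>1 - t\<close> later serves as the loss \<theta>
    allowed in local expansion bounds.\<close>
  define t where "t = (1 - c') / (real n + 2)"
  have t: "0 < t" "t < 1" "real n * t < 1 - c'" using c' by (auto simp: t_def field_simps)
  have "1 + real n * (- t) \<le> (1 + (- t)) ^ n" using t by (intro Bernoulli_inequality) auto
  then have "c < (1 - t) ^ n" using t c' by simp
  then show thesis using that [of "1 - t"] t by simp
qed

text \<open>Only preimages inside \<open>D\<close> are measured, which avoids any question of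
  multiplicity for the iterates. The last map is pulled back first, so \<open>G\<close> must be
  general in the induction; \<open>T n\<close> is a region around the \<open>n\<close>-th image
  where the one-step estimate holds.\<close>

lemma emeasure_iterated_preimage_le:
  fixes f :: "'a::topological_space \<Rightarrow> 'a" and k :: ennreal
  assumes "sets \<mu> = sets borel" and cont: "continuous_on UNIV f" and "open D"
    and T: "\<And>n. open (T n)" "\<And>n. (f ^^ n) ` D \<subseteq> T n"
    and step: "\<And>n E G. open E \<Longrightarrow> E \<subseteq> T n \<Longrightarrow> open G \<Longrightarrow> f ` E \<subseteq> G \<Longrightarrow> emeasure \<mu> E \<le> k * emeasure \<mu> G"
  shows "open G \<Longrightarrow> emeasure \<mu> {x \<in> D. (f ^^ n) x \<in> G} \<le> k ^ n * emeasure \<mu> G"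
proof (induction n arbitrary: G)
  case 0
  have "emeasure \<mu> {x \<in> D. (f ^^ 0) x \<in> G} \<le> emeasure \<mu> G"
    by (rule emeasure_mono) (use 0 in \<open>auto simp: assms(1)\<close>)
  then show ?case by simp
next
  case (Suc n)
  define E where "E = T n \<inter> f -` G"
  have "open E" unfolding E_def using T(1) Suc.prems cont by (intro open_Int open_vimage)
  have "{x \<in> D. (f ^^ Suc n) x \<in> G} = {x \<in> D. (f ^^ n) x \<in> E}"
    using T(2) [of n] by (auto simp: E_def)
  also have "emeasure \<mu> \<dots> \<le> k ^ n * emeasure \<mu> E" by (rule Suc.IH [OF \<open>open E\<close>])
  also have "\<dots> \<le> k ^ n * (k * emeasure \<mu> G)"
    by (intro mult_left_mono step [OF \<open>open E\<close> _ Suc.prems]) (auto simp: E_def)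
  finally show ?case by (simp add: mult_ac)
qed

text \<open>Borel-Cantelli with an explicit tail: for large \<open>N\<close> the measures of
  \<open>A n\<close> with \<open>n \<ge> N\<close> sum to less than the measure of \<open>B\<close>,
  so some point of \<open>B\<close> lies in none of these sets.\<close>

lemma exists_finitely_many_visits:
  assumes B: "B \<in> sets \<mu>" "emeasure \<mu> B > 0"
    and A: "\<And>n. A n \<in> sets \<mu>" "\<And>n. emeasure \<mu> (A n) \<le> ennreal (W * k ^ n)"
    and k: "0 \<le> k" "k < 1" and W: "0 \<le> W"
  obtains x N where "x \<in> B" "\<And>n. n \<ge> N \<Longrightarrow> x \<notin> A n"
proof -
  have "(\<lambda>n. ennreal (W * k ^ n / (1 - k))) \<longlonglongrightarrow> ennreal (W * 0 / (1 - k))"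
    using k by (intro tendsto_ennrealI tendsto_intros LIMSEQ_realpow_zero) auto
  then have "eventually (\<lambda>n. ennreal (W * k ^ n / (1 - k)) < emeasure \<mu> B) sequentially"
    using B by (intro order_tendstoD) auto
  then obtain N where N: "ennreal (W * k ^ N / (1 - k)) < emeasure \<mu> B"
    using eventually_happens by force
  have "emeasure \<mu> (\<Union>n. A (N + n)) \<le> (\<Sum>n. emeasure \<mu> (A (N + n)))"
    using A by (intro emeasure_subadditive_countably) auto
  also have "\<dots> \<le> (\<Sum>n. ennreal (W * k ^ N * k ^ n))"
  proof (rule suminf_le)
    show "emeasure \<mu> (A (N + n)) \<le> ennreal (W * k ^ N * k ^ n)" for n
      using A(2) [of "N + n"] by (simp add: power_add mult.assoc)
  qed auto
  also have "\<dots> = ennreal (W * k ^ N * (1 / (1 - k)))"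
    using k W by (intro suminf_ennreal_eq sums_mult geometric_sums) auto
  also have "\<dots> < emeasure \<mu> B" using N by simp
  finally have less: "emeasure \<mu> (\<Union>n. A (N + n)) < emeasure \<mu> B" .
  have "\<not> B \<subseteq> (\<Union>n. A (N + n))"
  proof
    assume "B \<subseteq> (\<Union>n. A (N + n))"
    then have "emeasure \<mu> B \<le> emeasure \<mu> (\<Union>n. A (N + n))" using A(1) by (intro emeasure_mono) auto
    with less show False by (simp add: leD)
  qed
  then obtain x where x: "x \<in> B" "\<And>n. x \<notin> A (N + n)" by blast
  show thesis
  proof (rule that [OF x(1)])
    show "x \<notin> A n" if "n \<ge> N" for n using x(2) [of "n - N"] that by simp
  qed
qed

lemma connected_avoiding_multiples:
  fixes S :: "real set"
  assumes "connected S" "c > 0" "\<And>k::int. of_int k * c \<notin> S" "S \<noteq> {}"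
  obtains a :: int where "\<And>t. t \<in> S \<Longrightarrow> of_int a * c < t \<and> t < (of_int a + 1) * c"
proof -
  obtain s where s: "s \<in> S" using assms by blast
  define a where "a = \<lfloor>s / c\<rfloor>"
  have "of_int a \<le> s / c" "s / c < of_int a + 1" unfolding a_def by linarith+
  then have a: "of_int a * c \<le> s" "s \<le> (of_int a + 1) * c" using assms(2) by (auto simp: field_simps)
  have n: "of_int a * c \<notin> S" "(of_int a + 1) * c \<notin> S"
    using assms(3) [of a] assms(3) [of "a + 1"] by auto
  show thesis
  proof (rule that [of a])
    fix t assume t: "t \<in> S"
    show "of_int a * c < t \<and> t < (of_int a + 1) * c"
    proof (rule ccontr)
      assume *: "\<not> (of_int a * c < t \<and> t < (of_int a + 1) * c)"
      have sub: "{t..s} \<subseteq> S" "{s..t} \<subseteq> S"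
        using connected_contains_Icc [OF assms(1)] s t by blast+
      from * consider "t \<le> of_int a * c" | "(of_int a + 1) * c \<le> t" by linarith
      then show False
      proof cases
        case 1
        then have "of_int a * c \<in> {t..s}" using a by simp
        then show False using sub n by blast
      next
        case 2
        then have "(of_int a + 1) * c \<in> {s..t}" using a by simp
        then show False using sub n by blast
      qed
    qed
  qed
qed

lemma negligible_coordinate_hyperplane: "negligible {x::real^'n. x $ k = c}"
  using negligible_hyperplane [of "axis k 1 :: real^'n" c] by (simp add: inner_axis')

section \<open>The geometry of Zorich maps\<close>

lemma norm_vec3_sq: "(norm v)\<^sup>2 = (v $ 1)\<^sup>2 + (v $ 2)\<^sup>2 + (v $ 3)\<^sup>2" for v :: "real^3"
  unfolding power2_norm_eq_inner inner_vec_def by (simp add: sum_3 power2_eq_square)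

lemma norm_vec2_sq: "(norm v)\<^sup>2 = (v $ 1)\<^sup>2 + (v $ 2)\<^sup>2" for v :: "real^2"
  unfolding power2_norm_eq_inner inner_vec_def by (simp add: sum_2 power2_eq_square)

lemma norm_eq_1_iff_sq: "norm v = 1 \<longleftrightarrow> (norm v)\<^sup>2 = 1"
  using power2_eq_iff_nonneg [of "norm v" 1] by simp

lemma vec3_eqI: "x $ 1 = y $ 1 \<Longrightarrow> x $ 2 = y $ 2 \<Longrightarrow> x $ 3 = y $ 3 \<Longrightarrow> x = y" for x y :: "real^3"
  by (simp add: vec_eq_iff forall_3)

definition hnorm :: "real^3 \<Rightarrow> real" where
  "hnorm v = sqrt ((v $ 1)\<^sup>2 + (v $ 2)\<^sup>2)"

lemma hnorm_nonneg [simp]: "0 \<le> hnorm v"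
  by (simp add: hnorm_def)

lemma hnorm_sq: "(hnorm v)\<^sup>2 = (v $ 1)\<^sup>2 + (v $ 2)\<^sup>2"
  by (simp add: hnorm_def)

lemma hnorm_eq_norm3: "hnorm v = norm (vector [v $ 1, v $ 2, 0] :: real^3)"
  by (simp add: hnorm_def norm_vec3_sq real_sqrt_unique)

lemma norm_sq_hnorm: "(norm v)\<^sup>2 = (hnorm v)\<^sup>2 + (v $ 3)\<^sup>2"
  by (simp add: hnorm_sq norm_vec3_sq)

lemma hnorm_triangle: "hnorm (u + v) \<le> hnorm u + hnorm v"
proof -
  have "vector [(u + v) $ 1, (u + v) $ 2, 0] = (vector [u $ 1, u $ 2, 0] + vector [v $ 1, v $ 2, 0] :: real^3)"
    by (rule vec3_eqI) auto
  then show ?thesis by (simp only: hnorm_eq_norm3 norm_triangle_ineq)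
qed

lemma hnorm_scaleR: "hnorm (c *\<^sub>R v) = \<bar>c\<bar> * hnorm v"
  by (simp add: hnorm_def power_mult_distrib real_sqrt_mult flip: distrib_left)

lemma hnorm_le_norm: "hnorm v \<le> norm v"
  by (rule power2_le_imp_le) (auto simp: norm_sq_hnorm)

lemma norm_le_hnorm: "norm v \<le> hnorm v + \<bar>v $ 3\<bar>"
  by (rule power2_le_imp_le) (auto simp: norm_sq_hnorm power2_sum)

lemma component_le_hnorm: "\<bar>v $ 1\<bar> \<le> hnorm v" "\<bar>v $ 2\<bar> \<le> hnorm v"
  by (auto simp: hnorm_def intro!: real_le_rsqrt)

lemma hnorm_eq_0: "hnorm v = 0 \<longleftrightarrow> v $ 1 = 0 \<and> v $ 2 = 0"
  by (auto simp: hnorm_def sum_power2_eq_zero_iff)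

text \<open>Distance in polar form with radial and angular parts separated; it is applied to
  \<open>Z\<close>, whose value is \<open>M * exp (x $ 3)\<close> times a unit vector.\<close>

lemma norm_scaled_units_diff_sq:
  fixes u v :: "'a::real_inner"
  assumes "norm u = 1" "norm v = 1"
  shows "(norm (a *\<^sub>R u - b *\<^sub>R v))\<^sup>2 = (a - b)\<^sup>2 + a * b * (norm (u - v))\<^sup>2"
proof -
  have "u \<bullet> u = 1" "v \<bullet> v = 1" using assms by (simp_all add: dot_square_norm)
  then show ?thesis
    by (simp add: power2_norm_eq_inner inner_diff_left inner_diff_right inner_commute [of v u])
       (simp add: power2_eq_square algebra_simps)
qed

lemma norm_sgn_diff_le:
  fixes x y :: "'a::real_normed_vector"
  assumes "x \<noteq> 0"
  shows "norm (sgn y - sgn x) \<le> 2 * norm (y - x) / norm x"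
proof (cases "y = 0")
  case True
  then show ?thesis using assms by (simp add: norm_sgn)
next
  case False
  have "norm x *\<^sub>R (sgn y - sgn x) = (norm x - norm y) *\<^sub>R sgn y + (y - x)"
    using assms False by (simp add: sgn_div_norm algebra_simps)
  then have "norm x * norm (sgn y - sgn x) = norm ((norm x - norm y) *\<^sub>R sgn y + (y - x))"
    by (metis abs_norm_cancel norm_scaleR)
  also have "\<dots> \<le> \<bar>norm x - norm y\<bar> * 1 + norm (y - x)"
    using False by (intro order_trans [OF norm_triangle_ineq]) (simp add: norm_sgn)
  also have "\<dots> \<le> 2 * norm (y - x)"
    using norm_triangle_ineq3 [of x y] by (simp add: norm_minus_commute)
  finally show ?thesis using assms by (simp add: field_simps)
qed

definition par :: "int \<Rightarrow> real" where
  "par i = (if even i then 1 else -1)"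

lemma par_sq [simp]: "par i * par i = 1" "par i * (par i * t) = t" "(par i)\<^sup>2 = 1"
  and par_abs [simp]: "\<bar>par i\<bar> = 1"
  and par_nz [simp]: "par i \<noteq> 0"
  by (auto simp: par_def)

section \<open>Beams and the polar form of the Zorich map\<close>

locale zorich_map =
  fixes hh :: "real^2 \<Rightarrow> real^3" and L lam nu :: real
  assumes L1: "L \<ge> 1"
    and bilip: "\<forall>a\<in>sqQ. \<forall>b\<in>sqQ. dist a b / L \<le> dist (hh a) (hh b) \<and> dist (hh a) (hh b) \<le> L * dist a b"
    and onto: "hh ` sqQ = upper_hemisphere"
    and bd: "hh ` frontier sqQ = equator"
    and diag: "\<forall>t\<in>{-1..1}. hh (vector [t, t]) $ 1 = hh (vector [t, t]) $ 2"
    and antidiag: "\<forall>t\<in>{-1..1}. hh (vector [t, -t]) $ 1 = - (hh (vector [t, -t]) $ 2)"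
    and lam1: "lam \<ge> 1"
    and lamL: "lam > L ^ 5"
    and nu: "nu > sqrt (2 * L / lam)"
begin

abbreviation Z :: "real^3 \<Rightarrow> real^3" where "Z \<equiv> zorich nu lam hh"

definition M :: real where "M = lam * nu"

lemma L_pos: "L > 0" and lam_pos: "lam > 0" and lam_nz: "lam \<noteq> 0"
  using L1 lam1 by auto

lemma nu_pos: "nu > 0"
proof -
  have "0 \<le> sqrt (2 * L / lam)" using L_pos lam_pos by simp
  with nu show ?thesis by linarith
qed

lemma M_pos: "M > 0"
  using nu_pos lam_pos by (simp add: M_def)

lemma lam_nu_sq: "lam * nu\<^sup>2 > 2 * L"
proof -
  have "(sqrt (2 * L / lam))\<^sup>2 < nu\<^sup>2"
    using nu L_pos lam_pos by (intro power_strict_mono) auto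
  then show ?thesis using L_pos lam_pos by (simp add: field_simps)
qed

lemma M_sq: "M\<^sup>2 > 2"
proof -
  have "2 * 1 < (lam * nu\<^sup>2) * lam"
    using lam_nu_sq L1 lam1 by (intro mult_less_le_imp_less) auto
  then show ?thesis by (simp add: M_def power2_eq_square mult_ac)
qed

text \<open>Closed intervals, so that they cover the line and neighbouring ones share an endpoint:
  passing from one beam to the next happens at such points.\<close>

definition cell :: "int \<Rightarrow> real \<Rightarrow> bool" where
  "cell i t \<longleftrightarrow> \<bar>t - 2 * of_int i * lam\<bar> \<le> lam"

definition loc :: "int \<Rightarrow> real \<Rightarrow> real" where
  "loc i t = par i * (t - 2 * of_int i * lam)"

lemma abs_loc: "\<bar>loc i t\<bar> = \<bar>t - 2 * of_int i * lam\<bar>"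
  by (simp add: loc_def abs_mult)

lemma loc_diff: "\<bar>loc i s - loc i t\<bar> = \<bar>s - t\<bar>"
  by (simp add: loc_def abs_mult flip: right_diff_distrib)

lemma cell_exists: "\<exists>i. cell i t"
proof -
  define i where "i = \<lfloor>(t + lam) / (2 * lam)\<rfloor>"
  have "of_int i \<le> (t + lam) / (2 * lam)" "(t + lam) / (2 * lam) < of_int i + 1"
    unfolding i_def by linarith+
  then have "cell i t" using lam_pos by (auto simp: cell_def field_simps)
  then show ?thesis ..
qed

text \<open>The sign is claimed only inside the cell, since at an endpoint \<open>fold_sign\<close>
  makes a one-sided choice. \<open>Z_beam\<close> shows this to be harmless: the third coordinate is
  0 there.\<close>

lemma fold_eq_loc:
  assumes "cell i t"
  shows "fold_refl lam t = loc i t" and "\<bar>t - 2 * of_int i * lam\<bar> < lam \<Longrightarrow> fold_sign lam t = par i"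
proof -
  have "fold_refl lam t = loc i t \<and> (\<bar>t - 2 * of_int i * lam\<bar> < lam \<longrightarrow> fold_sign lam t = par i)"
  proof (cases "even i")
    case True
    then obtain m where i: "i = 2 * m" by blast
    have "\<lfloor>(t + lam) / (4 * lam)\<rfloor> = m"
      using assms lam_pos by (intro floor_unique) (auto simp: cell_def i field_simps)
    then have "foldpos lam t = t + lam - 4 * lam * m" by (simp add: foldpos_def)
    then show ?thesis
      using assms by (auto simp: fold_refl_def fold_sign_def cell_def loc_def par_def i algebra_simps)
  next
    case False
    then obtain m where i: "i = 2 * m + 1" by (blast elim: oddE)
    show ?thesis
    \<comment> \<open>At the right end of an odd cell the floor has already jumped to the next
      period and \<open>foldpos\<close> is 0.\<close>
    proof (cases "t = (4 * m + 3) * lam")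
      case True
      then have "(t + lam) / (4 * lam) = of_int (m + 1)" using lam_pos by (simp add: field_simps)
      then have "foldpos lam t = 0" using True by (simp add: foldpos_def algebra_simps)
      then show ?thesis
        using True lam_pos by (auto simp: fold_refl_def cell_def loc_def par_def i algebra_simps)
    next
      case False
      have b: "t \<ge> (4 * m + 1) * lam" "t \<le> (4 * m + 3) * lam"
        using assms by (auto simp: cell_def i algebra_simps)
      then have "\<lfloor>(t + lam) / (4 * lam)\<rfloor> = m"
        using lam_pos False by (intro floor_unique) (auto simp: field_simps)
      then have "foldpos lam t = t + lam - 4 * lam * m" by (simp add: foldpos_def)
      then show ?thesis
        using b by (auto simp: fold_refl_def fold_sign_def cell_def loc_def par_def i algebra_simps)
    qed
  qed
  then show "fold_refl lam t = loc i t" "\<bar>t - 2 * of_int i * lam\<bar> < lam \<Longrightarrow> fold_sign lam t = par i"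
    by auto
qed

lemma mem_sqQ: "vector [a, b] \<in> sqQ \<longleftrightarrow> \<bar>a\<bar> \<le> 1 \<and> \<bar>b\<bar> \<le> 1"
  by (simp add: sqQ_def)

lemma frontier_sqQ: "q \<in> frontier sqQ \<longleftrightarrow> q \<in> sqQ \<and> (\<bar>q $ 1\<bar> = 1 \<or> \<bar>q $ 2\<bar> = 1)"
proof -
  have "sqQ = cbox (\<chi> i. -1) (\<chi> i. 1)"
    by (auto simp: sqQ_def mem_box_cart forall_2)
  then have "frontier sqQ = sqQ - box (\<chi> i. -1) (\<chi> i. 1)"
    by (metis frontier_cbox)
  then show ?thesis
    by (auto simp: sqQ_def mem_box_cart forall_2)
qed

lemma hh_hemisphere: "q \<in> sqQ \<Longrightarrow> norm (hh q) = 1 \<and> hh q $ 3 \<ge> 0"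
  using onto by (auto simp: upper_hemisphere_def)

lemma hh_equator_iff:
  assumes "q \<in> sqQ"
  shows "hh q $ 3 = 0 \<longleftrightarrow> \<bar>q $ 1\<bar> = 1 \<or> \<bar>q $ 2\<bar> = 1"
proof
  assume "hh q $ 3 = 0"
  then have "hh q \<in> hh ` frontier sqQ"
    using assms hh_hemisphere by (auto simp: bd equator_def)
  then obtain p where p: "p \<in> frontier sqQ" "hh q = hh p" by blast
  then have "p \<in> sqQ" by (simp add: frontier_sqQ)
  with bilip assms p have "dist q p / L \<le> 0" by force
  then have "q = p" using L_pos by (simp add: divide_le_0_iff not_less)
  with p show "\<bar>q $ 1\<bar> = 1 \<or> \<bar>q $ 2\<bar> = 1" by (simp add: frontier_sqQ)
next
  assume "\<bar>q $ 1\<bar> = 1 \<or> \<bar>q $ 2\<bar> = 1"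
  then have "hh q \<in> equator" using assms bd frontier_sqQ by blast
  then show "hh q $ 3 = 0" by (simp add: equator_def)
qed

lemma hh_0: "hh (vector [0, 0]) = vector [0, 0, 1]"
proof -
  have "hh (vector [0, 0]) $ 1 = 0" "hh (vector [0, 0]) $ 2 = 0"
    using bspec [OF diag, of 0] bspec [OF antidiag, of 0] by auto
  moreover have "norm (hh (vector [0, 0])) = 1" "hh (vector [0, 0]) $ 3 \<ge> 0"
    using hh_hemisphere [of "vector [0, 0]"] by (auto simp: mem_sqQ)
  ultimately have "hh (vector [0, 0]) $ 3 = 1"
    using norm_vec3_sq [of "hh (vector [0, 0])"] by (auto simp: power2_eq_1_iff)
  then show ?thesis
    using \<open>hh (vector [0, 0]) $ 1 = 0\<close> \<open>hh (vector [0, 0]) $ 2 = 0\<close> by (intro vec3_eqI) auto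
qed

definition base :: "int \<Rightarrow> int \<Rightarrow> real^3 \<Rightarrow> real^2" where
  "base i j x = vector [loc i (x $ 1) / lam, loc j (x $ 2) / lam]"

definition dir :: "int \<Rightarrow> int \<Rightarrow> real^3 \<Rightarrow> real^3" where
  "dir i j x = vector [hh (base i j x) $ 1, hh (base i j x) $ 2, par i * par j * hh (base i j x) $ 3]"

definition beam :: "int \<Rightarrow> int \<Rightarrow> (real^3) set" where
  "beam i j = {x. cell i (x $ 1) \<and> cell j (x $ 2)}"

lemma beam_exists: "\<exists>i j. x \<in> beam i j"
  using cell_exists by (auto simp: beam_def)

lemma base_in_sqQ: "x \<in> beam i j \<Longrightarrow> base i j x \<in> sqQ"
  using lam_pos by (auto simp: base_def mem_sqQ beam_def cell_def abs_loc)

lemma norm_base_diff: "norm (base i j x - base i j z) = hnorm (x - z) / lam"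
proof -
  have e: "(loc k s / lam - loc k t / lam)\<^sup>2 = (s - t)\<^sup>2 / lam\<^sup>2" for k s t
    using loc_diff [of k s t] by (metis diff_divide_distrib power2_abs power_divide)
  have "(norm (base i j x - base i j z))\<^sup>2 = (hnorm (x - z) / lam)\<^sup>2"
    by (simp add: norm_vec2_sq base_def e hnorm_sq power_divide add_divide_distrib)
  then show ?thesis
    using lam_pos by (subst (asm) power2_eq_iff_nonneg) auto
qed

lemma norm_dir: "x \<in> beam i j \<Longrightarrow> norm (dir i j x) = 1"
proof -
  assume "x \<in> beam i j"
  then have "(norm (hh (base i j x)))\<^sup>2 = 1"
    using hh_hemisphere base_in_sqQ by simp
  then have "(norm (dir i j x))\<^sup>2 = 1"
    by (simp add: dir_def norm_vec3_sq power_mult_distrib)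
  then show ?thesis by (simp only: norm_eq_1_iff_sq)
qed

lemma norm_dir_diff: "norm (dir i j x - dir i j z) = norm (hh (base i j x) - hh (base i j z))"
proof -
  have "(par i * par j * a - par i * par j * b)\<^sup>2 = (a - b)\<^sup>2" for a b
    by (simp add: power_mult_distrib flip: right_diff_distrib)
  then have "(norm (dir i j x - dir i j z))\<^sup>2 = (norm (hh (base i j x) - hh (base i j z)))\<^sup>2"
    by (simp add: norm_vec3_sq dir_def)
  then show ?thesis by (simp add: power2_eq_iff_nonneg)
qed

lemma dir_bilipschitz:
  assumes "x \<in> beam i j" "z \<in> beam i j"
  shows "hnorm (x - z) / (lam * L) \<le> norm (dir i j x - dir i j z)"
    and "norm (dir i j x - dir i j z) \<le> L * hnorm (x - z) / lam"
  using bilip [rule_format, OF base_in_sqQ [OF assms(1)] base_in_sqQ [OF assms(2)]]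
  by (auto simp: dist_norm norm_dir_diff norm_base_diff)

lemma Z_beam:
  assumes "x \<in> beam i j"
  shows "Z x = (M * exp (x $ 3)) *\<^sub>R dir i j x"
proof -
  have c: "cell i (x $ 1)" "cell j (x $ 2)" using assms by (auto simp: beam_def)
  have b: "(1 / lam) *\<^sub>R vector [fold_refl lam (x $ 1), fold_refl lam (x $ 2)] = base i j x"
    using fold_eq_loc(1) [OF c(1)] fold_eq_loc(1) [OF c(2)]
    by (simp add: base_def vec_eq_iff forall_2)
  have s: "fold_sign lam (x $ 1) * fold_sign lam (x $ 2) * hh (base i j x) $ 3
      = par i * par j * hh (base i j x) $ 3"
  proof (cases "\<bar>x $ 1 - 2 * of_int i * lam\<bar> < lam \<and> \<bar>x $ 2 - 2 * of_int j * lam\<bar> < lam")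
    case True
    then show ?thesis using fold_eq_loc(2) c by simp
  next
    case False
    then have "\<bar>base i j x $ 1\<bar> = 1 \<or> \<bar>base i j x $ 2\<bar> = 1"
      using c lam_pos by (auto simp: base_def cell_def abs_loc)
    then show ?thesis
      using hh_equator_iff base_in_sqQ [OF assms] by simp
  qed
  show ?thesis
    unfolding zorich_def scaled_h_def Let_def b
    using s by (intro vec3_eqI) (auto simp: dir_def M_def mult.assoc mult.left_commute)
qed

lemma norm_Z: "norm (Z x) = M * exp (x $ 3)"
  using beam_exists [of x] Z_beam norm_dir M_pos by (auto simp: abs_mult)

lemma Z_nonzero: "Z x \<noteq> 0"
  using norm_Z [of x] M_pos by auto

text \<open>In polar form the angular part is controlled by the lower Lipschitz bound, the radial
  part by \<open>2 * sinh d \<ge> 2 * d\<close> with \<open>d\<close> half the height difference.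
  Keeping the symmetric \<open>exp (x $ 3 + z $ 3)\<close> makes the bound global on a beam, with no
  error term.\<close>

lemma Z_expand:
  assumes "x \<in> beam i j" "z \<in> beam i j"
  shows "(nu / L)\<^sup>2 * exp (x $ 3 + z $ 3) * ((hnorm (x - z))\<^sup>2 + (L * lam)\<^sup>2 * (x $ 3 - z $ 3)\<^sup>2)
    \<le> (norm (Z x - Z z))\<^sup>2"
proof -
  define a b where "a = exp (x $ 3)" and "b = exp (z $ 3)"
  have ab: "a > 0" "b > 0" by (auto simp: a_def b_def)
  have sinh: "a * b * (x $ 3 - z $ 3)\<^sup>2 \<le> (a - b)\<^sup>2"
  proof -
    have *: "exp s * exp t * (s - t)\<^sup>2 \<le> (exp s - exp t)\<^sup>2" if "s \<ge> t" for s t :: real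
    proof -
      define d where "d = (s - t) / 2"
      have "d \<ge> 0" using that by (simp add: d_def)
      have "d * 2 \<le> exp d - exp (- d)"
      proof -
        have "d \<le> (exp d - inverse (exp d)) / 2" using \<open>d \<ge> 0\<close> by (rule real_le_x_sinh)
        then show ?thesis by (simp add: exp_minus)
      qed
      then have "(d * 2)\<^sup>2 \<le> (exp d - exp (- d))\<^sup>2" using \<open>d \<ge> 0\<close> by (intro power_mono) auto
      moreover have "exp s - exp t = exp ((s + t) / 2) * (exp d - exp (- d))"
        by (simp add: d_def right_diff_distrib exp_add [symmetric] field_simps)
      moreover have "exp s * exp t = (exp ((s + t) / 2))\<^sup>2"
        by (simp add: power2_eq_square exp_add [symmetric] field_simps)
      moreover have "d * 2 = s - t" unfolding d_def by simp
      ultimately show ?thesis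
        by (simp only: power_mult_distrib [of "exp ((s + t) / 2)"] mult_left_mono zero_le_power2)
    qed
    show ?thesis
    proof (cases "x $ 3 \<ge> z $ 3")
      case True then show ?thesis using * by (simp add: a_def b_def)
    next
      case False
      then show ?thesis using * [of "x $ 3" "z $ 3"]
        by (metis * a_def b_def linorder_le_cases mult.commute power2_commute)
    qed
  qed
  have "(hnorm (x - z) / (lam * L))\<^sup>2 \<le> (norm (dir i j x - dir i j z))\<^sup>2"
    using dir_bilipschitz(1) [OF assms] L_pos lam_pos by (intro power_mono) auto
  then have "M\<^sup>2 * (a * b) * (hnorm (x - z) / (lam * L))\<^sup>2 \<le> M\<^sup>2 * (a * b) * (norm (dir i j x - dir i j z))\<^sup>2"
    using ab by (intro mult_left_mono) auto
  moreover have "M\<^sup>2 * (a * b * (x $ 3 - z $ 3)\<^sup>2) \<le> M\<^sup>2 * (a - b)\<^sup>2"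
    using sinh by (intro mult_left_mono) auto
  ultimately have "M\<^sup>2 * (a * b * (x $ 3 - z $ 3)\<^sup>2) + M\<^sup>2 * (a * b) * (hnorm (x - z) / (lam * L))\<^sup>2
     \<le> M\<^sup>2 * (a - b)\<^sup>2 + M\<^sup>2 * (a * b) * (norm (dir i j x - dir i j z))\<^sup>2"
    by (rule add_mono [rotated])
  also have "\<dots> = (norm (Z x - Z z))\<^sup>2"
    unfolding Z_beam [OF assms(1)] Z_beam [OF assms(2)]
    unfolding norm_scaled_units_diff_sq [OF norm_dir [OF assms(1)] norm_dir [OF assms(2)]]
    by (simp add: a_def b_def power2_eq_square algebra_simps)
  finally show ?thesis
    using L_pos lam_pos
    by (simp add: a_def b_def exp_add M_def power_mult_distrib power_divide field_simps)
qed

section \<open>Local surjectivity, openness and continuity\<close>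

lemma Z_surj_in_beam:
  assumes x: "x \<in> beam i j" and v: "norm v = 1" "par i * par j * v $ 3 \<ge> 0"
  obtains z where "z \<in> beam i j" "z $ 3 = s" "Z z = (M * exp s) *\<^sub>R v" "dir i j z = v"
    "hnorm (z - x) \<le> L * lam * norm (v - dir i j x)"
proof -
  define w :: "real^3" where "w = vector [v $ 1, v $ 2, par i * par j * v $ 3]"
  have "(norm w)\<^sup>2 = (norm v)\<^sup>2" by (simp add: norm_vec3_sq w_def power_mult_distrib)
  then have "norm w = 1" using v by (simp add: norm_eq_1_iff_sq)
  then have "w \<in> upper_hemisphere"
    using v by (simp add: upper_hemisphere_def w_def)
  then have "w \<in> hh ` sqQ" by (simp add: onto)
  then obtain q where q: "q \<in> sqQ" "hh q = w" by auto
  define z :: "real^3" where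
    "z = vector [2 * of_int i * lam + par i * lam * q $ 1, 2 * of_int j * lam + par j * lam * q $ 2, s]"
  have bz: "base i j z = q"
    using lam_pos by (simp add: base_def z_def loc_def vec_eq_iff forall_2)
  have zb: "z \<in> beam i j"
    using q lam_pos by (auto simp: beam_def cell_def z_def abs_mult sqQ_def)
  have pp: "par i * par j * (par i * par j * t) = t" for t
    by (auto simp: par_def)
  have dz: "dir i j z = v"
    by (rule vec3_eqI) (auto simp: dir_def bz q w_def pp)
  have "hnorm (z - x) / (lam * L) \<le> norm (v - dir i j x)"
    using dir_bilipschitz(1) [OF zb x] by (simp add: dz)
  then have "hnorm (z - x) \<le> L * lam * norm (v - dir i j x)"
    using L_pos lam_pos by (simp add: field_simps)
  moreover have "Z z = (M * exp s) *\<^sub>R v" using Z_beam [OF zb] dz by (simp add: z_def)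
  ultimately show thesis using that zb dz by (simp add: z_def)
qed

text \<open>The horizontal projection of \<open>u\<close> is normalised. At a pole this is
  undefined, but there \<open>u $ 3\<close> has modulus 1 and every equator point is close
  enough.\<close>

lemma nearby_equator_point:
  fixes u :: "real^3"
  assumes "norm u = 1"
  obtains e :: "real^3" where "norm e = 1" "e $ 3 = 0" "norm (e - u) \<le> 2 * \<bar>u $ 3\<bar>"
proof (cases "hnorm u = 0")
  case True
  have u: "u $ 1 = 0" "u $ 2 = 0" using True by (simp_all add: hnorm_eq_0)
  have "\<bar>u $ 3\<bar> = 1" using assms norm_sq_hnorm [of u] True by (auto simp: power2_eq_1_iff)
  moreover have "norm (vector [1, 0, 0] - u) \<le> norm (vector [1, 0, 0] :: real^3) + norm u"
    by (rule norm_triangle_ineq4)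
  moreover have "(norm (vector [1, 0, 0] :: real^3))\<^sup>2 = 1" by (simp add: norm_vec3_sq)
  then have "norm (vector [1, 0, 0] :: real^3) = 1"
    by (simp only: norm_eq_1_iff_sq)
  ultimately show thesis using that [of "vector [1, 0, 0]"] assms by simp
next
  case False
  define r where "r = hnorm u"
  have r: "r > 0" using False hnorm_nonneg [of u] by (simp add: r_def less_le)
  have r2: "r\<^sup>2 + (u $ 3)\<^sup>2 = 1" using assms norm_sq_hnorm [of u] by (simp add: r_def)
  then have "r\<^sup>2 \<le> 1" by (metis le_add_same_cancel1 zero_le_power2)
  then have rle: "r \<le> 1" using r by (simp add: power2_le_iff_abs_le abs_square_le_1)
  define e :: "real^3" where "e = vector [u $ 1 / r, u $ 2 / r, 0]"
  have ru: "(u $ 1)\<^sup>2 + (u $ 2)\<^sup>2 = r\<^sup>2" by (simp add: r_def hnorm_sq)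
  have "(norm e)\<^sup>2 = 1"
    using r by (simp add: e_def norm_vec3_sq power_divide ru flip: add_divide_distrib)
  then have ne: "norm e = 1"
    by (simp only: norm_eq_1_iff_sq)
  have "hnorm (e - u) = hnorm ((1 / r - 1) *\<^sub>R u)"
    unfolding hnorm_def by (simp add: e_def algebra_simps)
  also have "\<dots> = 1 - r"
    using r rle by (simp add: hnorm_scaleR r_def [symmetric] abs_if field_simps)
  also have "1 - r \<le> \<bar>u $ 3\<bar>"
  proof -
    have "r * r \<le> r" using r rle by (simp add: mult_left_le)
    moreover have "(1 - r)\<^sup>2 = 1 - 2 * r + r * r" by (simp add: power2_eq_square algebra_simps)
    ultimately have "(1 - r)\<^sup>2 \<le> (u $ 3)\<^sup>2" using r2 [unfolded power2_eq_square [of r]] by linarith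
    then show ?thesis using abs_le_square_iff [of "1 - r" "u $ 3"] rle by simp
  qed
  finally have "norm (e - u) \<le> 2 * \<bar>u $ 3\<bar>"
    using norm_le_hnorm [of "e - u"] by (simp add: e_def)
  then show thesis using that [of e] ne by (simp add: e_def)
qed

text \<open>If \<open>v\<close> lies in the half-space that the beam of \<open>x\<close> does not
  reach, the way is broken at an equator point \<open>e\<close>: it leads to a point
  \<open>q\<close> on a face of the beam and goes on in the beam across that face. The two pieces
  cost \<open>2 * d\<close> and \<open>3 * d\<close>, hence the factor 5.\<close>

lemma Z_surj_near:
  assumes x: "x \<in> beam i j" and v: "norm v = 1"
  obtains z where "z $ 3 = s" "Z z = (M * exp s) *\<^sub>R v"
    "hnorm (z - x) \<le> 5 * L * lam * norm (v - dir i j x)"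
proof (cases "par i * par j * v $ 3 \<ge> 0")
  case True
  with Z_surj_in_beam [OF x v, of s] obtain z where
    "z $ 3 = s" "Z z = (M * exp s) *\<^sub>R v" "hnorm (z - x) \<le> L * lam * norm (v - dir i j x)"
    by blast
  moreover have "L * lam * norm (v - dir i j x) \<le> 5 * L * lam * norm (v - dir i j x)"
    using L_pos lam_pos by (intro mult_right_mono) auto
  ultimately show thesis using that by fastforce
next
  case False
  define d where "d = norm (v - dir i j x)"
  obtain e where e: "norm e = 1" "e $ 3 = 0" "norm (e - dir i j x) \<le> 2 * \<bar>dir i j x $ 3\<bar>"
    using nearby_equator_point norm_dir [OF x] by blast
  have "par i * par j * dir i j x $ 3 \<ge> 0"
    using hh_hemisphere [OF base_in_sqQ [OF x]] by (simp add: dir_def par_def)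
  then have "\<bar>dir i j x $ 3\<bar> \<le> \<bar>(v - dir i j x) $ 3\<bar>"
    using False by (auto simp: par_def split: if_splits)
  also have "\<dots> \<le> d" unfolding d_def by (rule component_le_norm_cart)
  finally have ed: "norm (e - dir i j x) \<le> 2 * d" using e by simp
  obtain q where q: "q \<in> beam i j" "dir i j q = e" "hnorm (q - x) \<le> L * lam * norm (e - dir i j x)"
    by (rule Z_surj_in_beam [OF x, of e s]) (use e in auto)
  have "hh (base i j q) $ 3 = 0" using q e by (auto simp: dir_def)
  then have "\<bar>base i j q $ 1\<bar> = 1 \<or> \<bar>base i j q $ 2\<bar> = 1"
    using hh_equator_iff base_in_sqQ q by blast
  then have "\<exists>i' j'. q \<in> beam i' j' \<and> base i' j' q = base i j q \<and> par i' * par j' = - (par i * par j)"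
  proof
    \<comment> \<open>Stepping over the face changes one cell index by one; the local coordinate is
      kept and the sign is flipped.\<close>
    have nb: "\<exists>k'. cell k' t \<and> loc k' t = loc k t \<and> par k' = - par k" if "\<bar>loc k t / lam\<bar> = 1" for k t
    proof -
      have "\<bar>t - 2 * of_int k * lam\<bar> = lam"
        using that lam_pos by (simp add: abs_loc)
      then consider "t - 2 * of_int k * lam = lam" | "t - 2 * of_int k * lam = - lam" by linarith
      then show ?thesis
      proof cases
        case 1
        then show ?thesis using lam_pos
          by (intro exI [of _ "k + 1"]) (auto simp: cell_def loc_def par_def algebra_simps)
      next
        case 2
        then show ?thesis using lam_pos
          by (intro exI [of _ "k - 1"]) (auto simp: cell_def loc_def par_def algebra_simps)
      qed
    qed
    {
      assume "\<bar>base i j q $ 1\<bar> = 1"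
      with nb [of i "q $ 1"] obtain i' where "cell i' (q $ 1)" "loc i' (q $ 1) = loc i (q $ 1)" "par i' = - par i"
        by (auto simp: base_def)
      then show ?thesis using q by (intro exI [of _ i'] exI [of _ j]) (auto simp: beam_def base_def)
    next
      assume "\<bar>base i j q $ 2\<bar> = 1"
      with nb [of j "q $ 2"] obtain j' where "cell j' (q $ 2)" "loc j' (q $ 2) = loc j (q $ 2)" "par j' = - par j"
        by (auto simp: base_def)
      then show ?thesis using q by (intro exI [of _ i] exI [of _ j']) (auto simp: beam_def base_def)
    }
  qed
  then obtain i' j' where b': "q \<in> beam i' j'" "base i' j' q = base i j q" "par i' * par j' = - (par i * par j)"
    by blast
  have de: "dir i' j' q = e"
  proof (rule vec3_eqI)
    show "dir i' j' q $ 1 = e $ 1" "dir i' j' q $ 2 = e $ 2"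
      unfolding q(2) [symmetric] by (simp_all add: dir_def b'(2))
    show "dir i' j' q $ 3 = e $ 3"
      using e(2) \<open>hh (base i j q) $ 3 = 0\<close> by (simp add: dir_def b'(2))
  qed
  obtain z where z: "z $ 3 = s" "Z z = (M * exp s) *\<^sub>R v" "hnorm (z - q) \<le> L * lam * norm (v - e)"
    by (rule Z_surj_in_beam [OF b'(1) v, of s]) (use False b' de in auto)
  have "norm (v - e) \<le> d + norm (e - dir i j x)"
    using norm_triangle_ineq4 [of "v - dir i j x" "e - dir i j x"] by (simp add: d_def)
  then have ve: "norm (v - e) \<le> 3 * d" using ed by simp
  have "hnorm (z - x) \<le> hnorm (z - q) + hnorm (q - x)"
    using hnorm_triangle [of "z - q" "q - x"] by simp
  also have "\<dots> \<le> L * lam * (3 * d) + L * lam * (2 * d)"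
    using z q ve ed L_pos lam_pos
    by (intro add_mono order_trans [OF z(3)] order_trans [OF q(3)] mult_left_mono) auto
  also have "\<dots> = 5 * L * lam * d" by simp
  finally show thesis using that z by (simp add: d_def)
qed

text \<open>12 = 10 + 2: in \<open>Z_ball\<close> the horizontal displacement is at most
  \<open>5 * L * lam * (2 * d)\<close> and the vertical one at most
  \<open>2 * d \<le> 2 * L * lam * d\<close>.\<close>

definition C :: real where "C = 12 * L * lam"

lemma C_pos: "C > 0" using L_pos lam_pos by (simp add: C_def)

text \<open>A quantitative open mapping property in place of a derivative:
  \<open>norm (Z x) / C\<close> is the linear expansion factor whose products are followed along
  orbits. The bound on \<open>r\<close> is \<open>C / 2\<close>; it keeps the relative displacement
  \<open>d\<close> below 1/2, so that the logarithm giving the height is under control.\<close>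

lemma Z_ball:
  assumes r: "0 < r" "r \<le> 6 * L * lam"
  shows "ball (Z x) (r * norm (Z x) / C) \<subseteq> Z ` ball x r"
proof
  fix y assume "y \<in> ball (Z x) (r * norm (Z x) / C)"
  then have yd: "norm (y - Z x) < r * norm (Z x) / C"
    by (simp add: dist_norm norm_minus_commute)
  define d where "d = norm (y - Z x) / norm (Z x)"
  have nz: "norm (Z x) > 0" using Z_nonzero by simp
  have Cd: "C * d < r" using yd nz C_pos by (simp add: d_def field_simps)
  then have "C * d < C * (1 / 2)" using r by (simp add: C_def mult_ac)
  then have d12: "d < 1 / 2" using C_pos by (simp only: mult_less_cancel_left_pos)
  define \<rho> where "\<rho> = norm y / norm (Z x)"
  have "\<bar>norm y - norm (Z x)\<bar> \<le> norm (y - Z x)" by (rule norm_triangle_ineq3)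
  then have "\<bar>norm y - norm (Z x)\<bar> / norm (Z x) \<le> d" using nz by (simp add: d_def divide_right_mono)
  moreover have "\<bar>norm y - norm (Z x)\<bar> / norm (Z x) = \<bar>\<rho> - 1\<bar>"
  proof -
    have "\<rho> - 1 = (norm y - norm (Z x)) / norm (Z x)" using nz by (simp add: \<rho>_def field_simps)
    then show ?thesis by simp
  qed
  ultimately have \<rho>d: "\<bar>\<rho> - 1\<bar> \<le> d" by simp
  then have \<rho>: "\<rho> > 1 / 2" using d12 by linarith
  then have "y \<noteq> 0" by (auto simp: \<rho>_def)
  have ln: "\<bar>ln \<rho>\<bar> \<le> 2 * d"
  proof -
    have "ln \<rho> \<le> \<rho> - 1" using \<rho> by (intro ln_le_minus_one) auto
    moreover have "- ln \<rho> \<le> 1 / \<rho> - 1"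
      using ln_le_minus_one [of "1 / \<rho>"] \<rho> by (simp add: ln_div)
    moreover have "1 / \<rho> - 1 \<le> 2 * d"
    proof -
      have "1 / \<rho> - 1 = (1 - \<rho>) / \<rho>" using \<rho> by (simp add: field_simps)
      also have "\<dots> \<le> d / \<rho>" using \<rho>d \<rho> by (intro divide_right_mono) auto
      also have "\<dots> \<le> d / (1 / 2)" using \<rho> \<rho>d by (intro divide_left_mono) auto
      finally show ?thesis by simp
    qed
    ultimately show ?thesis using \<rho>d by linarith
  qed
  obtain i j where ij: "x \<in> beam i j" using beam_exists by blast
  define s where "s = ln (norm y / M)"
  have My: "M * exp s = norm y" using M_pos \<open>y \<noteq> 0\<close> by (simp add: s_def)
  have sx: "s - x $ 3 = ln \<rho>"
    using M_pos \<open>y \<noteq> 0\<close> by (simp add: s_def \<rho>_def norm_Z ln_div ln_mult)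
  have dirx: "dir i j x = sgn (Z x)"
    using Z_beam [OF ij] M_pos norm_dir [OF ij] by (simp add: sgn_scaleR) (simp add: sgn_div_norm)
  obtain z where z: "z $ 3 = s" "Z z = (M * exp s) *\<^sub>R sgn y"
      "hnorm (z - x) \<le> 5 * L * lam * norm (sgn y - dir i j x)"
    using Z_surj_near [OF ij, of "sgn y" s] \<open>y \<noteq> 0\<close> by (auto simp: norm_sgn)
  have "Z z = y" using z \<open>y \<noteq> 0\<close> by (simp add: My sgn_div_norm)
  moreover have "norm (z - x) < r"
  proof -
    have "norm (sgn y - dir i j x) \<le> 2 * d"
      using norm_sgn_diff_le [OF Z_nonzero, of y x] by (simp add: dirx d_def)
    then have "hnorm (z - x) \<le> 5 * L * lam * (2 * d)"
      using L_pos lam_pos by (intro order_trans [OF z(3)] mult_left_mono) auto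
    moreover have "\<bar>(z - x) $ 3\<bar> \<le> 2 * d" using ln z sx by simp
    moreover have "2 * d \<le> 2 * (L * lam) * d"
      using mult_mono [OF L1 lam1] L_pos \<rho>d by (intro mult_right_mono) auto
    ultimately have "norm (z - x) \<le> C * d"
      using norm_le_hnorm [of "z - x"] by (simp add: C_def)
    then show ?thesis using Cd by simp
  qed
  ultimately show "y \<in> Z ` ball x r"
    by (auto simp: dist_norm norm_minus_commute intro!: image_eqI [of _ _ z])
qed

lemma open_Z_image:
  assumes "open S" shows "open (Z ` S)"
proof (clarsimp simp: open_contains_ball)
  fix x assume "x \<in> S"
  then obtain e where e: "e > 0" "ball x e \<subseteq> S" using assms open_contains_ball by blast
  define r where "r = min e (6 * L * lam)"
  have r: "0 < r" "r \<le> 6 * L * lam" using e L_pos lam_pos by (auto simp: r_def)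
  have "ball (Z x) (r * norm (Z x) / C) \<subseteq> Z ` ball x r" using Z_ball r by blast
  also have "\<dots> \<subseteq> Z ` S" using e by (auto simp: r_def)
  finally show "\<exists>e>0. ball (Z x) e \<subseteq> Z ` S"
    using r C_pos Z_nonzero by (intro exI [of _ "r * norm (Z x) / C"]) auto
qed

lemma continuous_on_Z: "continuous_on S Z"
proof -
  have "(Z \<longlongrightarrow> Z x) (at x)" for x
  proof -
    \<comment> \<open>At a cell endpoint \<open>s\<close> has neighbours in two cells. The common
      cell may depend on \<open>t\<close>, but each nearby \<open>t\<close> shares one with
      \<open>s\<close>.\<close>
    have near: "\<exists>\<eta>>0. \<forall>t. \<bar>t - s\<bar> < \<eta> \<longrightarrow> (\<exists>i. cell i s \<and> cell i t)" for s
    proof -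
      define i where "i = \<lfloor>(s + lam) / (2 * lam)\<rfloor>"
      have i: "of_int i * (2 * lam) \<le> s + lam" "s + lam < (of_int i + 1) * (2 * lam)"
        using lam_pos floor_correct [of "(s + lam) / (2 * lam)"]
        by (simp_all add: i_def flip: pos_le_divide_eq pos_divide_less_eq)
      show ?thesis
      proof (cases "of_int i * (2 * lam) = s + lam")
        case True
        show ?thesis
        proof (intro exI [of _ lam] conjI allI impI)
          fix t assume t: "\<bar>t - s\<bar> < lam"
          show "\<exists>k. cell k s \<and> cell k t"
          proof (cases "t \<ge> s")
            case True
            then show ?thesis using i t \<open>of_int i * (2 * lam) = s + lam\<close>
              by (intro exI [of _ i]) (auto simp: cell_def algebra_simps)
          next
            case False
            then show ?thesis using i t \<open>of_int i * (2 * lam) = s + lam\<close>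
              by (intro exI [of _ "i - 1"]) (auto simp: cell_def algebra_simps)
          qed
        qed (use lam_pos in auto)
      next
        case False
        then show ?thesis using i
          by (intro exI [of _ "min (s + lam - of_int i * (2 * lam)) ((of_int i + 1) * (2 * lam) - (s + lam))"])
             (auto simp: cell_def algebra_simps intro!: exI [of _ i])
      qed
    qed
    obtain \<eta>1 \<eta>2 where \<eta>: "\<eta>1 > 0" "\<eta>2 > 0"
      "\<And>t. \<bar>t - x $ 1\<bar> < \<eta>1 \<Longrightarrow> \<exists>i. cell i (x $ 1) \<and> cell i t"
      "\<And>t. \<bar>t - x $ 2\<bar> < \<eta>2 \<Longrightarrow> \<exists>i. cell i (x $ 2) \<and> cell i t"
      using near [of "x $ 1"] near [of "x $ 2"] by blast
    define g where "g z = M * \<bar>exp (z $ 3) - exp (x $ 3)\<bar> + M * exp (x $ 3) * (L * hnorm (z - x) / lam)" for z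
    have le: "norm (Z z - Z x) \<le> g z" if "dist z x < min \<eta>1 \<eta>2" for z
    proof -
      have "\<bar>(z - x) $ 1\<bar> < \<eta>1" "\<bar>(z - x) $ 2\<bar> < \<eta>2"
        using that component_le_norm_cart [of "z - x"] by (auto simp: dist_norm intro: le_less_trans)
      then obtain i j where ij: "x \<in> beam i j" "z \<in> beam i j"
        using \<eta> by (fastforce simp: beam_def)
      have "Z z - Z x = (M * (exp (z $ 3) - exp (x $ 3))) *\<^sub>R dir i j z + (M * exp (x $ 3)) *\<^sub>R (dir i j z - dir i j x)"
        unfolding Z_beam [OF ij(1)] Z_beam [OF ij(2)] by (simp add: algebra_simps)
      also have "norm \<dots> \<le> \<bar>M * (exp (z $ 3) - exp (x $ 3))\<bar> * norm (dir i j z) + \<bar>M * exp (x $ 3)\<bar> * norm (dir i j z - dir i j x)"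
        by (metis norm_scaleR norm_triangle_ineq)
      also have "\<dots> \<le> g z"
        unfolding g_def using M_pos
        by (intro add_mono mult_left_mono mult_mono [of "\<bar>M * exp (x $ 3)\<bar>"] dir_bilipschitz(2) [OF ij(2) ij(1)])
           (auto simp: abs_mult norm_dir [OF ij(2)])
      finally show ?thesis .
    qed
    have lim: "(g \<longlongrightarrow> 0) (at x)"
    proof -
      have "isCont g x"
        unfolding g_def hnorm_def using lam_nz by (intro continuous_intros) auto
      moreover have "g x = 0" by (simp add: g_def hnorm_def)
      ultimately show ?thesis by (metis isCont_def)
    qed
    have "eventually (\<lambda>z. norm (Z z - Z x) \<le> g z) (at x)"
      unfolding eventually_at
    proof (intro exI conjI ballI impI)
      show "min \<eta>1 \<eta>2 > 0" using \<eta>(1,2) by simp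
      show "norm (Z z - Z x) \<le> g z" if "z \<noteq> x \<and> dist z x < min \<eta>1 \<eta>2" for z
        using that le by blast
    qed
    from Lim_null_comparison [OF this lim] have "((\<lambda>z. Z z - Z x) \<longlongrightarrow> 0) (at x)" .
    then show ?thesis by (simp add: LIM_zero_iff)
  qed
  then show ?thesis
    by (meson continuous_at_imp_continuous_on isCont_def)
qed

section \<open>Behaviour near the axis\<close>

lemma hnorm_dir_sq:
  assumes "x \<in> beam i j"
  shows "(hnorm (dir i j x))\<^sup>2 = 1 - (dir i j x $ 3)\<^sup>2"
  using norm_dir [OF assms] norm_sq_hnorm [of "dir i j x"] by simp

lemma beam_0: "x \<in> beam 0 0 \<longleftrightarrow> \<bar>x $ 1\<bar> \<le> lam \<and> \<bar>x $ 2\<bar> \<le> lam"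
  by (simp add: beam_def cell_def)

lemma dir_0: "dir 0 0 0 = vector [0, 0, 1]"
  using hh_0 by (simp add: dir_def base_def loc_def par_def)

lemma norm_dir_diff_0:
  assumes "x \<in> beam 0 0"
  shows "(norm (dir 0 0 x - dir 0 0 0))\<^sup>2 = 2 * (1 - dir 0 0 x $ 3)"
proof -
  have "(norm (dir 0 0 x - dir 0 0 0))\<^sup>2 = (hnorm (dir 0 0 x))\<^sup>2 + (dir 0 0 x $ 3 - 1)\<^sup>2"
    by (simp add: norm_vec3_sq hnorm_sq dir_0)
  then show ?thesis using hnorm_dir_sq [OF assms] by (simp add: power2_eq_square algebra_simps)
qed

text \<open>In the central beam this is the upper Lipschitz bound relative to the axis, whose
  direction is the north pole. Elsewhere \<open>hnorm x \<ge> lam\<close>, and the trivial bound by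
  \<open>norm (Z x)\<close> is enough.\<close>

lemma hnorm_Z_le: "hnorm (Z x) \<le> L * nu * exp (x $ 3) * hnorm x"
proof (cases "x \<in> beam 0 0")
  case True
  have 0: "(0::real^3) \<in> beam 0 0" using lam_pos by (simp add: beam_0)
  have "hnorm (dir 0 0 x) = hnorm (dir 0 0 x - dir 0 0 0)" by (simp add: hnorm_def dir_0)
  also have "\<dots> \<le> norm (dir 0 0 x - dir 0 0 0)" by (rule hnorm_le_norm)
  also have "\<dots> \<le> L * hnorm x / lam" using dir_bilipschitz(2) [OF True 0] by simp
  finally have "M * exp (x $ 3) * hnorm (dir 0 0 x) \<le> M * exp (x $ 3) * (L * hnorm x / lam)"
    using M_pos by (intro mult_left_mono) auto
  then show ?thesis
    using M_pos lam_pos nu_pos by (simp add: Z_beam [OF True] hnorm_scaleR M_def abs_mult mult_ac)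
next
  case False
  then have "\<bar>x $ 1\<bar> > lam \<or> \<bar>x $ 2\<bar> > lam" by (auto simp: beam_0)
  then have "lam \<le> hnorm x" using component_le_hnorm [of x] by linarith
  have "hnorm (Z x) \<le> M * exp (x $ 3)" using hnorm_le_norm [of "Z x"] by (simp add: norm_Z)
  also have "\<dots> = nu * exp (x $ 3) * (1 * lam)" by (simp add: M_def)
  also have "\<dots> \<le> nu * exp (x $ 3) * (L * hnorm x)"
    using \<open>lam \<le> hnorm x\<close> L1 nu_pos lam_pos by (intro mult_left_mono mult_mono) auto
  finally show ?thesis by (simp add: mult_ac)
qed

text \<open>Up to distance \<open>lam / L\<close> the direction stays within 1 of the north pole, so
  its third component is at least 1/2. On that cap the chord to the pole is at most twice its
  horizontal part, which gives the 2 in the second bound.\<close>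

lemma near_axis:
  assumes "hnorm x \<le> lam / L"
  shows "M * exp (x $ 3) / 2 \<le> Z x $ 3"
    and "nu * exp (x $ 3) * hnorm x / (2 * L) \<le> hnorm (Z x)"
proof -
  have "hnorm x \<le> lam" 
  proof -
    have "lam / L \<le> lam / 1" using L1 lam_pos by (intro divide_left_mono) auto
    with assms show ?thesis by simp
  qed
  then have x: "x \<in> beam 0 0" using component_le_hnorm [of x] by (simp add: beam_0)
  have 0: "(0::real^3) \<in> beam 0 0" using lam_pos by (simp add: beam_0)
  have "norm (dir 0 0 x - dir 0 0 0) \<le> L * hnorm x / lam" using dir_bilipschitz(2) [OF x 0] by simp
  also have "\<dots> \<le> 1" using assms L_pos lam_pos by (simp add: field_simps)
  finally have "(norm (dir 0 0 x - dir 0 0 0))\<^sup>2 \<le> 1" by (simp add: power_le_one)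
  then have d3: "dir 0 0 x $ 3 \<ge> 1 / 2" using norm_dir_diff_0 [OF x] by simp
  then have "M * exp (x $ 3) * (1 / 2) \<le> M * exp (x $ 3) * dir 0 0 x $ 3"
    using M_pos by (intro mult_left_mono) auto
  then show "M * exp (x $ 3) / 2 \<le> Z x $ 3" by (simp add: Z_beam [OF x])
  have d1: "dir 0 0 x $ 3 \<le> 1"
    using component_le_norm_cart [of "dir 0 0 x" 3] norm_dir [OF x] by linarith
  have "(hnorm x / (lam * L))\<^sup>2 \<le> (norm (dir 0 0 x - dir 0 0 0))\<^sup>2"
    using dir_bilipschitz(1) [OF x 0] L_pos lam_pos by (intro power_mono) auto
  also have "\<dots> \<le> 2 * (1 - (dir 0 0 x $ 3)\<^sup>2)"
    using d3 d1 mult_left_le [of "dir 0 0 x $ 3" "dir 0 0 x $ 3"]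
    unfolding norm_dir_diff_0 [OF x] by (simp add: power2_eq_square)
  also have "\<dots> \<le> (2 * hnorm (dir 0 0 x))\<^sup>2"
    using hnorm_dir_sq [OF x] zero_le_power2 [of "hnorm (dir 0 0 x)"]
    unfolding power_mult_distrib by simp
  finally have "hnorm x / (lam * L) \<le> 2 * hnorm (dir 0 0 x)"
    by (rule power2_le_imp_le) simp
  then have "M * exp (x $ 3) * (hnorm x / (lam * L)) \<le> M * exp (x $ 3) * (2 * hnorm (dir 0 0 x))"
    using M_pos by (intro mult_left_mono) auto
  then show "nu * exp (x $ 3) * hnorm x / (2 * L) \<le> hnorm (Z x)"
    using M_pos lam_pos L_pos nu_pos by (simp add: Z_beam [OF x] hnorm_scaleR M_def abs_mult field_simps)
qed

section \<open>The diagonal planes and their preimages\<close>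

lemma hh_diagonal:
  assumes "\<bar>a\<bar> \<le> 1" "e = 1 \<or> e = -1"
  shows "hh (vector [a, e * a]) $ 2 = e * hh (vector [a, e * a]) $ 1"
  using assms bspec [OF diag, of a] bspec [OF antidiag, of a] by (auto simp: abs_le_iff)

text \<open>The plane is followed through the beams \<open>(i, i)\<close> for \<open>e = 1\<close>
  and \<open>(i, - i)\<close> for \<open>e = -1\<close>. Both indices have the same parity, so the
  signs multiply to 1 and the image stays in the upper half-space.\<close>

lemma Z_plane:
  assumes e: "e = 1 \<or> e = -1" and x: "x $ 2 = e * x $ 1"
  shows "Z x $ 2 = e * Z x $ 1" and "Z x $ 3 \<ge> 0"
proof -
  obtain i where i: "cell i (x $ 1)" using cell_exists by blast
  define j where "j = (if e = 1 then i else - i)"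
  have par: "par j = par i" and "cell j (x $ 2)" and l: "loc j (x $ 2) = e * loc i (x $ 1)"
    using i e x by (auto simp: j_def cell_def loc_def par_def algebra_simps)
  then have b: "x \<in> beam i j" using i by (simp add: beam_def)
  have "\<bar>loc i (x $ 1) / lam\<bar> \<le> 1" using i lam_pos by (simp add: abs_loc cell_def)
  from hh_diagonal [OF this e] show "Z x $ 2 = e * Z x $ 1"
    by (simp add: Z_beam [OF b] dir_def base_def l)
  show "Z x $ 3 \<ge> 0"
    using M_pos hh_hemisphere [OF base_in_sqQ [OF b]] by (simp add: Z_beam [OF b] dir_def par)
qed

text \<open>In coordinates \<open>a\<close>, \<open>c\<close> centred in a beam the condition reads
  \<open>a + e * c = 2 * n * lam\<close>, with both of modulus at most \<open>lam\<close>. So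
  \<open>n = 0\<close> or both have modulus \<open>lam\<close>; either way the point lies over a
  diagonal of the square.\<close>

lemma Z_preplane:
  assumes e: "e = 1 \<or> e = -1" and x: "x $ 1 + e * x $ 2 = 2 * of_int k * lam"
  shows "Z x $ 2 = Z x $ 1 \<or> Z x $ 2 = - Z x $ 1"
proof -
  obtain i j where b: "x \<in> beam i j" using beam_exists by blast
  define a c where "a = x $ 1 - 2 * of_int i * lam" and "c = x $ 2 - 2 * of_int j * lam"
  have ac: "\<bar>a\<bar> \<le> lam" "\<bar>c\<bar> \<le> lam" using b by (auto simp: beam_def cell_def a_def c_def)
  have "\<exists>n::int. a + e * c = 2 * of_int n * lam"
    using e x by (intro exI [of _ "k - i - (if e = 1 then j else - j)"]) (auto simp: a_def c_def algebra_simps)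
  then obtain n :: int where n: "a + e * c = 2 * of_int n * lam" by blast
  have "\<bar>c\<bar> = \<bar>a\<bar>"
  proof (cases "n = 0")
    case True then show ?thesis using n e by auto
  next
    case False
    then have "\<bar>2 * of_int n * lam\<bar> \<ge> 2 * lam" using lam_pos by (simp add: abs_mult)
    moreover have "\<bar>a + e * c\<bar> \<le> \<bar>a\<bar> + \<bar>c\<bar>" using e by auto
    ultimately show ?thesis using n ac by linarith
  qed
  then have "\<bar>loc j (x $ 2)\<bar> = \<bar>loc i (x $ 1)\<bar>" by (simp add: abs_loc a_def c_def)
  then obtain e' :: real where e': "e' = 1 \<or> e' = -1" "loc j (x $ 2) = e' * loc i (x $ 1)"
    by (metis abs_eq_iff mult_1 mult_minus1)
  have "\<bar>loc i (x $ 1) / lam\<bar> \<le> 1" using b lam_pos by (simp add: abs_loc cell_def beam_def)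
  from hh_diagonal [OF this e'(1)] have "Z x $ 2 = e' * Z x $ 1"
    by (simp add: Z_beam [OF b] dir_def base_def e'(2))
  then show ?thesis using e'(1) by auto
qed

lemma Z_centre:
  assumes "x $ 1 = 2 * of_int i * lam" "x $ 2 = 2 * of_int j * lam"
  shows "hnorm (Z x) = 0"
proof -
  have b: "x \<in> beam i j" using assms lam_pos by (simp add: beam_def cell_def)
  have "base i j x = vector [0, 0]" using assms by (simp add: base_def loc_def)
  then show ?thesis using hh_0 by (simp add: Z_beam [OF b] dir_def hnorm_def)
qed

lemma Z_axis:
  assumes "hnorm x = 0"
  shows "Z x = vector [0, 0, M * exp (x $ 3)]"
proof -
  have b: "x \<in> beam 0 0" using assms lam_pos by (simp add: beam_0 hnorm_eq_0)
  have "base 0 0 x = vector [0, 0]" using assms by (simp add: base_def loc_def hnorm_eq_0)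
  then have "dir 0 0 x = vector [0, 0, 1]" by (simp add: dir_def hh_0 par_def)
  then show ?thesis unfolding Z_beam [OF b] by (intro vec3_eqI) simp_all
qed

section \<open>Orbits and expansion factors\<close>

text \<open>Vertical lines that \<open>Z\<close> maps into the axis. They bound the size of images:
  a set avoiding them contains no ball of radius above \<open>2 * lam\<close>.\<close>

definition centres :: "(real^3) set" where
  "centres = {x. \<exists>i j::int. x $ 1 = 2 * of_int i * lam \<and> x $ 2 = 2 * of_int j * lam}"

lemma ball_meets_centres:
  assumes "r > 2 * lam" shows "ball p r \<inter> centres \<noteq> {}"
proof -
  obtain i j where b: "p \<in> beam i j" using beam_exists by blast
  define q :: "real^3" where "q = vector [2 * of_int i * lam, 2 * of_int j * lam, p $ 3]"
  have "hnorm (p - q) \<le> norm (vector [p $ 1 - q $ 1, 0, 0] :: real^3) + norm (vector [0, p $ 2 - q $ 2, 0] :: real^3)"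
    unfolding hnorm_eq_norm3
    by (intro order_trans [OF _ norm_triangle_ineq] eq_refl arg_cong [where f = norm] vec3_eqI) auto
  also have "norm (vector [p $ 1 - q $ 1, 0, 0] :: real^3) = \<bar>p $ 1 - q $ 1\<bar>"
    by (rule power2_eq_imp_eq) (simp_all add: norm_vec3_sq)
  also have "norm (vector [0, p $ 2 - q $ 2, 0] :: real^3) = \<bar>p $ 2 - q $ 2\<bar>"
    by (rule power2_eq_imp_eq) (simp_all add: norm_vec3_sq)
  finally have "hnorm (p - q) \<le> 2 * lam" using b by (simp add: q_def beam_def cell_def)
  then have "norm (p - q) \<le> 2 * lam" using norm_le_hnorm [of "p - q"] by (simp add: q_def)
  then have "q \<in> ball p r" using assms by (simp add: dist_norm)
  moreover have "q \<in> centres" by (auto simp: centres_def q_def)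
  ultimately show ?thesis by blast
qed

text \<open>\<open>Z_ball\<close> is iterated. The bound \<open>\<rho> n \<le> 2 * lam\<close>,
  forced by the avoided centres, keeps the radius within the range of \<open>Z_ball\<close> and so
  closes the induction; it is also the bound on the product.\<close>

lemma product_bounded_if_avoids_centres:
  assumes "open V" "x \<in> V" and avoid: "\<And>n. (Z ^^ n) ` V \<inter> centres = {}"
  shows "\<exists>B. \<forall>n. (\<Prod>j<n. norm ((Z ^^ Suc j) x) / C) \<le> B"
proof -
  obtain r where r: "r > 0" "ball x r \<subseteq> V" using assms open_contains_ball by blast
  define \<rho> where "\<rho> n = r * (\<Prod>j<n. norm ((Z ^^ Suc j) x) / C)" for n
  have pos: "\<rho> n > 0" for n
    unfolding \<rho>_def using r C_pos Z_nonzero by (intro mult_pos_pos prod_pos) auto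
  have small: "\<rho> n \<le> 2 * lam" if "ball ((Z ^^ n) x) (\<rho> n) \<subseteq> (Z ^^ n) ` V" for n
    using ball_meets_centres [of "\<rho> n" "(Z ^^ n) x"] avoid [of n] that by (meson disjoint_iff subsetD not_le)
  have sub: "ball ((Z ^^ n) x) (\<rho> n) \<subseteq> (Z ^^ n) ` V" for n
  proof (induction n)
    case 0
    then show ?case using r by (simp add: \<rho>_def)
  next
    case (Suc n)
    have "2 * lam \<le> 6 * L * lam" using L1 lam_pos by simp
    with small [OF Suc] have "ball (Z ((Z ^^ n) x)) (\<rho> n * norm (Z ((Z ^^ n) x)) / C) \<subseteq> Z ` ball ((Z ^^ n) x) (\<rho> n)"
      using pos by (intro Z_ball) auto
    also have "\<dots> \<subseteq> Z ` ((Z ^^ n) ` V)" using Suc by (rule image_mono)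
    finally show ?case by (simp add: \<rho>_def image_comp mult.assoc)
  qed
  show ?thesis
  proof (intro exI [of _ "2 * lam / r"] allI)
    fix n
    show "(\<Prod>j<n. norm ((Z ^^ Suc j) x) / C) \<le> 2 * lam / r"
      using small [OF sub [of n]] r by (simp add: \<rho>_def field_simps)
  qed
qed

section \<open>Escape along the axis and covering from an axis point\<close>

lemma axis_orbit:
  assumes "hnorm x = 0"
  shows "hnorm ((Z ^^ n) x) = 0" and "(Z ^^ Suc n) x $ 3 \<ge> real n"
proof -
  show *: "hnorm ((Z ^^ n) x) = 0" for n
    by (induction n) (use assms in \<open>auto simp: Z_axis\<close>, simp add: hnorm_def)
  show "(Z ^^ Suc n) x $ 3 \<ge> real n"
  proof (induction n)
    case 0
    then show ?case using Z_axis [OF assms] M_pos by simp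
  next
    case (Suc n)
    \<comment> \<open>With \<open>M \<ge> 1\<close> and \<open>exp t \<ge> 1 + t\<close> the height
      rises by at least 1 per step. The count starts after one step because the initial height may
      be very negative.\<close>
    have "1 \<le> M"
    proof (rule ccontr)
      assume "\<not> 1 \<le> M"
      then have "M\<^sup>2 \<le> 1" using M_pos by (intro power_le_one) auto
      then show False using M_sq by simp
    qed
    have "real (Suc n) \<le> 1 + (Z ^^ Suc n) x $ 3" using Suc by simp
    also have "\<dots> \<le> 1 * exp ((Z ^^ Suc n) x $ 3)" using exp_ge_add_one_self by simp
    also have "\<dots> \<le> M * exp ((Z ^^ Suc n) x $ 3)" using \<open>1 \<le> M\<close> by (intro mult_right_mono) auto
    also have "\<dots> = (Z ^^ Suc (Suc n)) x $ 3"
      using Z_axis [OF * [of "Suc n"]] by simp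
    finally show ?case .
  qed
qed

text \<open>The cap \<open>6 * L * lam\<close> is the largest radius allowed in
  \<open>Z_ball\<close>; with the minimum the doubling can be iterated until the cap is
  reached.\<close>

lemma Z_ball_doubling:
  assumes "ball p (min (6 * L * lam) \<rho>) \<subseteq> W" "\<rho> > 0" "norm (Z p) \<ge> 2 * C"
  shows "ball (Z p) (min (6 * L * lam) (2 * \<rho>)) \<subseteq> Z ` W"
proof -
  define r where "r = min (6 * L * lam) \<rho>"
  have r: "0 < r" "r \<le> 6 * L * lam" using assms L_pos lam_pos by (auto simp: r_def)
  have "min K (2 * \<rho>) \<le> min K \<rho> * 2" if "0 < K" for K :: real using that by auto
  then have "min (6 * L * lam) (2 * \<rho>) \<le> r * 2" using L_pos lam_pos by (simp add: r_def)
  also have "\<dots> \<le> r * (norm (Z p) / C)"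
    using assms(3) r C_pos by (intro mult_left_mono) (auto simp: field_simps)
  finally have "ball (Z p) (min (6 * L * lam) (2 * \<rho>)) \<subseteq> ball (Z p) (r * norm (Z p) / C)"
    by (intro subset_ball) simp
  also have "\<dots> \<subseteq> Z ` ball p r" using Z_ball r by blast
  also have "\<dots> \<subseteq> Z ` W" using assms(1) by (auto simp: r_def)
  finally show ?thesis .
qed

text \<open>Two adjacent beams of opposite sign, with first indices \<open>2 * k\<close> and
  \<open>2 * k + 1\<close>, together reach every direction. The free \<open>k\<close> puts the
  preimage as far out as desired.\<close>

lemma Z_preimage_in_column:
  assumes "y \<noteq> 0"
  obtains z where "Z z = y" "z $ 3 = ln (norm y / M)"
    "\<bar>z $ 1 - (4 * of_int k + 1) * lam\<bar> \<le> 2 * lam" "\<bar>z $ 2\<bar> \<le> lam"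
proof -
  define m where "m = (if sgn y $ 3 \<ge> 0 then 2 * k else 2 * k + 1)"
  have m: "m = 2 * k \<or> m = 2 * k + 1" "par m * par 0 * (sgn y) $ 3 \<ge> 0"
    by (auto simp: m_def par_def)
  define b :: "real^3" where "b = vector [2 * of_int m * lam, 0, 0]"
  have b: "b \<in> beam m 0" using lam_pos by (simp add: b_def beam_def cell_def)
  have n: "norm (sgn y) = 1" using assms by (simp add: norm_sgn)
  obtain z where z: "z \<in> beam m 0" "z $ 3 = ln (norm y / M)" "Z z = (M * exp (ln (norm y / M))) *\<^sub>R sgn y"
    by (rule Z_surj_in_beam [OF b n m(2)])
  have "Z z = y" using z M_pos assms by (simp add: sgn_div_norm)
  moreover have "\<bar>z $ 1 - (4 * of_int k + 1) * lam\<bar> \<le> 2 * lam" "\<bar>z $ 2\<bar> \<le> lam"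
    using z(1) m(1) lam_pos by (auto simp: beam_def cell_def algebra_simps abs_le_iff)
  ultimately show thesis using that z by blast
qed

text \<open>A ball of radius \<open>6 * L * lam\<close> about a high axis point contains a full pair
  of adjacent beams within height 1, so its image contains the shell of radii \<open>Q / 2\<close>
  to \<open>2 * Q\<close>. Preimages of \<open>w\<close> recur periodically at a fixed height; one
  of them lies in the shell, and a second step reaches \<open>w\<close>.\<close>

lemma covers_of_axis_point:
  assumes "open V" "x \<in> V" "hnorm x = 0" "w \<noteq> 0"
  shows "\<exists>n. w \<in> (Z ^^ n) ` V"
proof -
  define a where "a n = (Z ^^ n) x $ 3" for n
  have a: "a (Suc n) \<ge> real n" for n using axis_orbit(2) [OF assms(3)] by (simp add: a_def)
  have nZ: "norm ((Z ^^ Suc n) x) = M * exp (a n)" for n by (simp add: norm_Z a_def)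
  have "eventually (\<lambda>n::nat. M * exp (real n) \<ge> 2 * C) sequentially"
    using M_pos by real_asymp
  then obtain N0 where N0: "\<And>n. n \<ge> N0 \<Longrightarrow> M * exp (real n) \<ge> 2 * C"
    by (auto simp: eventually_sequentially)
  define N where "N = Suc N0"
  have big: "norm (Z ((Z ^^ n) x)) \<ge> 2 * C" if n: "n \<ge> N" for n
  proof -
    obtain m where m: "n = Suc m" "m \<ge> N0" using n by (cases n) (auto simp: N_def)
    have "2 * C \<le> M * exp (real m)" using N0 m by blast
    also have "\<dots> \<le> M * exp (a n)" using a [of m] m M_pos by simp
    finally show ?thesis using nZ [of n] by simp
  qed
  have op: "open ((Z ^^ n) ` V)" for n
  proof (induction n)
    case (Suc n)
    then show ?case using open_Z_image [OF Suc] by (simp add: image_comp)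
  qed (use assms(1) in simp)
  have "(Z ^^ N) x \<in> (Z ^^ N) ` V" using assms by blast
  then obtain r where r: "r > 0" "ball ((Z ^^ N) x) r \<subseteq> (Z ^^ N) ` V"
    using op [of N] open_contains_ball by blast
  have grow: "ball ((Z ^^ (N + k)) x) (min (6 * L * lam) (2 ^ k * r)) \<subseteq> (Z ^^ (N + k)) ` V" for k
  proof (induction k)
    case 0
    then show ?case using r by auto
  next
    case (Suc k)
    have "ball (Z ((Z ^^ (N + k)) x)) (min (6 * L * lam) (2 * (2 ^ k * r))) \<subseteq> Z ` (Z ^^ (N + k)) ` V"
      using r by (intro Z_ball_doubling Suc big) auto
    then show ?case by (simp add: image_comp mult.assoc)
  qed
  define R where "R n = M * exp (a n)" for n
  have ev1: "eventually (\<lambda>k. 2 ^ k * r \<ge> 6 * L * lam) sequentially"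
    using r by real_asymp
  \<comment> \<open>\<open>norm w / M + M / norm w\<close> bounds the modulus of the height
    \<open>ln (norm w / M)\<close> of a preimage of \<open>w\<close>; \<open>18 * lam\<close> leaves
    room for its horizontal position.\<close>
  have ev2: "eventually (\<lambda>k. M * exp (real k) \<ge> 18 * lam + norm w / M + M / norm w) sequentially"
    using M_pos by real_asymp
  obtain k where k: "2 ^ k * r \<ge> 6 * L * lam" "M * exp (real k) \<ge> 18 * lam + norm w / M + M / norm w"
    using eventually_happens [OF eventually_conj [OF ev1 ev2]] by auto
  define n where "n = N + k"
  define p where "p = (Z ^^ n) x"
  have p0: "p $ 1 = 0" "p $ 2 = 0" using axis_orbit(1) [OF assms(3), of n] by (auto simp: p_def hnorm_eq_0)
  have pball: "ball p (6 * L * lam) \<subseteq> (Z ^^ n) ` V" using grow [of k] k by (simp add: p_def n_def)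
  define Q where "Q = M * exp (p $ 3)"
  have "real k \<le> p $ 3" using a [of "N0 + k"] by (simp add: p_def n_def N_def a_def)
  then have "M * exp (real k) \<le> Q" using M_pos by (simp add: Q_def)
  then have Q: "Q \<ge> 18 * lam + norm w / M + M / norm w" using k by linarith
  have pos: "norm w / M > 0" "M / norm w > 0" using M_pos assms by auto
  have e2: "exp (1::real) \<ge> 2" using exp_ge_add_one_self [of 1] by simp
  have shell: "y \<in> (Z ^^ Suc n) ` V" if y: "Q / 2 \<le> norm y" "norm y \<le> 2 * Q" for y
  proof -
    have "Q > 0" using Q pos lam_pos by linarith
    then have "y \<noteq> 0" using y by auto
    then obtain z where z: "Z z = y" "z $ 3 = ln (norm y / M)"
      "\<bar>z $ 1 - (4 * of_int 0 + 1) * lam\<bar> \<le> 2 * lam" "\<bar>z $ 2\<bar> \<le> lam"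
      by (rule Z_preimage_in_column)
    have "M * exp (z $ 3) = norm y" using z(1) by (metis norm_Z)
    then have ex: "Q * (1 / 2) \<le> Q * exp (z $ 3 - p $ 3)" "Q * exp (z $ 3 - p $ 3) \<le> Q * 2"
      using y by (simp_all add: Q_def mult.assoc flip: exp_add)
    then have ex: "1 / 2 \<le> exp (z $ 3 - p $ 3)" "exp (z $ 3 - p $ 3) \<le> 2"
      using \<open>Q > 0\<close> by (simp_all only: mult_le_cancel_left_pos)
    \<comment> \<open>As \<open>exp 1 \<ge> 2\<close>, a factor of at most 2 in the modulus is a
      height difference of at most 1.\<close>
    have "exp (z $ 3 - p $ 3) \<le> exp 1" using ex e2 by linarith
    moreover have "exp (- 1 :: real) \<le> 1 / 2" using e2 by (simp add: exp_minus field_simps)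
    then have "exp (- 1) \<le> exp (z $ 3 - p $ 3)" using ex by linarith
    ultimately have z3: "\<bar>z $ 3 - p $ 3\<bar> \<le> 1" by (simp add: abs_le_iff)
    have "norm (z - p) \<le> \<bar>(z - p) $ 1\<bar> + \<bar>(z - p) $ 2\<bar> + \<bar>(z - p) $ 3\<bar>"
      using norm_le_l1_cart [of "z - p"] by (simp add: sum_3)
    also have "\<dots> \<le> 3 * lam + lam + 1" using z z3 p0 by (auto simp: abs_le_iff)
    also have "\<dots> < 6 * 1 * lam" using lam1 by simp
    also have "\<dots> \<le> 6 * L * lam" using L1 lam_pos by (intro mult_right_mono) auto
    finally have "z \<in> (Z ^^ n) ` V" using pball by (auto simp: dist_norm norm_minus_commute)
    then show ?thesis using z(1) by (auto simp flip: image_comp)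
  qed
  \<comment> \<open>The least column that lies wholly in \<open>x $ 1 \<ge> Q / 2\<close>.\<close>
  define kk where "kk = \<lceil>(Q / 2 + lam) / (4 * lam)\<rceil>"
  have kk: "Q / 2 + lam \<le> 4 * of_int kk * lam" "4 * of_int kk * lam \<le> Q / 2 + 5 * lam"
  proof -
    have "(Q / 2 + lam) / (4 * lam) \<le> of_int kk" "of_int kk \<le> (Q / 2 + lam) / (4 * lam) + 1"
      unfolding kk_def by linarith+
    then show "Q / 2 + lam \<le> 4 * of_int kk * lam" "4 * of_int kk * lam \<le> Q / 2 + 5 * lam"
      using lam_pos by (simp_all add: field_simps)
  qed
  obtain z where z: "Z z = w" "z $ 3 = ln (norm w / M)"
      "\<bar>z $ 1 - (4 * of_int kk + 1) * lam\<bar> \<le> 2 * lam" "\<bar>z $ 2\<bar> \<le> lam"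
    using Z_preimage_in_column [OF \<open>w \<noteq> 0\<close>] by blast
  have z3: "\<bar>z $ 3\<bar> \<le> Q - 18 * lam"
  proof -
    have "ln (norm w / M) \<le> norm w / M" using pos by (intro ln_bound)
    moreover have "- ln (norm w / M) \<le> M / norm w"
      using ln_bound [OF pos(2)] M_pos assms by (simp add: ln_div)
    ultimately show ?thesis using z(2) Q pos by linarith
  qed
  have z1: "Q / 2 \<le> z $ 1" "z $ 1 \<le> Q / 2 + 8 * lam"
    using z(3) kk by (auto simp: abs_le_iff algebra_simps)
  have "Q / 2 \<le> norm z" using component_le_norm_cart [of z 1] z1 by linarith
  moreover have "norm z \<le> 2 * Q"
  proof -
    have "norm z \<le> \<bar>z $ 1\<bar> + \<bar>z $ 2\<bar> + \<bar>z $ 3\<bar>"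
      using norm_le_l1_cart [of z] by (simp add: sum_3)
    then show ?thesis using z1 z(4) z3 Q pos lam_pos by linarith
  qed
  ultimately have "z \<in> (Z ^^ Suc n) ` V" by (rule shell)
  then have "w \<in> (Z ^^ Suc (Suc n)) ` V" using z(1) by (auto simp flip: image_comp)
  then show ?thesis ..
qed

section \<open>Excursions along the axis and growth of the expansion products\<close>

lemma M_half_exp: "M / 2 * exp s \<ge> s + 1 / 2"
proof -
  \<comment> \<open>Near the axis one step only guarantees the new height
    \<open>M / 2 * exp s\<close>. Since \<open>M\<^sup>2 > 2\<close>,
    \<open>ln (M / 2) \<ge> - ln 2 / 2 \<ge> - 1 / 2\<close>, and the height still rises by
    1/2.\<close>
  have "ln 2 \<le> 2 * ln M"
    using M_sq M_pos ln_mono [of 2 "M\<^sup>2"] by (simp add: ln_realpow)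
  moreover have "ln 2 \<le> (1::real)" using ln_le_minus_one [of 2] by simp
  moreover have "ln (M / 2) = ln M - ln 2" using M_pos by (simp add: ln_div)
  ultimately have "s + 1 / 2 \<le> 1 + (ln (M / 2) + s)" by linarith
  also have "\<dots> \<le> exp (ln (M / 2) + s)" by (rule exp_ge_add_one_self)
  also have "\<dots> = M / 2 * exp s" using M_pos by (simp add: exp_add)
  finally show ?thesis by simp
qed

lemma M_half: "M / 2 > 1 / 2"
proof -
  have "1 < M"
  proof (rule ccontr)
    assume "\<not> 1 < M"
    then have "M\<^sup>2 \<le> 1" using M_pos by (intro power_le_one) auto
    then show False using M_sq by simp
  qed
  then show ?thesis by simp
qed

definition tube :: real where "tube = lam / L"

lemma tube_pos: "tube > 0" using lam_pos L_pos by (simp add: tube_def)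

text \<open>In the tube the heights grow, so the horizontal expansion eventually exceeds 2 and the
  orbit must leave. Each step multiplies \<open>hnorm\<close> by at most
  \<open>L * nu * exp s\<close>, which is \<open>12 * L\<^sup>2\<close> times the expansion factor;
  hence the growth of \<open>hnorm\<close> up to \<open>tube\<close> forces the product
  bound.\<close>

lemma axis_run:
  assumes nz: "hnorm x \<noteq> 0" and near: "hnorm x \<le> tube"
  obtains m where "m > 0" "hnorm ((Z ^^ m) x) > tube" "(Z ^^ m) x $ 3 \<ge> 0"
    "\<And>j. j < m \<Longrightarrow> hnorm ((Z ^^ j) x) \<le> tube"
    "(Z ^^ m) x $ 3 \<ge> (real m - 1) / 2" "m \<ge> 2 \<Longrightarrow> (Z ^^ m) x $ 3 \<ge> exp ((real m - 2) / 2) / 2"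
    "(\<Prod>j<m. norm ((Z ^^ Suc j) x) / C) \<ge> tube / hnorm x / (12 * L\<^sup>2) ^ m"
proof -
  define s where "s j = (Z ^^ j) x $ 3" for j
  have nZ: "norm ((Z ^^ Suc j) x) = M * exp (s j)" for j by (simp add: norm_Z s_def)
  have s_up: "s (Suc j) \<ge> M / 2 * exp (s j)" if "hnorm ((Z ^^ j) x) \<le> tube" for j
    using near_axis(1) that by (simp add: s_def tube_def)
  have h_up: "hnorm ((Z ^^ Suc j) x) \<ge> nu * exp (s j) / (2 * L) * hnorm ((Z ^^ j) x)"
    if "hnorm ((Z ^^ j) x) \<le> tube" for j
    using near_axis(2) that by (simp add: s_def tube_def)
  have s_lin: "s (Suc j) \<ge> real j / 2" if "\<And>i. i \<le> j \<Longrightarrow> hnorm ((Z ^^ i) x) \<le> tube" for j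
    using that
  proof (induction j)
    case 0
    have "M / 2 * exp (s 0) \<ge> 0" using M_pos by simp
    then show ?case using s_up [of 0] 0 by simp
  next
    case (Suc j)
    then have "s (Suc j) \<ge> real j / 2" by simp
    then show ?case using s_up [of "Suc j"] M_half_exp [of "s (Suc j)"] Suc.prems [of "Suc j"] by simp
  qed
  have "\<exists>m. hnorm ((Z ^^ m) x) > tube"
  proof (rule ccontr)
    assume "\<nexists>m. hnorm ((Z ^^ m) x) > tube"
    then have all: "hnorm ((Z ^^ m) x) \<le> tube" for m by (meson not_le)
    have "eventually (\<lambda>n. nu * exp (real n / 2) / (2 * L) \<ge> 2) sequentially"
      using nu_pos L_pos by real_asymp
    then obtain N where N: "\<And>n. n \<ge> N \<Longrightarrow> nu * exp (real n / 2) / (2 * L) \<ge> 2"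
      by (auto simp: eventually_sequentially)
    have hpos: "hnorm ((Z ^^ j) x) > 0" for j
    proof (induction j)
      case 0
      then show ?case using nz by (simp add: less_le)
    next
      case (Suc j)
      have "0 < nu * exp (s j) / (2 * L) * hnorm ((Z ^^ j) x)" using Suc nu_pos L_pos by simp
      then show ?case using h_up [OF all [of j]] by linarith
    qed
    have "hnorm ((Z ^^ (Suc N + k)) x) \<ge> 2 ^ k * hnorm ((Z ^^ Suc N) x)" for k
    proof (induction k)
      case (Suc k)
      have "2 \<le> nu * exp (real (N + k) / 2) / (2 * L)" using N [of "N + k"] by simp
      also have "\<dots> \<le> nu * exp (s (Suc N + k)) / (2 * L)"
        using s_lin [of "N + k", OF all] nu_pos L_pos by (intro divide_right_mono mult_left_mono) auto
      finally have "2 * hnorm ((Z ^^ (Suc N + k)) x) \<le> nu * exp (s (Suc N + k)) / (2 * L) * hnorm ((Z ^^ (Suc N + k)) x)"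
        using hpos by (intro mult_right_mono) (auto intro: less_imp_le)
      also have "\<dots> \<le> hnorm ((Z ^^ Suc (Suc N + k)) x)" by (rule h_up [OF all])
      finally show ?case using Suc by simp
    qed simp
    moreover obtain k where "2 ^ k > tube / hnorm ((Z ^^ Suc N) x)"
      using real_arch_pow [of 2 "tube / hnorm ((Z ^^ Suc N) x)"] by auto
    then have "2 ^ k * hnorm ((Z ^^ Suc N) x) > tube"
      using hpos [of "Suc N"] by (simp add: field_simps)
    ultimately show False using all by (meson less_le_trans not_le)
  qed
  then obtain m where m: "hnorm ((Z ^^ m) x) > tube" "\<And>j. j < m \<Longrightarrow> hnorm ((Z ^^ j) x) \<le> tube"
    using exists_least_iff [of "\<lambda>m. hnorm ((Z ^^ m) x) > tube"] by (meson not_le)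
  have "m > 0" using m near by (cases m) auto
  then obtain m' where m': "m = Suc m'" using gr0_conv_Suc by blast
  have lin: "s m \<ge> real m' / 2" unfolding m' using m(2) m' by (intro s_lin) auto
  have hle: "hnorm ((Z ^^ Suc j) x) \<le> L * nu * exp (s j) * hnorm ((Z ^^ j) x)" for j
    using hnorm_Z_le by (simp add: s_def)
  have prod: "hnorm ((Z ^^ k) x) \<le> hnorm x * (\<Prod>j<k. L * nu * exp (s j))" for k
  proof (induction k)
    case (Suc k)
    have "hnorm ((Z ^^ Suc k) x) \<le> L * nu * exp (s k) * hnorm ((Z ^^ k) x)" by (rule hle)
    also have "\<dots> \<le> L * nu * exp (s k) * (hnorm x * (\<Prod>j<k. L * nu * exp (s j)))"
      using Suc L_pos nu_pos by (intro mult_left_mono) auto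
    finally show ?case by (simp add: mult_ac)
  qed simp
  have "(\<Prod>j<m. norm ((Z ^^ Suc j) x) / C) = (\<Prod>j<m. L * nu * exp (s j) / (12 * L\<^sup>2))"
    unfolding nZ using L_pos lam_pos
    by (intro prod.cong refl) (simp add: C_def M_def field_simps power2_eq_square)
  also have "\<dots> = (\<Prod>j<m. L * nu * exp (s j)) / (12 * L\<^sup>2) ^ m" by (simp add: prod_dividef)
  also have "\<dots> \<ge> tube / hnorm x / (12 * L\<^sup>2) ^ m"
  proof (rule divide_right_mono)
    have "tube \<le> hnorm x * (\<Prod>j<m. L * nu * exp (s j))" using m(1) prod [of m] by linarith
    moreover have "hnorm x > 0" using nz by (simp add: less_le)
    ultimately show "tube / hnorm x \<le> (\<Prod>j<m. L * nu * exp (s j))" by (simp add: field_simps)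
  qed simp
  finally have P: "(\<Prod>j<m. norm ((Z ^^ Suc j) x) / C) \<ge> tube / hnorm x / (12 * L\<^sup>2) ^ m" .
  \<comment> \<open>One more use of \<open>s_up\<close> on the linear bound makes the exit height
    exponential in \<open>m\<close>, enough to beat the loss
    \<open>(12 * L\<^sup>2) ^ m\<close>.\<close>
  have quick: "s m \<ge> exp ((real m - 2) / 2) / 2" if "m \<ge> 2"
  proof -
    obtain k where "m = 2 + k" using le_Suc_ex \<open>m \<ge> 2\<close> by blast
    then have k: "m = Suc (Suc k)" by simp
    have "s (Suc k) \<ge> real k / 2" using m(2) k by (intro s_lin) auto
    then have "1 / 2 * exp (real k / 2) \<le> M / 2 * exp (s (Suc k))"
      using M_half by (intro mult_mono) auto
    also have "\<dots> \<le> s m" unfolding k by (rule s_up [OF m(2)]) (simp add: k)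
    finally show ?thesis by (simp add: k)
  qed
  show thesis
    using that [of m] m \<open>m > 0\<close> lin quick P m' by (simp add: s_def)
qed

text \<open>\<open>Q ^ m\<close> is the loss of a run of length \<open>m\<close>. Long runs end at a
  height exponential in \<open>m\<close>; short ones are covered by the threshold
  \<open>T0\<close>.\<close>

lemma fast_beats_geometric:
  assumes "\<kappa> > 0" "Q \<ge> 1"
  obtains T0 where "\<And>m s. m \<ge> 1 \<Longrightarrow> s \<ge> T0 \<Longrightarrow> (m \<ge> 2 \<Longrightarrow> s \<ge> exp ((real m - 2) / 2) / 2) \<Longrightarrow> \<kappa> * exp s / Q ^ m \<ge> 2"
proof -
  define D where "D = ln (2 / \<kappa>)"
  have key: "\<kappa> * exp s / Q ^ m \<ge> 2" if "s \<ge> D + real m * ln Q" for m s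
  proof -
    have "2 * Q ^ m = \<kappa> * exp (D + real m * ln Q)"
      using assms by (simp add: D_def exp_add exp_of_nat_mult)
    also have "\<dots> \<le> \<kappa> * exp s" using that assms by simp
    finally show ?thesis using assms by (simp add: field_simps)
  qed
  have "eventually (\<lambda>m::nat. exp ((real m - 2) / 2) / 2 \<ge> D + real m * ln Q) sequentially"
    by real_asymp
  then obtain m0 where m0: "\<And>m. m \<ge> m0 \<Longrightarrow> exp ((real m - 2) / 2) / 2 \<ge> D + real m * ln Q"
    by (auto simp: eventually_sequentially)
  show thesis
  proof (rule that [of "D + real (m0 + 1) * ln Q"])
    fix m s assume *: "(m::nat) \<ge> 1" "s \<ge> D + real (m0 + 1) * ln Q" "m \<ge> 2 \<Longrightarrow> s \<ge> exp ((real m - 2) / 2) / 2"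
    show "\<kappa> * exp s / Q ^ m \<ge> 2"
    proof (cases "m \<le> m0 + 1")
      case True
      then have "real m * ln Q \<le> real (m0 + 1) * ln Q" using assms by (intro mult_right_mono) auto
      then show ?thesis using * by (intro key) linarith
    next
      case False
      then show ?thesis using * m0 [of m] by (intro key) linarith
    qed
  qed
qed

text \<open>An orbit that stays either near the axis or at great height splits into blocks over which
  the product of the expansion factors at least doubles: a single step at large positive height,
  or an excursion that drops close to the origin and then climbs up along the axis.\<close>

lemma product_unbounded:
  "\<exists>T>0. \<forall>x. (\<forall>n. hnorm ((Z ^^ n) x) \<noteq> 0) \<longrightarrow>
      (\<forall>n. hnorm ((Z ^^ n) x) \<le> tube \<or> \<bar>(Z ^^ n) x $ 3\<bar> \<ge> T) \<longrightarrow>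
      \<not> (\<exists>B. \<forall>n. (\<Prod>j<n. norm ((Z ^^ Suc j) x) / C) \<le> B)"
proof -
  \<comment> \<open>The constant left over in an excursion: the entering step has factor
    \<open>M * exp (s n) / C\<close>, the run gains \<open>tube / (M * exp (s n))\<close> up to its
    geometric loss, and the last step has factor \<open>M * exp s / C\<close> with \<open>s\<close>
    the exit height. The term \<open>exp (s n)\<close> cancels.\<close>
  have "tube * M / C\<^sup>2 > 0" using tube_pos M_pos C_pos by simp
  moreover have "12 * L\<^sup>2 \<ge> 1" using one_le_power [OF L1, of 2] by simp
  ultimately obtain T0 where T0: "\<And>m s. m \<ge> 1 \<Longrightarrow> s \<ge> T0 \<Longrightarrow> (m \<ge> 2 \<Longrightarrow> s \<ge> exp ((real m - 2) / 2) / 2) \<Longrightarrow>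
      tube * M / C\<^sup>2 * exp s / (12 * L\<^sup>2) ^ m \<ge> 2"
    using fast_beats_geometric by blast
  \<comment> \<open>From below \<open>- T\<close> the next point is in the tube. From above
    \<open>T\<close> the next height has modulus at least \<open>T\<close> even if the point is in
    the tube, and the single factor is at least 2.\<close>
  have "eventually (\<lambda>T. T > 0 \<and> T \<ge> T0 \<and> M * exp (- T) \<le> tube \<and> M * exp T \<ge> T + tube \<and> M * exp T \<ge> 2 * C) at_top"
  proof (intro eventually_conj)
    show "eventually (\<lambda>T. M * exp (- T) \<le> tube) at_top" using M_pos tube_pos by real_asymp
    show "eventually (\<lambda>T. M * exp T \<ge> T + tube) at_top" using M_pos by real_asymp
    show "eventually (\<lambda>T. M * exp T \<ge> 2 * C) at_top" using M_pos by real_asymp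
  qed (auto simp: eventually_gt_at_top eventually_ge_at_top)
  then obtain T where T: "T > 0" "T \<ge> T0" "M * exp (- T) \<le> tube" "M * exp T \<ge> T + tube" "M * exp T \<ge> 2 * C"
    using eventually_happens by (metis (mono_tags, lifting) trivial_limit_at_top_linorder)
  show ?thesis
  proof (intro exI [of _ T] conjI allI impI)
    show "T > 0" by (rule T(1))
    fix x assume "\<forall>n. hnorm ((Z ^^ n) x) \<noteq> 0"
      and "\<forall>n. hnorm ((Z ^^ n) x) \<le> tube \<or> \<bar>(Z ^^ n) x $ 3\<bar> \<ge> T"
    then have nz: "\<And>n. hnorm ((Z ^^ n) x) \<noteq> 0"
      and thin: "\<And>n. hnorm ((Z ^^ n) x) \<le> tube \<or> \<bar>(Z ^^ n) x $ 3\<bar> \<ge> T" by auto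
    define s where "s n = (Z ^^ n) x $ 3" for n
    define P where "P a m = (\<Prod>j<m. norm ((Z ^^ Suc (a + j)) x) / C)" for a m
    have P_add: "P a (m + k) = P a m * P (a + m) k" for a m k
      unfolding P_def by (induction k) (simp_all add: mult_ac add_ac)
    have P1: "P a 1 = M * exp (s a) / C" for a by (simp add: P_def norm_Z s_def)
    have Ppos: "P a m > 0" for a m unfolding P_def using C_pos Z_nonzero by (intro prod_pos) auto
    have after_high: "\<bar>s (Suc n)\<bar> \<ge> T" if "s n \<ge> T" for n
    proof (cases "hnorm ((Z ^^ Suc n) x) \<le> tube")
      case True
      have "T + tube \<le> M * exp (s n)" using T(4) that M_pos
        by (meson exp_le_cancel_iff mult_le_cancel_left_pos order_trans)
      also have "\<dots> = norm ((Z ^^ Suc n) x)" by (simp add: norm_Z s_def)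
      also have "\<dots> \<le> hnorm ((Z ^^ Suc n) x) + \<bar>s (Suc n)\<bar>" unfolding s_def by (rule norm_le_hnorm)
      finally show ?thesis using True by linarith
    next
      case False
      then show ?thesis using thin [of "Suc n"] by (simp add: s_def)
    qed
    have exit: "\<exists>k>0. s (n + k) \<ge> T \<and> P n k \<ge> tube / hnorm ((Z ^^ n) x) / (12 * L\<^sup>2) ^ k
        \<and> (k \<ge> 2 \<longrightarrow> s (n + k) \<ge> exp ((real k - 2) / 2) / 2)" if near: "hnorm ((Z ^^ n) x) \<le> tube" for n
    proof -
      have f: "(Z ^^ k) ((Z ^^ n) x) = (Z ^^ (n + k)) x" for k by (metis add.commute comp_apply funpow_add)
      obtain k where k: "k > 0" "hnorm ((Z ^^ (n + k)) x) > tube" "s (n + k) \<ge> 0"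
        "k \<ge> 2 \<Longrightarrow> s (n + k) \<ge> exp ((real k - 2) / 2) / 2"
        "P n k \<ge> tube / hnorm ((Z ^^ n) x) / (12 * L\<^sup>2) ^ k"
        by (rule axis_run [OF nz near]) (auto simp: f s_def P_def simp del: funpow.simps)
      then have "s (n + k) \<ge> T" using thin [of "n + k"] by (simp add: s_def)
      then show ?thesis using k by blast
    qed
    have block: "\<exists>k>0. \<bar>s (n + k)\<bar> \<ge> T \<and> P n k \<ge> 2" if start: "\<bar>s n\<bar> \<ge> T" for n
    proof (cases "s n \<ge> T")
      case True
      have "2 * C \<le> M * exp (s n)" using T(5) True M_pos
        by (meson exp_le_cancel_iff mult_le_cancel_left_pos order_trans)
      then have "P n 1 \<ge> 2" unfolding P1 using C_pos by (simp add: field_simps)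
      then show ?thesis using after_high [OF True] by (intro exI [of _ 1]) simp
    next
      case False
      then have low: "s n \<le> - T" using start by linarith
      have nx: "norm ((Z ^^ Suc n) x) = M * exp (s n)" by (simp add: norm_Z s_def)
      have "M * exp (s n) \<le> M * exp (- T)" using low M_pos by simp
      then have "hnorm ((Z ^^ Suc n) x) \<le> tube"
        using hnorm_le_norm [of "(Z ^^ Suc n) x"] nx T(3) by linarith
      from exit [OF this] obtain k where k: "k > 0" "s (Suc n + k) \<ge> T"
        "P (Suc n) k \<ge> tube / hnorm ((Z ^^ Suc n) x) / (12 * L\<^sup>2) ^ k"
        "k \<ge> 2 \<Longrightarrow> s (Suc n + k) \<ge> exp ((real k - 2) / 2) / 2" by blast
      have hpos: "0 < hnorm ((Z ^^ Suc n) x)" using nz [of "Suc n"] by (simp add: less_le)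
      have Mpos: "M * exp (s n) > 0" using M_pos by simp
      have "2 \<le> tube * M / C\<^sup>2 * exp (s (Suc n + k)) / (12 * L\<^sup>2) ^ k"
        using k T by (intro T0) auto
      also have "\<dots> = M * exp (s n) / C * (tube / (M * exp (s n)) / (12 * L\<^sup>2) ^ k) * (M * exp (s (Suc n + k)) / C)"
        using M_pos by (simp add: field_simps power2_eq_square)
      also have "\<dots> \<le> M * exp (s n) / C * P (Suc n) k * (M * exp (s (Suc n + k)) / C)"
      proof (intro mult_right_mono mult_left_mono)
        have "tube / (M * exp (s n)) \<le> tube / hnorm ((Z ^^ Suc n) x)"
          using hnorm_le_norm [of "(Z ^^ Suc n) x"] nx hpos tube_pos by (intro divide_left_mono) auto
        then have "tube / (M * exp (s n)) / (12 * L\<^sup>2) ^ k \<le> tube / hnorm ((Z ^^ Suc n) x) / (12 * L\<^sup>2) ^ k"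
          by (intro divide_right_mono) auto
        then show "tube / (M * exp (s n)) / (12 * L\<^sup>2) ^ k \<le> P (Suc n) k" using k(3) by linarith
      qed (use M_pos C_pos in auto)
      also have "\<dots> = P n (1 + k + 1)"
        unfolding P_add P1 by simp
      finally have "P n (1 + k + 1) \<ge> 2" .
      moreover have "\<bar>s (n + (1 + k + 1))\<bar> \<ge> T"
        using after_high [OF k(2)] by simp
      ultimately show ?thesis by (intro exI [of _ "1 + k + 1"]) simp
    qed
    \<comment> \<open>A start inside the tube is first carried to great height by
      \<open>exit\<close>.\<close>
    obtain n0 where n0: "\<bar>s n0\<bar> \<ge> T"
    proof (cases "hnorm x \<le> tube")
      case True
      then show ?thesis using exit [of 0] that by (metis abs_ge_self funpow_0 order_trans)
    next
      case False
      then show ?thesis using thin [of 0] that [of 0] by (simp add: s_def)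
    qed
    have iter: "\<exists>k. \<bar>s (n0 + k)\<bar> \<ge> T \<and> P n0 k \<ge> 2 ^ N" for N
    proof (induction N)
      case 0
      then show ?case using n0 by (intro exI [of _ 0]) (simp add: P_def)
    next
      case (Suc N)
      then obtain k where k: "\<bar>s (n0 + k)\<bar> \<ge> T" "P n0 k \<ge> 2 ^ N" by blast
      obtain k' where k': "\<bar>s (n0 + k + k')\<bar> \<ge> T" "P (n0 + k) k' \<ge> 2" using block [OF k(1)] by blast
      have "2 ^ N * 2 \<le> P n0 k * P (n0 + k) k'" using k k' Ppos by (intro mult_mono) (auto intro: less_imp_le)
      then show ?case using k' by (intro exI [of _ "k + k'"]) (simp add: P_add add.assoc mult.commute)
    qed
    show "\<not> (\<exists>B. \<forall>n. (\<Prod>j<n. norm ((Z ^^ Suc j) x) / C) \<le> B)"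
    proof
      assume "\<exists>B. \<forall>n. (\<Prod>j<n. norm ((Z ^^ Suc j) x) / C) \<le> B"
      then obtain B where B: "P 0 n \<le> B" for n by (auto simp: P_def)
      obtain N where N: "2 ^ N > B / P 0 n0" using real_arch_pow [of 2 "B / P 0 n0"] by auto
      obtain k where k: "P n0 k \<ge> 2 ^ N" using iter by blast
      have "B < 2 ^ N * P 0 n0" using N Ppos [of 0 n0] by (simp add: field_simps)
      also have "\<dots> \<le> P n0 k * P 0 n0" using k Ppos [of 0 n0] by (intro mult_right_mono) auto
      also have "\<dots> = P 0 (n0 + k)" by (simp add: P_add)
      finally show False using B [of "n0 + k"] by linarith
    qed
  qed
qed

section \<open>Reaching the invariant planes\<close>

definition obeam :: "int \<Rightarrow> int \<Rightarrow> (real^3) set" where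
  "obeam i j = {x. \<bar>x $ 1 - 2 * of_int i * lam\<bar> < lam \<and> \<bar>x $ 2 - 2 * of_int j * lam\<bar> < lam}"

lemma obeam_subset: "obeam i j \<subseteq> beam i j"
  by (auto simp: obeam_def beam_def cell_def)

lemma open_obeam: "open (obeam i j)"
  unfolding obeam_def by (intro open_Collect_conj open_Collect_less continuous_intros)

lemma inj_on_Z_obeam: "inj_on Z (obeam i j)"
proof (rule inj_onI)
  fix x z assume xz: "x \<in> obeam i j" "z \<in> obeam i j" "Z x = Z z"
  have "(nu / L)\<^sup>2 * exp (x $ 3 + z $ 3) * ((hnorm (x - z))\<^sup>2 + (L * lam)\<^sup>2 * (x $ 3 - z $ 3)\<^sup>2) \<le> 0"
    using Z_expand [of x i j z] xz obeam_subset by auto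
  moreover have "(nu / L)\<^sup>2 * exp (x $ 3 + z $ 3) > 0" using nu_pos L_pos by simp
  ultimately have le: "(hnorm (x - z))\<^sup>2 + (L * lam)\<^sup>2 * (x $ 3 - z $ 3)\<^sup>2 \<le> 0"
    by (meson mult_pos_pos not_le)
  moreover have "0 \<le> (hnorm (x - z))\<^sup>2" "0 \<le> (L * lam)\<^sup>2 * (x $ 3 - z $ 3)\<^sup>2" by auto
  ultimately have "(hnorm (x - z))\<^sup>2 = 0" "(L * lam)\<^sup>2 * (x $ 3 - z $ 3)\<^sup>2 = 0" by linarith+
  then show "x = z" using L_pos lam_pos by (intro vec3_eqI) (auto simp: hnorm_eq_0)
qed

text \<open>The symmetric exponential of \<open>Z_expand\<close> is replaced by
  \<open>exp (x $ 3)\<close> at the cost of \<theta>; a drop in height by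
  \<open>- 2 * ln \<theta>\<close> costs exactly that.\<close>

lemma Z_local_expand:
  assumes "0 < \<theta>" "\<theta> < 1"
  obtains \<delta> where "\<delta> > 0" "\<And>z. x \<in> obeam i j \<Longrightarrow> z \<in> obeam i j \<Longrightarrow> \<bar>z $ 3 - x $ 3\<bar> < \<delta> \<Longrightarrow>
    \<theta> * nu * exp (x $ 3) / L * sqrt ((hnorm (z - x))\<^sup>2 + (L * lam)\<^sup>2 * (z $ 3 - x $ 3)\<^sup>2) \<le> norm (Z z - Z x)"
proof (rule that [of "- 2 * ln \<theta>"])
  show "- 2 * ln \<theta> > 0" using assms by simp
  fix z assume x: "x \<in> obeam i j" and z: "z \<in> obeam i j" and d: "\<bar>z $ 3 - x $ 3\<bar> < - 2 * ln \<theta>"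
  let ?N = "(hnorm (z - x))\<^sup>2 + (L * lam)\<^sup>2 * (z $ 3 - x $ 3)\<^sup>2"
  have "\<theta>\<^sup>2 * (exp (x $ 3))\<^sup>2 = exp (2 * ln \<theta> + 2 * x $ 3)"
    using assms by (simp add: exp_add exp_double)
  also have "\<dots> \<le> exp (x $ 3 + z $ 3)" using d by simp
  finally have "(nu / L)\<^sup>2 * (\<theta>\<^sup>2 * (exp (x $ 3))\<^sup>2) * ?N \<le> (nu / L)\<^sup>2 * exp (x $ 3 + z $ 3) * ?N"
    by (intro mult_right_mono mult_left_mono) auto
  also have "\<dots> \<le> (norm (Z z - Z x))\<^sup>2"
    using Z_expand [of z i j x] x z obeam_subset by (auto simp: add.commute)
  finally have "(\<theta> * nu * exp (x $ 3) / L * sqrt ?N)\<^sup>2 \<le> (norm (Z z - Z x))\<^sup>2"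
    by (simp add: power_mult_distrib power_divide mult_ac)
  then show "\<theta> * nu * exp (x $ 3) / L * sqrt ?N \<le> norm (Z z - Z x)"
    by (rule power2_le_imp_le) simp
qed

text \<open>Relative to this measure the volume distortion of \<open>Z\<close> is at least \<open>lam / L ^ 5\<close>: the
  Jacobian is at least \<open>lam * (nu * exp x\<^sub>3) ^ 3 / L\<^sup>2\<close>, and \<open>hnorm\<close> grows at most by the
  factor \<open>L * nu * exp x\<^sub>3\<close>.\<close>

definition axial :: "(real^3) measure" where
  "axial = density lborel (\<lambda>x. ennreal (1 / hnorm x ^ 3))"

lemma sets_axial [simp]: "sets axial = sets borel"
  by (simp add: axial_def)

lemma hnorm_measurable [measurable]: "hnorm \<in> borel_measurable borel"
  unfolding hnorm_def by measurable

lemma axial_density_measurable: "(\<lambda>x. ennreal (1 / hnorm x ^ 3)) \<in> borel_measurable lborel"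
  by measurable

lemma continuous_on_hnorm [continuous_intros]: "continuous_on S f \<Longrightarrow> continuous_on S (\<lambda>x. hnorm (f x))"
  unfolding hnorm_def by (intro continuous_intros)

lemma axial_null: "N \<in> sets borel \<Longrightarrow> negligible N \<Longrightarrow> emeasure axial N = 0"
  using absolutely_continuousI_density [OF axial_density_measurable]
  by (auto simp: axial_def negligible_iff_null_sets null_sets_completion_iff absolutely_continuous_def null_sets_def)

text \<open>Halfway between \<open>L ^ 5 / lam\<close> and 1: still a contraction, with room for the
  loss \<open>\<theta> ^ 3\<close>.\<close>

definition contr3 :: real where "contr3 = (1 + L ^ 5 / lam) / 2"

lemma contr3: "0 < contr3" "contr3 < 1" "L ^ 5 / lam < contr3"
proof -
  have "0 < L ^ 5 / lam" "L ^ 5 / lam < 1" using L_pos lam_pos lamL by auto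
  moreover have "0 < (1 + l) / 2 \<and> (1 + l) / 2 < 1 \<and> l < (1 + l) / 2" if "0 < l" "l < 1" for l :: real
    using that by auto
  ultimately show "0 < contr3" "contr3 < 1" "L ^ 5 / lam < contr3" unfolding contr3_def by blast+
qed

lemma axial_expansion_obeam:
  assumes "open E" "E \<subseteq> obeam i j" "\<And>x. x \<in> E \<Longrightarrow> hnorm x \<noteq> 0" "\<And>x. x \<in> E \<Longrightarrow> hnorm (Z x) \<noteq> 0"
  shows "emeasure axial E \<le> ennreal contr3 * emeasure axial (Z ` E)"
proof -
  \<comment> \<open>Up to \<theta>, the number \<open>b\<close> below is the horizontal factor
    \<open>nu * exp (x $ 3) / L\<close>; the weight \<open>L * lam\<close> turns it into the
    vertical factor \<open>M * exp (x $ 3)\<close>.\<close>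
  define m :: "3 \<Rightarrow> real" where "m i = (if i = 3 then L * lam else 1)" for i
  have "prod m UNIV = m 1 * m 2 * m 3" unfolding UNIV_3 by (simp add: mult.assoc)
  then have prodm: "prod m UNIV = L * lam" by (simp add: m_def)
  have normm: "norm (\<chi> i. m i * v $ i) = sqrt ((hnorm v)\<^sup>2 + (L * lam)\<^sup>2 * (v $ 3)\<^sup>2)" for v :: "real^3"
  proof -
    have "(norm (\<chi> i. m i * v $ i))\<^sup>2 = (hnorm v)\<^sup>2 + (L * lam)\<^sup>2 * (v $ 3)\<^sup>2"
      by (simp add: norm_vec3_sq hnorm_sq m_def power_mult_distrib)
    then show ?thesis by (metis norm_ge_zero real_sqrt_unique)
  qed
  have "L ^ 5 / lam / contr3 < 1" using contr3 by (simp only: divide_less_eq_1_pos)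
  then obtain \<theta> where \<theta>: "0 < \<theta>" "\<theta> < 1" "L ^ 5 / lam / contr3 < \<theta> ^ 3"
    by (rule exists_power_greater)
  have \<theta>': "1 < contr3 * \<theta> ^ 3 * lam / L ^ 5"
    using \<theta>(3) contr3(1) L_pos lam_pos by (simp add: field_simps)
  have cont: "isCont (\<lambda>x. 1 / hnorm x ^ 3) x" if "hnorm x \<noteq> 0" for x :: "real^3"
  proof -
    have "isCont hnorm x" unfolding hnorm_def by (intro continuous_intros)
    then show ?thesis using that by (intro continuous_intros) auto
  qed
  have pos: "1 / hnorm x ^ 3 > 0" if "hnorm x \<noteq> 0" for x using that by (simp add: less_le)
  show ?thesis
    unfolding axial_def
  proof (rule weighted_measure_expansion [where m = m])
    show "m i > 0" for i using L_pos lam_pos by (simp add: m_def)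
    show "(\<lambda>x. 1 / hnorm x ^ 3) \<in> borel_measurable borel" by measurable
    show "inj_on Z E" using inj_on_Z_obeam assms(2) by (rule inj_on_subset)
    show "continuous_on E Z" by (rule continuous_on_Z)
    fix x assume x: "x \<in> E"
    have hx: "hnorm x > 0" "hnorm (Z x) > 0" using assms(3,4) [OF x] by (simp_all add: less_le)
    obtain \<delta> where \<delta>: "\<delta> > 0" "\<And>z. x \<in> obeam i j \<Longrightarrow> z \<in> obeam i j \<Longrightarrow> \<bar>z $ 3 - x $ 3\<bar> < \<delta> \<Longrightarrow>
      \<theta> * nu * exp (x $ 3) / L * sqrt ((hnorm (z - x))\<^sup>2 + (L * lam)\<^sup>2 * (z $ 3 - x $ 3)\<^sup>2) \<le> norm (Z z - Z x)"
      using Z_local_expand [OF \<theta>(1,2)] by blast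
    define b where "b = \<theta> * nu * exp (x $ 3) / L"
    show "\<exists>b>0. \<exists>\<delta>>0. (\<forall>z\<in>E \<inter> ball x \<delta>. b * norm (\<chi> i. m i * (z - x) $ i) \<le> norm (Z z - Z x)) \<and>
        1 / hnorm x ^ 3 < contr3 * (b ^ CARD(3) * prod m UNIV) * (1 / hnorm (Z x) ^ 3)"
    proof (rule exI [of _ b], rule conjI [OF _ exI [of _ \<delta>]], goal_cases)
      case 1
      show ?case using \<theta> nu_pos L_pos by (simp add: b_def)
    next
      case 2
      show ?case
      proof (intro conjI ballI)
        show "\<delta> > 0" by (rule \<delta>)
        fix z assume z: "z \<in> E \<inter> ball x \<delta>"
        have "\<bar>z $ 3 - x $ 3\<bar> \<le> norm (z - x)" using component_le_norm_cart [of "z - x" 3] by simp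
        also have "\<dots> < \<delta>" using z by (simp add: dist_norm norm_minus_commute)
        finally show "b * norm (\<chi> i. m i * (z - x) $ i) \<le> norm (Z z - Z x)"
          unfolding normm b_def using \<delta>(2) [of z] z x assms(2) by auto
      next
        define X where "X = (L * nu * exp (x $ 3) * hnorm x) ^ 3"
        have "hnorm (Z x) ^ 3 \<le> X"
          unfolding X_def using hnorm_Z_le by (intro power_mono) auto
        moreover have "X > 0" using L_pos nu_pos hx by (simp add: X_def)
        then have "X * 1 < X * (contr3 * \<theta> ^ 3 * lam / L ^ 5)"
          using \<theta>' by (intro mult_strict_left_mono)
        moreover have "X * (contr3 * \<theta> ^ 3 * lam / L ^ 5) = contr3 * (b ^ 3 * (L * lam)) * hnorm x ^ 3"
          using L_pos by (simp add: X_def b_def power_mult_distrib power_divide field_simps eval_nat_numeral)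
        ultimately have "hnorm (Z x) ^ 3 < contr3 * (b ^ 3 * (L * lam)) * hnorm x ^ 3" by linarith
        moreover have "1 / p < K * (1 / q)" if "q < K * p" "0 < p" "0 < q" for p q K :: real
          using that by (simp add: field_simps)
        ultimately show "1 / hnorm x ^ 3 < contr3 * (b ^ CARD(3) * prod m UNIV) * (1 / hnorm (Z x) ^ 3)"
          using hx by (simp add: prodm)
      qed
    qed
  qed (use assms contr3 cont pos in auto)
qed

section \<open>Diamond beams and the two half-spaces\<close>

lemma Z_obeam_sign:
  assumes "x \<in> obeam i j" shows "par i * par j * Z x $ 3 > 0"
proof -
  have x: "x \<in> beam i j" using assms obeam_subset by blast
  have "\<not> (\<bar>base i j x $ 1\<bar> = 1 \<or> \<bar>base i j x $ 2\<bar> = 1)"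
    using assms lam_pos by (auto simp: base_def abs_loc obeam_def)
  then have "hh (base i j x) $ 3 > 0"
    using hh_equator_iff [OF base_in_sqQ [OF x]] hh_hemisphere [OF base_in_sqQ [OF x]] by (simp add: less_le)
  then show ?thesis using M_pos by (auto simp: Z_beam [OF x] dir_def par_def)
qed

text \<open>One piece of the grid cut out by \<open>preplanes\<close>. Two opposite edges are centre
  lines of adjacent square beams, and the face between these beams cuts the diamond in half.\<close>

definition diamond :: "int \<Rightarrow> int \<Rightarrow> (real^3) set" where
  "diamond a b = {x. of_int a * (2 * lam) < x $ 1 + x $ 2 \<and> x $ 1 + x $ 2 < (of_int a + 1) * (2 * lam) \<and>
     of_int b * (2 * lam) < x $ 1 - x $ 2 \<and> x $ 1 - x $ 2 < (of_int b + 1) * (2 * lam)}"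

lemma open_diamond: "open (diamond a b)"
  unfolding diamond_def by (intro open_Collect_conj open_Collect_less continuous_intros)

text \<open>The parity of \<open>a + b\<close> tells whether the two beams are neighbours in the
  first or in the second coordinate; neighbours have opposite signs.\<close>

lemma diamond_two_beams:
  obtains i j i' j' k c where "par i * par j = - (par i' * par j')"
    "diamond a b \<subseteq> obeam i j \<union> obeam i' j' \<union> {x. x $ k = c}"
proof (cases "even (a + b)")
  case True
  then obtain p where p: "a + b = 2 * p" by blast
  define q where "q = a - p"
  have ab: "a = p + q" "b = p - q" using p by (auto simp: q_def)
  show thesis
  proof (rule that [of p q "p + 1" q])
    show "par p * par q = - (par (p + 1) * par q)" by (simp add: par_def)
    show "diamond a b \<subseteq> obeam p q \<union> obeam (p + 1) q \<union> {x. x $ 1 = (2 * of_int p + 1) * lam}"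
      using lam_pos by (auto simp: diamond_def obeam_def ab algebra_simps abs_less_iff)
  qed
next
  case False
  then obtain p where p: "a + b = 2 * p + 1" by (blast elim: oddE)
  define q where "q = a - p - 1"
  have ab: "a = p + q + 1" "b = p - q" using p by (auto simp: q_def)
  show thesis
  proof (rule that [of "p + 1" q "p + 1" "q + 1"])
    show "par (p + 1) * par q = - (par (p + 1) * par (q + 1))" by (simp add: par_def)
    show "diamond a b \<subseteq> obeam (p + 1) q \<union> obeam (p + 1) (q + 1) \<union> {x. x $ 2 = (2 * of_int q + 1) * lam}"
      using lam_pos by (auto simp: diamond_def obeam_def ab algebra_simps abs_less_iff)
  qed
qed

lemma diamond_hnorm: "x \<in> diamond a b \<Longrightarrow> hnorm x \<noteq> 0"
proof
  assume x: "x \<in> diamond a b" "hnorm x = 0"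
  then have "of_int a * (2 * lam) < 0" "0 < (of_int a + 1) * (2 * lam)"
    by (auto simp: diamond_def hnorm_eq_0)
  then have "of_int a < (0::real)" "0 < (of_int a + 1 :: real)"
    using lam_pos by (auto simp: mult_less_0_iff zero_less_mult_iff)
  then have "a < 0" "0 < a + 1" by linarith+
  then show False by linarith
qed

text \<open>The two halves have images in opposite open half-spaces. These are disjoint, so their
  measures add and treating two beams at once costs no factor.\<close>

lemma axial_expansion_diamond:
  assumes "open E" "E \<subseteq> diamond a b" "\<And>x. x \<in> E \<Longrightarrow> hnorm (Z x) \<noteq> 0" "open G" "Z ` E \<subseteq> G"
  shows "emeasure axial E \<le> ennreal contr3 * emeasure axial G"
proof -
  obtain i j i' j' k c where ij: "par i * par j = - (par i' * par j')"
    "diamond a b \<subseteq> obeam i j \<union> obeam i' j' \<union> {x. x $ k = c}" using diamond_two_beams .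
  define E1 E2 where "E1 = E \<inter> obeam i j" and "E2 = E \<inter> obeam i' j'"
  have op: "open E1" "open E2" using assms(1) open_obeam by (auto simp: E1_def E2_def)
  have opZ: "open (Z ` E1)" "open (Z ` E2)" using op open_Z_image by auto
  have disj: "Z ` E1 \<inter> Z ` E2 = {}"
  proof -
    have "Z x \<noteq> Z z" if "x \<in> E1" "z \<in> E2" for x z
      using Z_obeam_sign [of x i j] Z_obeam_sign [of z i' j'] that ij(1) by (auto simp: E1_def E2_def)
    then show ?thesis by blast
  qed
  have H: "{x. x $ k = c} \<in> sets borel" by (intro borel_closed closed_Collect_eq continuous_intros)
  have "emeasure axial E \<le> emeasure axial (E1 \<union> E2 \<union> {x. x $ k = c})"
    using assms(2) ij(2) op H by (intro emeasure_mono) (auto simp: E1_def E2_def)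
  also have "\<dots> \<le> emeasure axial (E1 \<union> E2) + emeasure axial {x. x $ k = c}"
    using op H by (intro emeasure_subadditive) auto
  also have "emeasure axial {x. x $ k = c} = 0"
    using H by (intro axial_null negligible_coordinate_hyperplane)
  also have "emeasure axial (E1 \<union> E2) + 0 \<le> emeasure axial E1 + emeasure axial E2"
    using op by (simp add: emeasure_subadditive)
  also have "\<dots> \<le> ennreal contr3 * emeasure axial (Z ` E1) + ennreal contr3 * emeasure axial (Z ` E2)"
    using assms op diamond_hnorm
    by (intro add_mono axial_expansion_obeam [where i = i and j = j] axial_expansion_obeam [where i = i' and j = j'])
       (auto simp: E1_def E2_def)
  also have "\<dots> = ennreal contr3 * emeasure axial (Z ` E1 \<union> Z ` E2)"
    using opZ plus_emeasure [of "Z ` E1" axial "Z ` E2"] disj by (simp add: distrib_left [symmetric])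
  also have "\<dots> \<le> ennreal contr3 * emeasure axial G"
    using assms(4,5) by (intro mult_left_mono emeasure_mono) (auto simp: E1_def E2_def)
  finally show ?thesis .
qed

definition preplanes :: "(real^3) set" where
  "preplanes = {x. \<exists>e k. (e = 1 \<or> e = -1) \<and> x $ 1 + e * x $ 2 = of_int k * (2 * lam)}"

lemma axis_subset_preplanes: "hnorm x = 0 \<Longrightarrow> x \<in> preplanes"
  unfolding preplanes_def hnorm_eq_0
  by (intro CollectI exI [of _ "1::real"] exI [of _ "0::int"]) auto

lemma centres_subset_preplanes: "centres \<subseteq> preplanes"
proof
  fix x assume "x \<in> centres"
  then obtain i j where "x $ 1 = 2 * of_int i * lam" "x $ 2 = 2 * of_int j * lam" by (auto simp: centres_def)
  then show "x \<in> preplanes"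
    unfolding preplanes_def
    by (intro CollectI exI [of _ "1::real"] exI [of _ "i + j"]) (auto simp: algebra_simps)
qed

lemma continuous_on_iter: "continuous_on UNIV (Z ^^ n)"
proof (induction n)
  case (Suc n)
  then show ?case using continuous_on_compose [OF Suc continuous_on_Z] by simp
qed (simp add: id_def)

lemma open_iter_image: "open V \<Longrightarrow> open ((Z ^^ n) ` V)"
proof (induction n)
  case (Suc n)
  then show ?case using open_Z_image [OF Suc.IH [OF Suc.prems]] by (simp add: image_comp)
qed simp

lemma connected_in_diamond:
  assumes "connected S" "S \<inter> preplanes = {}" "S \<noteq> {}"
  obtains a b where "S \<subseteq> diamond a b"
proof -
  have av: "of_int k * (2 * lam) \<noteq> x $ 1 + x $ 2" "of_int k * (2 * lam) \<noteq> x $ 1 - x $ 2" if "x \<in> S" for x k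
  proof -
    have "x \<notin> preplanes" using assms(2) that by blast
    then have *: "\<And>e k. e = 1 \<or> e = -1 \<Longrightarrow> x $ 1 + e * x $ 2 \<noteq> of_int k * (2 * lam)"
      by (auto simp: preplanes_def)
    show "of_int k * (2 * lam) \<noteq> x $ 1 + x $ 2" "of_int k * (2 * lam) \<noteq> x $ 1 - x $ 2"
      using * [of 1 k] * [of "-1" k] by auto
  qed
  have "connected ((\<lambda>x. x $ 1 + x $ 2) ` S)" "connected ((\<lambda>x. x $ 1 - x $ 2) ` S)"
    by (intro connected_continuous_image continuous_intros assms)+
  then have conn: "connected ((\<lambda>x. x $ 1 + x $ 2) ` S)" "connected ((\<lambda>x. x $ 1 - x $ 2) ` S)" by auto
  obtain a :: int where "\<And>t. t \<in> (\<lambda>x. x $ 1 + x $ 2) ` S \<Longrightarrow> of_int a * (2 * lam) < t \<and> t < (of_int a + 1) * (2 * lam)"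
    by (rule connected_avoiding_multiples [OF conn(1), of "2 * lam"]) (use lam_pos av assms(3) in auto)
  moreover obtain b :: int where "\<And>t. t \<in> (\<lambda>x. x $ 1 - x $ 2) ` S \<Longrightarrow> of_int b * (2 * lam) < t \<and> t < (of_int b + 1) * (2 * lam)"
    by (rule connected_avoiding_multiples [OF conn(2), of "2 * lam"]) (use lam_pos av assms(3) in auto)
  ultimately show thesis using that [of a b] by (auto simp: diamond_def)
qed

lemma orbit_meets_preplanes:
  assumes "open V" "V \<noteq> {}"
  shows "\<exists>n. (Z ^^ n) ` V \<inter> preplanes \<noteq> {}"
proof (rule ccontr)
  assume "\<nexists>n. (Z ^^ n) ` V \<inter> preplanes \<noteq> {}"
  then have avoidV: "(Z ^^ n) ` V \<inter> preplanes = {}" for n by blast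
  \<comment> \<open>A ball is taken because connectedness confines each of its images to a single
    diamond.\<close>
  obtain p r where p: "r > 0" "ball p r \<subseteq> V" using assms open_contains_ball by blast
  define B where "B = ball p r"
  have B: "open B" "connected B" "p \<in> B" using p by (auto simp: B_def)
  have avoid: "(Z ^^ n) ` B \<inter> preplanes = {}" for n using avoidV [of n] p by (auto simp: B_def)
  have "\<exists>a b. (Z ^^ n) ` B \<subseteq> diamond a b" for n
  proof -
    have "connected ((Z ^^ n) ` B)"
      using continuous_on_iter B(2) by (intro connected_continuous_image) (auto intro: continuous_on_subset)
    moreover have "(Z ^^ n) ` B \<noteq> {}" using B(3) by blast
    ultimately show ?thesis using connected_in_diamond [OF _ avoid [of n]] by metis
  qed
  then obtain a b where ab: "\<And>n. (Z ^^ n) ` B \<subseteq> diamond (a n) (b n)" by metis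
  \<comment> \<open>The preimage of the axis is removed, so that the weight is positive and
    continuous at the image points.\<close>
  define Tn where "Tn n = diamond (a n) (b n) \<inter> {x. hnorm (Z x) \<noteq> 0}" for n
  have Topen: "open (Tn n)" for n
    unfolding Tn_def by (intro open_Int open_diamond open_Collect_neq continuous_intros continuous_on_Z)
  have Tsub: "(Z ^^ n) ` B \<subseteq> Tn n" for n
  proof
    fix y assume y: "y \<in> (Z ^^ n) ` B"
    then have "Z y \<in> (Z ^^ Suc n) ` B" by auto
    then have "hnorm (Z y) \<noteq> 0" using avoid [of "Suc n"] axis_subset_preplanes by blast
    then show "y \<in> Tn n" using y ab by (auto simp: Tn_def)
  qed
  obtain T where T: "T > 0" "\<And>x. \<forall>n. hnorm ((Z ^^ n) x) \<noteq> 0 \<Longrightarrow>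
      \<forall>n. hnorm ((Z ^^ n) x) \<le> tube \<or> \<bar>(Z ^^ n) x $ 3\<bar> \<ge> T \<Longrightarrow>
      \<not> (\<exists>B. \<forall>n. (\<Prod>j<n. norm ((Z ^^ Suc j) x) / C) \<le> B)"
    using product_unbounded by meson
  \<comment> \<open>Away from the axis and of bounded height: inside one diamond its axial measure
    is at most \<open>W\<close>, whichever diamond it is.\<close>
  define K where "K = {x::real^3. hnorm x > tube \<and> \<bar>x $ 3\<bar> < T}"
  have Kopen: "open K" unfolding K_def
    by (intro open_Collect_conj open_Collect_less continuous_intros)
  define A where "A n = {x \<in> B. (Z ^^ n) x \<in> K \<inter> Tn n}" for n
  define R where "R = 2 * lam + T"
  define W where "W = 1 / tube ^ 3 * (unit_ball_vol 3 * R ^ 3)"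
  have W: "W \<ge> 0" using tube_pos T(1) lam_pos by (simp add: W_def R_def)
  have KT: "emeasure axial (K \<inter> Tn n) \<le> ennreal W" for n
  proof -
    define c :: "real^3" where "c = vector [(of_int (a n) + of_int (b n) + 1) * lam, (of_int (a n) - of_int (b n)) * lam, 0]"
    have "norm (x - c) \<le> R" if "x \<in> K \<inter> Tn n" for x
    proof -
      have "\<bar>(x - c) $ 1\<bar> \<le> lam" "\<bar>(x - c) $ 2\<bar> \<le> lam" "\<bar>(x - c) $ 3\<bar> \<le> T"
        using that by (auto simp: c_def K_def Tn_def diamond_def abs_le_iff algebra_simps)
      then show ?thesis using norm_le_l1_cart [of "x - c"] by (simp add: sum_3 R_def)
    qed
    then have sub: "K \<inter> Tn n \<subseteq> cball c R" by (auto simp: dist_norm norm_minus_commute)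
    have "emeasure axial (K \<inter> Tn n) = (\<integral>\<^sup>+x. ennreal (1 / hnorm x ^ 3) * indicator (K \<inter> Tn n) x \<partial>lborel)"
      unfolding axial_def using Kopen Topen axial_density_measurable by (intro emeasure_density) auto
    also have "\<dots> \<le> (\<integral>\<^sup>+x. ennreal (1 / tube ^ 3) * indicator (cball c R) x \<partial>lborel)"
    proof (rule nn_integral_mono)
      fix x :: "real^3"
      show "ennreal (1 / hnorm x ^ 3) * indicator (K \<inter> Tn n) x \<le> ennreal (1 / tube ^ 3) * indicator (cball c R) x"
      proof (cases "x \<in> K \<inter> Tn n")
        case True
        then have "tube \<le> hnorm x" by (simp add: K_def)
        then have "1 / hnorm x ^ 3 \<le> 1 / tube ^ 3"
          using tube_pos by (intro divide_left_mono power_mono mult_pos_pos zero_less_power) auto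
        then show ?thesis using True sub by (auto intro!: ennreal_leI)
      qed simp
    qed
    also have "\<dots> = ennreal (1 / tube ^ 3) * emeasure lborel (cball c R)"
      by (simp add: nn_integral_cmult_indicator)
    also have "emeasure lborel (cball c R) = ennreal (unit_ball_vol 3 * R ^ 3)"
      using T(1) lam_pos emeasure_cball [of R c] by (simp add: R_def)
    also have "ennreal (1 / tube ^ 3) * \<dots> = ennreal W"
      unfolding W_def using tube_pos T(1) lam_pos
      by (intro ennreal_mult [symmetric]) (auto simp: R_def intro!: mult_nonneg_nonneg)
    finally show ?thesis .
  qed
  have Am: "A n \<in> sets axial" for n
  proof -
    have "A n = B \<inter> (Z ^^ n) -` (K \<inter> Tn n)" by (auto simp: A_def)
    moreover have "open (B \<inter> (Z ^^ n) -` (K \<inter> Tn n))"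
      using B Kopen Topen continuous_on_iter by (intro open_Int open_vimage) auto
    ultimately show ?thesis by simp
  qed
  have Ale: "emeasure axial (A n) \<le> ennreal (W * contr3 ^ n)" for n
  proof -
    have "emeasure axial (A n) \<le> ennreal contr3 ^ n * emeasure axial (K \<inter> Tn n)"
      unfolding A_def
    proof (rule emeasure_iterated_preimage_le [OF _ continuous_on_Z B(1) Topen Tsub])
      show "emeasure axial E \<le> ennreal contr3 * emeasure axial G"
        if "open E" "E \<subseteq> Tn n" "open G" "Z ` E \<subseteq> G" for n E G
        using that by (intro axial_expansion_diamond [of E "a n" "b n"]) (auto simp: Tn_def)
    qed (use Kopen Topen in auto)
    also have "\<dots> \<le> ennreal contr3 ^ n * ennreal W" by (intro mult_left_mono KT) simp
    also have "\<dots> = ennreal (W * contr3 ^ n)"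
      using contr3 W by (simp add: ennreal_power ennreal_mult mult.commute)
    finally show ?thesis .
  qed
  have Bpos: "emeasure axial B > 0"
  proof -
    define Q where "Q = hnorm p + r"
    have Q: "Q > 0" using p by (simp add: Q_def add_nonneg_pos)
    have "ennreal (1 / Q ^ 3) * emeasure lborel B = (\<integral>\<^sup>+x. ennreal (1 / Q ^ 3) * indicator B x \<partial>lborel)"
      using B by (simp add: nn_integral_cmult_indicator)
    also have "\<dots> \<le> (\<integral>\<^sup>+x. ennreal (1 / hnorm x ^ 3) * indicator B x \<partial>lborel)"
    proof (rule nn_integral_mono)
      fix x :: "real^3"
      show "ennreal (1 / Q ^ 3) * indicator B x \<le> ennreal (1 / hnorm x ^ 3) * indicator B x"
      proof (cases "x \<in> B")
        case True
        have "hnorm x \<noteq> 0" using avoid [of 0] axis_subset_preplanes True by auto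
        then have "0 < hnorm x" by (simp add: less_le)
        moreover have "hnorm x \<le> hnorm p + hnorm (x - p)" using hnorm_triangle [of p "x - p"] by simp
        then have "hnorm x \<le> Q" using True hnorm_le_norm [of "x - p"]
          by (simp add: Q_def B_def dist_norm norm_minus_commute)
        ultimately have "1 / Q ^ 3 \<le> 1 / hnorm x ^ 3"
          using Q by (intro divide_left_mono power_mono mult_pos_pos zero_less_power) auto
        then show ?thesis using True by (auto intro!: ennreal_leI)
      qed simp
    qed
    also have "\<dots> = emeasure axial B"
      unfolding axial_def using B axial_density_measurable by (intro emeasure_density [symmetric]) auto
    finally have "ennreal (1 / Q ^ 3) * emeasure lborel B \<le> emeasure axial B" .
    moreover have "emeasure lborel B > 0"
      using p by (simp add: B_def emeasure_ball)
    then have "ennreal (1 / Q ^ 3) * emeasure lborel B > 0"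
      using Q by (simp add: ennreal_zero_less_mult_iff)
    ultimately show ?thesis by (rule less_le_trans [rotated])
  qed
  obtain x N where x: "x \<in> B" "\<And>n. n \<ge> N \<Longrightarrow> x \<notin> A n"
  proof (rule exists_finitely_many_visits [OF _ Bpos Am Ale])
    show "B \<in> sets axial" using B(1) by simp
  qed (use contr3 W in auto)
  \<comment> \<open>Starting at time \<open>N\<close> turns "outside \<open>K\<close> from some time
    on" into "outside \<open>K\<close> always".\<close>
  define x' where "x' = (Z ^^ N) x"
  have f: "(Z ^^ n) x' = (Z ^^ (n + N)) x" for n by (simp add: x'_def funpow_add)
  have inB: "(Z ^^ n) x \<in> (Z ^^ n) ` B" for n using x by blast
  have nz: "hnorm ((Z ^^ n) x') \<noteq> 0" for n
    using avoid [of "n + N"] inB [of "n + N"] axis_subset_preplanes by (auto simp: f)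
  have thin: "hnorm ((Z ^^ n) x') \<le> tube \<or> \<bar>(Z ^^ n) x' $ 3\<bar> \<ge> T" for n
  proof -
    have "(Z ^^ (n + N)) x \<notin> K" using x(2) [of "n + N"] x(1) Tsub [of "n + N"] by (auto simp: A_def)
    then show ?thesis by (auto simp: f K_def)
  qed
  have "\<exists>B. \<forall>n. (\<Prod>j<n. norm ((Z ^^ Suc j) x') / C) \<le> B"
  proof (rule product_bounded_if_avoids_centres)
    show "open ((Z ^^ N) ` B)" using open_iter_image B by blast
    show "x' \<in> (Z ^^ N) ` B" using x by (simp add: x'_def)
    show "(Z ^^ n) ` (Z ^^ N) ` B \<inter> centres = {}" for n
      using avoid [of "n + N"] centres_subset_preplanes by (auto simp: image_comp funpow_add)
  qed
  moreover have "\<not> (\<exists>B. \<forall>n. (\<Prod>j<n. norm ((Z ^^ Suc j) x') / C) \<le> B)"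
    using nz thin by (intro T(2)) auto
  ultimately show False by simp
qed

section \<open>From the invariant planes to the axis\<close>

text \<open>Isometric coordinates on the vertical planes \<open>x\<^sub>2 = e * x\<^sub>1\<close> with \<open>e\<close> equal to 1 or -1,
  which \<open>Z\<close> leaves invariant.\<close>

definition emb :: "real \<Rightarrow> real^2 \<Rightarrow> real^3" where
  "emb e p = vector [p $ 1 / sqrt 2, e * p $ 1 / sqrt 2, p $ 2]"

definition proj :: "real^3 \<Rightarrow> real^2" where
  "proj x = vector [sqrt 2 * x $ 1, x $ 3]"

definition planar :: "real \<Rightarrow> real^2 \<Rightarrow> real^2" where
  "planar e p = proj (Z (emb e p))"

lemma emb_nth [simp]: "emb e p $ 1 = p $ 1 / sqrt 2" "emb e p $ 2 = e * p $ 1 / sqrt 2" "emb e p $ 3 = p $ 2"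
  by (simp_all add: emb_def)

lemma emb_proj: "x $ 2 = e * x $ 1 \<Longrightarrow> emb e (proj x) = x"
  by (rule vec3_eqI) (auto simp: proj_def)

lemma emb_planar:
  assumes "e = 1 \<or> e = -1" shows "emb e (planar e p) = Z (emb e p)"
  unfolding planar_def using Z_plane(1) [OF assms, of "emb e p"] by (intro emb_proj) simp

lemma planar_nonneg: "e = 1 \<or> e = -1 \<Longrightarrow> planar e p $ 2 \<ge> 0"
  using Z_plane(2) [of e "emb e p"] by (simp add: planar_def proj_def)

lemma emb_iter:
  assumes "e = 1 \<or> e = -1" shows "emb e ((planar e ^^ n) p) = (Z ^^ n) (emb e p)"
  by (induction n) (simp_all add: emb_planar [OF assms])

lemma hnorm_emb_diff:
  assumes "e = 1 \<or> e = -1"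
  shows "(hnorm (emb e p - emb e q))\<^sup>2 = (p $ 1 - q $ 1)\<^sup>2"
proof -
  have "(emb e p - emb e q) $ 1 = (p $ 1 - q $ 1) / sqrt 2"
    "(emb e p - emb e q) $ 2 = e * ((p $ 1 - q $ 1) / sqrt 2)"
    by (simp_all add: diff_divide_distrib right_diff_distrib)
  moreover have "e\<^sup>2 = 1" using assms by auto
  ultimately show ?thesis unfolding hnorm_sq by (simp add: power_mult_distrib power_divide)
qed

lemma norm_emb_diff:
  assumes "e = 1 \<or> e = -1" shows "norm (emb e p - emb e q) = norm (p - q)"
proof -
  have "(norm (emb e p - emb e q))\<^sup>2 = (norm (p - q))\<^sup>2"
    unfolding norm_sq_hnorm hnorm_emb_diff [OF assms] norm_vec2_sq by simp
  then show ?thesis by (simp add: power2_eq_iff_nonneg)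
qed

lemma continuous_on_emb:
  assumes "e = 1 \<or> e = -1" shows "continuous_on S (emb e)"
  unfolding continuous_on_iff dist_norm norm_emb_diff [OF assms] by blast

lemma continuous_on_proj: "continuous_on S proj"
proof -
  have eq: "proj = (\<lambda>x. \<chi> i. if i = 1 then sqrt 2 * x $ 1 else x $ 3)"
    by (simp add: fun_eq_iff proj_def vec_eq_iff forall_2)
  have c: "continuous_on S (\<lambda>x::real^3. if i = 1 then sqrt 2 * x $ 1 else x $ 3)" for i :: 2
    by (cases "i = 1") (auto intro!: continuous_intros)
  show ?thesis unfolding eq by (intro continuous_on_vec_lambda c)
qed

lemma continuous_on_planar:
  assumes "e = 1 \<or> e = -1" shows "continuous_on S (planar e)"
proof -
  have "continuous_on S (proj \<circ> (Z \<circ> emb e))"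
    by (intro continuous_on_compose continuous_on_emb [OF assms] continuous_on_Z continuous_on_proj)
  then show ?thesis by (simp add: planar_def [abs_def] comp_def)
qed

text \<open>Halfway between \<open>L / (lam * nu\<^sup>2)\<close> and 1/2: below 1/2 to pay for two
  sheets, with room for the loss \<open>\<theta> ^ 4\<close>.\<close>

definition contr2 :: real where "contr2 = (1 / 2 + L / (lam * nu\<^sup>2)) / 2"

lemma contr2: "0 < contr2" "contr2 < 1 / 2" "1 / (contr2 * (lam * nu\<^sup>2 / L)) < 1"
proof -
  have pos: "lam * nu\<^sup>2 > 0" using lam_pos nu_pos by simp
  define l where "l = L / (lam * nu\<^sup>2)"
  have l: "0 < l" "l < 1 / 2" using pos L_pos lam_nu_sq by (simp_all add: l_def field_simps)
  have c: "contr2 = (1 / 2 + l) / 2" by (simp add: contr2_def l_def)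
  show "0 < contr2" "contr2 < 1 / 2" using l by (simp_all add: c)
  have "contr2 * (lam * nu\<^sup>2 / L) = contr2 / l" using pos by (simp add: l_def)
  moreover have "contr2 / l > 1" using l by (simp add: c field_simps)
  moreover have "1 / t < 1" if "1 < t" for t :: real using that by simp
  ultimately show "1 / (contr2 * (lam * nu\<^sup>2 / L)) < 1" by metis
qed

text \<open>Above height \<open>ln \<theta>\<close> the linear factor is at least
  \<open>\<theta>\<^sup>2 * nu / L\<close>, one \<theta> coming from the local bound and one from
  \<open>exp (p $ 2)\<close>; squaring gives \<open>\<theta> ^ 4\<close>. The lower bound on the
  height is what allows plain area in place of a weight.\<close>

lemma planar_expansion_obeam:
  assumes e: "e = 1 \<or> e = -1" and "open E" and E: "\<And>p. p \<in> E \<Longrightarrow> emb e p \<in> obeam i j"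
    and \<theta>: "0 < \<theta>" "\<theta> < 1" "1 / (contr2 * (lam * nu\<^sup>2 / L)) < \<theta> ^ 4"
    and low: "\<And>p. p \<in> E \<Longrightarrow> p $ 2 > ln \<theta>"
  shows "emeasure lborel E \<le> ennreal contr2 * emeasure lborel (planar e ` E)" and "open (planar e ` E)"
proof -
  define m :: "2 \<Rightarrow> real" where "m i = (if i = 1 then 1 else L * lam)" for i
  have "prod m UNIV = m 1 * m 2" unfolding UNIV_2 by simp
  then have prodm: "prod m UNIV = L * lam" by (simp add: m_def)
  have normm: "norm (\<chi> i. m i * (q - p) $ i) = sqrt ((hnorm (emb e q - emb e p))\<^sup>2 + (L * lam)\<^sup>2 * (emb e q $ 3 - emb e p $ 3)\<^sup>2)" for p q
  proof -
    have "(norm (\<chi> i. m i * (q - p) $ i))\<^sup>2 = (hnorm (emb e q - emb e p))\<^sup>2 + (L * lam)\<^sup>2 * (emb e q $ 3 - emb e p $ 3)\<^sup>2"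
      unfolding hnorm_emb_diff [OF e] norm_vec2_sq by (simp add: m_def power_mult_distrib)
    then show ?thesis by (metis norm_ge_zero real_sqrt_unique)
  qed
  have nplanar: "norm (planar e q - planar e p) = norm (Z (emb e q) - Z (emb e p))" for p q
    using norm_emb_diff [OF e, of "planar e q" "planar e p"] by (simp add: emb_planar [OF e])
  have inj: "inj_on (planar e) E"
  proof (rule inj_onI)
    fix p q assume pq: "p \<in> E" "q \<in> E" "planar e p = planar e q"
    then have "Z (emb e p) = Z (emb e q)" using emb_planar [OF e] by metis
    then have "emb e p = emb e q" using inj_on_Z_obeam E pq by (meson inj_onD)
    then have "norm (p - q) = 0" using norm_emb_diff [OF e, of p q] by simp
    then show "p = q" by simp
  qed
  show "open (planar e ` E)"
    using continuous_on_planar [OF e] assms(2) inj by (rule invariance_of_domain)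
  have one: "1 < contr2 * (\<theta> ^ 4 * (lam * nu\<^sup>2 / L))"
  proof -
    have "0 < contr2 * (lam * nu\<^sup>2 / L)" using contr2(1) lam_pos nu_pos L_pos by simp
    moreover have "1 < t * K" if "1 / K < t" "0 < K" for t K :: real
      using that by (simp add: pos_divide_less_eq)
    ultimately have "1 < \<theta> ^ 4 * (contr2 * (lam * nu\<^sup>2 / L))" using \<theta>(3) by blast
    then show ?thesis by (simp only: mult_ac)
  qed
  have "emeasure (density lborel (\<lambda>_. ennreal 1)) E \<le> ennreal contr2 * emeasure (density lborel (\<lambda>_. ennreal 1)) (planar e ` E)"
  proof (rule weighted_measure_expansion [where m = m])
    show "m i > 0" for i using L_pos lam_pos by (simp add: m_def)
    show "inj_on (planar e) E" by (rule inj)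
    show "continuous_on E (planar e)" by (rule continuous_on_planar [OF e])
    fix p assume p: "p \<in> E"
    obtain \<delta> where \<delta>: "\<delta> > 0" "\<And>z. emb e p \<in> obeam i j \<Longrightarrow> z \<in> obeam i j \<Longrightarrow> \<bar>z $ 3 - emb e p $ 3\<bar> < \<delta> \<Longrightarrow>
      \<theta> * nu * exp (emb e p $ 3) / L * sqrt ((hnorm (z - emb e p))\<^sup>2 + (L * lam)\<^sup>2 * (z $ 3 - emb e p $ 3)\<^sup>2) \<le> norm (Z z - Z (emb e p))"
      using Z_local_expand [OF \<theta>(1,2)] by blast
    define b where "b = \<theta> * nu * exp (emb e p $ 3) / L"
    show "\<exists>b>0. \<exists>\<delta>>0. (\<forall>q\<in>E \<inter> ball p \<delta>. b * norm (\<chi> i. m i * (q - p) $ i) \<le> norm (planar e q - planar e p)) \<and>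
        1 < contr2 * (b ^ CARD(2) * prod m UNIV) * 1"
    proof (rule exI [of _ b], rule conjI [OF _ exI [of _ \<delta>]], goal_cases)
      case 1
      show ?case using \<theta> nu_pos L_pos by (simp add: b_def)
    next
      case 2
      show ?case
      proof (intro conjI ballI)
        show "\<delta> > 0" by (rule \<delta>)
        fix q assume q: "q \<in> E \<inter> ball p \<delta>"
        have "\<bar>emb e q $ 3 - emb e p $ 3\<bar> \<le> norm (q - p)" using component_le_norm_cart [of "q - p" 2] by simp
        also have "\<dots> < \<delta>" using q by (simp add: dist_norm norm_minus_commute)
        finally show "b * norm (\<chi> i. m i * (q - p) $ i) \<le> norm (planar e q - planar e p)"
          unfolding normm b_def nplanar using \<delta>(2) [of "emb e q"] q p E by auto
      next
        have "exp (ln \<theta>) \<le> exp (p $ 2)" using low [OF p] by simp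
        then have "\<theta> \<le> exp (p $ 2)" using \<theta> by simp
        then have "\<theta> * nu * \<theta> / L \<le> b"
          unfolding b_def emb_nth using \<theta> nu_pos L_pos by (intro divide_right_mono mult_left_mono) auto
        then have "(\<theta> * nu * \<theta> / L)\<^sup>2 \<le> b\<^sup>2" using \<theta> nu_pos L_pos by (intro power_mono) auto
        then have "contr2 * ((\<theta> * nu * \<theta> / L)\<^sup>2 * (L * lam)) \<le> contr2 * (b\<^sup>2 * (L * lam))"
          using contr2(1) L_pos lam_pos by (intro mult_left_mono mult_right_mono) auto
        moreover have "contr2 * ((\<theta> * nu * \<theta> / L)\<^sup>2 * (L * lam)) = contr2 * (\<theta> ^ 4 * (lam * nu\<^sup>2 / L))"
          using L_pos by (simp add: field_simps power2_eq_square power4_eq_xxxx)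
        ultimately show "1 < contr2 * (b ^ CARD(2) * prod m UNIV) * 1"
          using one by (simp add: prodm)
      qed
    qed
  qed (use assms contr2 in auto)
  then show "emeasure lborel E \<le> ennreal contr2 * emeasure lborel (planar e ` E)"
    by (simp add: density_1)
qed

text \<open>Lies between consecutive centre lines of the plane. For \<open>\<theta> < 1\<close> the
  bound \<open>ln \<theta>\<close> is negative, so the set can be open although image points may
  have height 0.\<close>

definition strip :: "real \<Rightarrow> int \<Rightarrow> (real^2) set" where
  "strip \<theta> a = {p. of_int a * (2 * lam) < p $ 1 / sqrt 2 \<and> p $ 1 / sqrt 2 < (of_int a + 1) * (2 * lam) \<and> p $ 2 > ln \<theta>}"

lemma open_strip: "open (strip \<theta> a)"
  unfolding strip_def by (intro open_Collect_conj open_Collect_less continuous_intros) auto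

text \<open>A strip folds onto a half-plane two-to-one, which costs a factor two in area; the
  hypothesis \<open>nu > sqrt (2 * L / lam)\<close> makes up for it.\<close>

lemma planar_expansion_strip:
  assumes e: "e = 1 \<or> e = -1" and "open E" and E: "E \<subseteq> strip \<theta> a"
    and \<theta>: "0 < \<theta>" "\<theta> < 1" "1 / (contr2 * (lam * nu\<^sup>2 / L)) < \<theta> ^ 4"
    and G: "open G" "planar e ` E \<subseteq> G"
  shows "emeasure lborel E \<le> ennreal (2 * contr2) * emeasure lborel G"
proof -
  \<comment> \<open>Here the strip crosses the common edge of two diagonally adjacent square
    beams.\<close>
  define c where "c = sqrt 2 * ((2 * of_int a + 1) * lam)"
  define E1 E2 where "E1 = E \<inter> {p. p $ 1 < c}" and "E2 = E \<inter> {p. p $ 1 > c}"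
  define s :: "int \<Rightarrow> int" where "s k = (if e = 1 then k else - k)" for k
  have op: "open E1" "open E2"
    unfolding E1_def E2_def using assms(2) by (intro open_Int open_Collect_less continuous_intros; simp)+
  have se: "2 * of_int (s k) * lam = e * (2 * of_int k * lam)" for k using e by (auto simp: s_def)
  have in_obeam: "x \<in> obeam k (s k)" if "x $ 2 = e * x $ 1" "\<bar>x $ 1 - 2 * of_int k * lam\<bar> < lam" for x k
  proof -
    have "x $ 2 - 2 * of_int (s k) * lam = e * (x $ 1 - 2 * of_int k * lam)"
      unfolding se that(1) by (simp add: right_diff_distrib)
    then have "\<bar>x $ 2 - 2 * of_int (s k) * lam\<bar> = \<bar>x $ 1 - 2 * of_int k * lam\<bar>"
      using e by (auto simp: abs_mult)
    then show ?thesis using that(2) by (simp add: obeam_def)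
  qed
  have lt: "p $ 1 < c \<longleftrightarrow> p $ 1 / sqrt 2 < (2 * of_int a + 1) * lam"
    and gt: "p $ 1 > c \<longleftrightarrow> p $ 1 / sqrt 2 > (2 * of_int a + 1) * lam" for p :: "real^2"
    by (simp_all add: c_def pos_divide_less_eq pos_less_divide_eq mult.commute)
  have o1: "emb e p \<in> obeam a (s a)" if "p \<in> E1" for p
    using that E lam_pos
    by (intro in_obeam) (auto simp: E1_def lt strip_def algebra_simps abs_less_iff)
  have o2: "emb e p \<in> obeam (a + 1) (s (a + 1))" if "p \<in> E2" for p
    using that E lam_pos
    by (intro in_obeam) (auto simp: E2_def gt strip_def algebra_simps abs_less_iff)
  have l1: "p $ 2 > ln \<theta>" if "p \<in> E1" for p using that E by (auto simp: E1_def strip_def)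
  have l2: "p $ 2 > ln \<theta>" if "p \<in> E2" for p using that E by (auto simp: E2_def strip_def)
  note x1 = planar_expansion_obeam [OF e op(1) o1 \<theta> l1]
  note x2 = planar_expansion_obeam [OF e op(2) o2 \<theta> l2]
  have H: "{p::real^2. p $ 1 = c} \<in> sets borel" by (intro borel_closed closed_Collect_eq continuous_intros)
  have "emeasure lebesgue {p::real^2. p $ 1 = c} = 0"
    using negligible_coordinate_hyperplane [of "1::2" c] by (simp add: negligible_iff_emeasure0)
  then have H0: "emeasure lborel {p::real^2. p $ 1 = c} = 0" using H by simp
  have "emeasure lborel E \<le> emeasure lborel (E1 \<union> E2 \<union> {p. p $ 1 = c})"
    using op H by (intro emeasure_mono) (auto simp: E1_def E2_def)
  also have "\<dots> \<le> emeasure lborel (E1 \<union> E2) + emeasure lborel {p::real^2. p $ 1 = c}"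
    using op H by (intro emeasure_subadditive) auto
  also have "\<dots> \<le> emeasure lborel E1 + emeasure lborel E2"
    using op by (simp add: H0 emeasure_subadditive)
  also have "\<dots> \<le> ennreal contr2 * emeasure lborel G + ennreal contr2 * emeasure lborel G"
  proof (intro add_mono)
    have "emeasure lborel (planar e ` E1) \<le> emeasure lborel G" "emeasure lborel (planar e ` E2) \<le> emeasure lborel G"
      using G by (auto simp: E1_def E2_def intro!: emeasure_mono)
    then show "emeasure lborel E1 \<le> ennreal contr2 * emeasure lborel G"
      "emeasure lborel E2 \<le> ennreal contr2 * emeasure lborel G"
      using x1(1) x2(1) by (meson mult_left_mono order_trans zero_le)+
  qed
  also have "\<dots> = ennreal (2 * contr2) * emeasure lborel G"
    using contr2(1) ennreal_plus [of contr2 contr2] by (simp only: mult_2 distrib_right less_imp_le)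
  finally show ?thesis .
qed

text \<open>Heights are nonnegative after the first step, so an orbit that leaves the low parts of
  the strips for good stays above \<open>T\<close>, where every single factor is at least 2. This
  contradicts \<open>product_bounded_if_avoids_centres\<close> directly, without any
  excursions.\<close>

lemma orbit_meets_axis:
  assumes "open V" "x \<in> V" and e: "e = 1 \<or> e = -1" and x: "x $ 2 = e * x $ 1"
  shows "\<exists>n y. y \<in> (Z ^^ n) ` V \<and> hnorm y = 0"
proof (rule ccontr)
  assume "\<nexists>n y. y \<in> (Z ^^ n) ` V \<and> hnorm y = 0"
  then have noaxis: "hnorm y \<noteq> 0" if "y \<in> (Z ^^ n) ` V" for n y using that by blast
  have avoid: "(Z ^^ n) ` V \<inter> centres = {}" for n
  proof -
    have "y \<notin> centres" if "y \<in> (Z ^^ n) ` V" for y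
    proof
      assume "y \<in> centres"
      then have "hnorm (Z y) = 0" using Z_centre by (auto simp: centres_def)
      moreover have "Z y \<in> (Z ^^ Suc n) ` V" using that by auto
      ultimately show False using noaxis by blast
    qed
    then show ?thesis by blast
  qed
  obtain \<theta> where \<theta>: "0 < \<theta>" "\<theta> < 1" "1 / (contr2 * (lam * nu\<^sup>2 / L)) < \<theta> ^ 4"
    by (rule exists_power_greater [OF contr2(3)])
  have ln\<theta>: "ln \<theta> < 0" using \<theta> by simp
  define U where "U = emb e -` (Z ` V)"
  have Uopen: "open U"
    unfolding U_def using open_Z_image [OF assms(1)] continuous_on_emb [OF e] by (rule open_vimage)
  \<comment> \<open>Starting from \<open>Z x\<close> instead of \<open>x\<close> gives a nonnegative
    initial height.\<close>
  have p0: "emb e (proj (Z x)) = Z x" "proj (Z x) $ 2 \<ge> 0"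
    using Z_plane [OF e x] by (simp_all add: emb_proj) (simp add: proj_def)
  then have "proj (Z x) \<in> U \<inter> {p. p $ 2 > ln \<theta>}" using assms(2) ln\<theta> by (simp add: U_def)
  moreover have "open (U \<inter> {p. p $ 2 > ln \<theta>})"
    by (intro open_Int Uopen open_Collect_less continuous_intros)
  ultimately obtain r where r: "r > 0" "ball (proj (Z x)) r \<subseteq> U \<inter> {p. p $ 2 > ln \<theta>}"
    using open_contains_ball by blast
  define D where "D = ball (proj (Z x)) r"
  have D: "open D" "connected D" "D \<noteq> {}" using r by (auto simp: D_def)
  have iter: "(Z ^^ n) (emb e p) \<in> (Z ^^ Suc n) ` V" if "p \<in> D" for p n
  proof -
    have "emb e p \<in> Z ` V" using that r by (auto simp: D_def U_def)
    then show ?thesis by (auto simp: funpow_swap1)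
  qed
  have high: "(planar e ^^ n) p $ 2 > ln \<theta>" if "p \<in> D" for p n
  proof (cases n)
    case 0
    then show ?thesis using that r by (auto simp: D_def)
  next
    case (Suc k)
    then show ?thesis using planar_nonneg [OF e, of "(planar e ^^ k) p"] ln\<theta> by simp
  qed
  have cont: "continuous_on UNIV (planar e ^^ n)" for n
  proof (induction n)
    case (Suc n)
    then show ?case using continuous_on_compose [OF Suc continuous_on_planar [OF e]] by simp
  qed (simp add: id_def)
  have "\<exists>a. (planar e ^^ n) ` D \<subseteq> strip \<theta> a" for n
  proof -
    define S where "S = (\<lambda>p. p $ 1 / sqrt 2) ` (planar e ^^ n) ` D"
    have "connected S" unfolding S_def
      by (intro connected_continuous_image continuous_intros continuous_on_subset [OF cont] D) auto
    moreover have "of_int k * (2 * lam) \<notin> S" for k :: int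
    proof
      assume "of_int k * (2 * lam) \<in> S"
      then obtain p where p: "p \<in> D" "(planar e ^^ n) p $ 1 / sqrt 2 = of_int k * (2 * lam)"
        by (auto simp: S_def)
      have "emb e ((planar e ^^ n) p) $ 1 = 2 * of_int k * lam" using p(2) by simp
      moreover have "emb e ((planar e ^^ n) p) $ 2 = e * (emb e ((planar e ^^ n) p) $ 1)" by simp
      then have "emb e ((planar e ^^ n) p) $ 2 = 2 * of_int (if e = 1 then k else - k) * lam"
        using calculation e by auto
      ultimately have "emb e ((planar e ^^ n) p) \<in> centres" unfolding centres_def by blast
      then show False using iter [OF p(1), of n] avoid [of "Suc n"] by (auto simp: emb_iter [OF e])
    qed
    moreover have "S \<noteq> {}" using D by (simp add: S_def)
    ultimately obtain a :: int where "\<And>t. t \<in> S \<Longrightarrow> of_int a * (2 * lam) < t \<and> t < (of_int a + 1) * (2 * lam)"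
      using connected_avoiding_multiples [of S "2 * lam"] lam_pos by (metis mult_pos_pos zero_less_numeral)
    then show ?thesis using high by (intro exI [of _ a]) (auto simp: strip_def S_def)
  qed
  then obtain a where a: "\<And>n. (planar e ^^ n) ` D \<subseteq> strip \<theta> (a n)" by metis
  obtain T where T: "T > 0" "M * exp T \<ge> 2 * C"
  proof -
    have "eventually (\<lambda>T. M * exp T \<ge> 2 * C) at_top" using M_pos by real_asymp
    then have "eventually (\<lambda>T. M * exp T \<ge> 2 * C \<and> T > 0) at_top"
      by (intro eventually_conj eventually_gt_at_top)
    then show ?thesis using that by (metis (mono_tags, lifting) eventually_happens trivial_limit_at_top_linorder)
  qed
  define K where "K n = strip \<theta> (a n) \<inter> {p. p $ 2 < T}" for n
  have Kopen: "open (K n)" for n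
    unfolding K_def by (intro open_Int open_strip open_Collect_less continuous_intros)
  define A where "A n = {p \<in> D. (planar e ^^ n) p \<in> K n}" for n
  define R where "R = sqrt 2 * lam + (T - ln \<theta>)"
  have R: "R > 0" using lam_pos T ln\<theta> by (simp add: R_def add_pos_pos)
  define W where "W = unit_ball_vol 2 * R ^ 2"
  have W: "W \<ge> 0" using R by (simp add: W_def)
  have KW: "emeasure lborel (K n) \<le> ennreal W" for n
  proof -
    define c :: "real^2" where "c = vector [sqrt 2 * ((2 * of_int (a n) + 1) * lam), 0]"
    have "norm (p - c) \<le> R" if "p \<in> K n" for p
    proof -
      have "\<bar>p $ 1 / sqrt 2 - (2 * of_int (a n) + 1) * lam\<bar> \<le> lam"
        using that by (auto simp: K_def strip_def abs_le_iff algebra_simps)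
      then have "sqrt 2 * \<bar>p $ 1 / sqrt 2 - (2 * of_int (a n) + 1) * lam\<bar> \<le> sqrt 2 * lam"
        by (intro mult_left_mono) auto
      moreover have "\<bar>(p - c) $ 1\<bar> = sqrt 2 * \<bar>p $ 1 / sqrt 2 - (2 * of_int (a n) + 1) * lam\<bar>"
      proof -
        have "(p - c) $ 1 = sqrt 2 * (p $ 1 / sqrt 2 - (2 * of_int (a n) + 1) * lam)"
          by (simp add: c_def right_diff_distrib)
        then show ?thesis by (simp only: abs_mult) simp
      qed
      moreover have "\<bar>(p - c) $ 2\<bar> \<le> T - ln \<theta>"
        using that T ln\<theta> by (auto simp: c_def K_def strip_def abs_le_iff)
      ultimately show ?thesis
        using norm_le_l1_cart [of "p - c"] unfolding sum_2 R_def by linarith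
    qed
    then have "K n \<subseteq> cball c R" by (auto simp: dist_norm norm_minus_commute)
    then have "emeasure lborel (K n) \<le> emeasure lborel (cball c R)" by (intro emeasure_mono) auto
    also have "\<dots> = ennreal W" using R emeasure_cball [of R c] by (simp add: W_def)
    finally show ?thesis .
  qed
  have c: "0 \<le> 2 * contr2" "2 * contr2 < 1" using contr2 by auto
  have Ale: "emeasure lborel (A n) \<le> ennreal (W * (2 * contr2) ^ n)" for n
  proof -
    have "emeasure lborel (A n) \<le> ennreal (2 * contr2) ^ n * emeasure lborel (K n)"
      unfolding A_def
    proof (rule emeasure_iterated_preimage_le [where T = "\<lambda>n. strip \<theta> (a n)"])
      show "emeasure lborel E \<le> ennreal (2 * contr2) * emeasure lborel G"
        if "open E" "E \<subseteq> strip \<theta> (a n)" "open G" "planar e ` E \<subseteq> G" for n E G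
        by (rule planar_expansion_strip [OF e that(1,2) \<theta> that(3,4)])
    qed (use D a Kopen open_strip continuous_on_planar [OF e] in auto)
    also have "\<dots> \<le> ennreal (2 * contr2) ^ n * ennreal W" by (intro mult_left_mono KW) simp
    also have "\<dots> = ennreal (W * (2 * contr2) ^ n)"
      unfolding ennreal_power [OF c(1)] using W c(1) by (simp add: ennreal_mult mult.commute del: ennreal_power)
    finally show ?thesis .
  qed
  have Am: "A n \<in> sets lborel" for n
  proof -
    have "A n = D \<inter> (planar e ^^ n) -` K n" by (auto simp: A_def)
    moreover have "open (D \<inter> (planar e ^^ n) -` K n)"
      using D Kopen cont by (intro open_Int open_vimage) auto
    ultimately show ?thesis by simp
  qed
  have Dpos: "emeasure lborel D > 0" using r by (simp add: D_def emeasure_ball)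
  obtain p N where p: "p \<in> D" "\<And>n. n \<ge> N \<Longrightarrow> p \<notin> A n"
    by (rule exists_finitely_many_visits [OF _ Dpos Am Ale c W]) (use D in auto)
  define x' where "x' = (Z ^^ N) (emb e p)"
  have f: "(Z ^^ n) x' = (Z ^^ (n + N)) (emb e p)" for n by (simp add: x'_def funpow_add)
  have "(Z ^^ n) x' $ 3 \<ge> T" for n
  proof -
    have "(planar e ^^ (n + N)) p \<notin> K (n + N)" using p(2) [of "n + N"] p(1) by (simp add: A_def)
    moreover have "(planar e ^^ (n + N)) p \<in> strip \<theta> (a (n + N))" using a p(1) by blast
    ultimately have "(planar e ^^ (n + N)) p $ 2 \<ge> T" by (simp add: K_def)
    then have "emb e ((planar e ^^ (n + N)) p) $ 3 \<ge> T" by simp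
    then show ?thesis by (simp add: f emb_iter [OF e] del: emb_nth)
  qed
  then have fac: "norm ((Z ^^ Suc n) x') / C \<ge> 2" for n
  proof -
    have "2 * C \<le> M * exp ((Z ^^ n) x' $ 3)"
      using T \<open>\<And>n. (Z ^^ n) x' $ 3 \<ge> T\<close> [of n] M_pos
      by (meson exp_le_cancel_iff mult_le_cancel_left_pos order_trans)
    then show ?thesis using C_pos by (simp add: norm_Z field_simps)
  qed
  have "\<exists>B. \<forall>n. (\<Prod>j<n. norm ((Z ^^ Suc j) x') / C) \<le> B"
  proof (rule product_bounded_if_avoids_centres)
    show "open ((Z ^^ (N + 1)) ` V)" using open_iter_image assms(1) by blast
    show "x' \<in> (Z ^^ (N + 1)) ` V" using iter [OF p(1), of N] by (simp add: x'_def)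
    show "(Z ^^ n) ` (Z ^^ (N + 1)) ` V \<inter> centres = {}" for n
      using avoid [of "n + (N + 1)"] by (simp only: image_comp funpow_add)
  qed
  then obtain B where B: "(\<Prod>j<n. norm ((Z ^^ Suc j) x') / C) \<le> B" for n by blast
  have "2 ^ n \<le> B" for n
  proof -
    have "(2::real) ^ n = (\<Prod>j<n. 2)" by simp
    also have "\<dots> \<le> (\<Prod>j<n. norm ((Z ^^ Suc j) x') / C)"
      using fac by (intro prod_mono) (auto simp del: funpow.simps)
    finally show ?thesis using B [of n] by linarith
  qed
  moreover obtain n where "B < 2 ^ n" using real_arch_pow [of 2 B] by auto
  ultimately show False by (meson not_le)
qed

section \<open>Covering by orbits and the Julia set\<close>

lemma orbit_covers:
  assumes "open V" "V \<noteq> {}" "w \<noteq> 0"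
  shows "\<exists>n. w \<in> (Z ^^ n) ` V"
proof -
  obtain n y where y: "y \<in> (Z ^^ n) ` V" "y \<in> preplanes"
    using orbit_meets_preplanes [OF assms(1,2)] by blast
  have "\<exists>e. (e = 1 \<or> e = -1) \<and> Z y $ 2 = e * Z y $ 1"
  proof -
    obtain e k where "e = 1 \<or> e = -1" "y $ 1 + e * y $ 2 = 2 * of_int k * lam"
      using y(2) by (auto simp: preplanes_def mult_ac)
    from Z_preplane [OF this] show ?thesis by auto
  qed
  then obtain e where e: "e = 1 \<or> e = -1" "Z y $ 2 = e * Z y $ 1" by blast
  have "Z y \<in> (Z ^^ Suc n) ` V" using y by auto
  from orbit_meets_axis [OF open_iter_image [OF assms(1)] this e]
  obtain m z where z: "z \<in> (Z ^^ m) ` (Z ^^ Suc n) ` V" "hnorm z = 0" by blast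
  have "open ((Z ^^ m) ` (Z ^^ Suc n) ` V)" using assms(1) open_iter_image by blast
  from covers_of_axis_point [OF this z assms(3)]
  obtain k where "w \<in> (Z ^^ k) ` (Z ^^ m) ` (Z ^^ Suc n) ` V" by blast
  then have "w \<in> (Z ^^ (k + m + Suc n)) ` V"
    by (simp only: image_comp funpow_add o_assoc)
  then show ?thesis ..
qed

lemma julia_Z: "julia Z = UNIV"
proof -
  have "zero_cap (UNIV - (\<Union>k\<in>{1..}. (Z ^^ k) ` U))" if "open U" "x \<in> U" for U x
  proof (rule zero_cap_subset_origin)
    have "w \<in> (\<Union>k\<in>{1..}. (Z ^^ k) ` U)" if "w \<noteq> 0" for w
    proof -
      \<comment> \<open>\<open>julia\<close> counts iterates from 1, so the covering statement is
        applied to the image of \<open>U\<close> under \<open>Z\<close>.\<close>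
      obtain n where "w \<in> (Z ^^ n) ` (Z ` U)"
        using orbit_covers [of "Z ` U" w] open_Z_image \<open>open U\<close> \<open>x \<in> U\<close> \<open>w \<noteq> 0\<close> by blast
      then have "w \<in> (Z ^^ Suc n) ` U" by (simp only: funpow_Suc_right image_comp)
      then show ?thesis by (intro UN_I [of "Suc n"]) auto
    qed
    then show "UNIV - (\<Union>k\<in>{1..}. (Z ^^ k) ` U) \<subseteq> {0}" by blast
  qed
  then show ?thesis by (auto simp: julia_def)
qed

end

theorem theorem1p1:
  fixes hh :: "real^2 \<Rightarrow> real^3" and L lam nu :: real
  assumes L1: "L \<ge> 1"
    and bilip: "\<forall>a\<in>sqQ. \<forall>b\<in>sqQ. dist a b / L \<le> dist (hh a) (hh b) \<and> dist (hh a) (hh b) \<le> L * dist a b"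
    and onto: "hh ` sqQ = upper_hemisphere"
    and bd: "hh ` frontier sqQ = equator"
    and sp: "sense_preserving_hemi hh"
    and diag: "\<forall>t\<in>{-1..1}. hh (vector [t, t]) $ 1 = hh (vector [t, t]) $ 2"
    and antidiag: "\<forall>t\<in>{-1..1}. hh (vector [t, -t]) $ 1 = - (hh (vector [t, -t]) $ 2)"
    and lam1: "lam \<ge> 1"
    and lamL: "lam > L ^ 5"
    and nu: "nu > sqrt (2 * L / lam)"
  shows "julia (zorich nu lam hh) = UNIV \<and>
         (\<forall>V. open V \<and> V \<noteq> {} \<longrightarrow>
              UNIV - {0} \<subseteq> (\<Union>n. (zorich nu lam hh ^^ n) ` V))"
proof -
  interpret zorich_map hh L lam nu
    using assms by unfold_locales
  show ?thesis using julia_Z orbit_covers by blast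
qed

end
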